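(* Let $\Delta$ be a building of type $(W,S)$. Then parallelism is an equivalence relation on the set of residues of $\Delta$ if and only if every spherical residue of rank $2$ of $\Delta$ is either thin or right-angled.
   Context: Coxeter data: $S$ is a set, $M=\{m_{r,s}\}_{r,s\in S}$ is a Coxeter matrix (symmetric, entries in $\mathbb{N}\cup\{\infty\}$, $m_{s,s}=1$, $m_{r,s}\ge 2$ for $r\ne s$), and $W=\langle s\in S\mid (rs)^{m_{r,s}}=1 \text{ for all } r,s\in S\rangle$ (no relation when $m_{r,s}=\infty$). For $I\subset S$, $W_I$ is the subgroup generated by $I$; $(W_I,I)$ is again a Coxeter system. It is spherical if the group is finite, and right-angled if $m_{r,s}\in\{2,\infty\}$ for all distinct $r,s$ in its generating set. Chamber systems: a chamber system over $S$ is a set (of chambers) with a family of partitions indexed by $S$; chambers $c,c'$ in the same class of the partition indexed by $s$ are called $s$-adjacent ($c\sim_s c'$), and adjacent if they are $s$-adjacent for some $s$. Any subset inherits a chamber system structure. A gallery is a finite sequence of consecutively adjacent chambers; $d_c(x,y)$ is the length of a shortest gallery from $x$ to $y$. For $I\subset S$, an $I$-residue (residue of type $I$) is a connected component for galleries using only adjacencies of types in $I$; its rank is $\#I$; residues of rank $1$ are called panels. $\Sigma(W,S)$ is the chamber system on the set $W$ in which $w\sim_s w'$ iff $w'\in\{w,ws\}$. Buildings: a chamber system $\Delta$ over $S$ is a building of type $(W,S)$ if it admits a maximal family of subsystems isomorphic to $\Sigma(W,S)$ (apartments) such that any two chambers lie in a common apartment and for any apartments $A,B$ there is an isomorphism $A\to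 B$ fixing $A\cap B$. An $I$-residue of $\Delta$ is itself a building of type $(W_I,I)$; it is called spherical (resp. right-angled) if $(W_I,I)$ is, and thin if each of its panels contains exactly two chambers. Projections and parallelism: for a residue $R$ and a chamber $x$ of $\Delta$, $\mathrm{proj}_R(x)$ is the unique chamber of $R$ at minimal distance $d_c$ from $x$. For residues $R,Q$, $\mathrm{proj}_R(Q)=\{\mathrm{proj}_R(x):x\in Q\}$. $R$ and $Q$ are parallel if $\mathrm{proj}_R(Q)=R$ and $\mathrm{proj}_Q(R)=Q$.
   Formalization: In the definition of a building, the isomorphism A→B fixing A∩B must fix not only common chambers but also every residue meeting both A and B (the usual simplicial sense); fixing chambers alone admits non-buildings in which projections are not unique. *)

theory Defs
  imports
    "HOL-Algebra.Generated_Groups"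
    "HOL-Library.Extended_Nat"
    "HOL-Library.Disjoint_Sets"
begin

section \<open>Groups given by generators and relators\<close>

text \<open>The letter \<open>(s, True)\<close> stands for the generator \<open>s\<close> and \<open>(s, False)\<close> for its formal inverse.\<close>

type_synonym 's word = "('s \<times> bool) list"

abbreviation words :: "'s set \<Rightarrow> 's word set" where
  "words S \<equiv> lists (S \<times> UNIV)"

inductive_set pres_rel :: "'s set \<Rightarrow> 's word set \<Rightarrow> ('s word \<times> 's word) set"
  for S :: "'s set" and R :: "'s word set" where
  pres_refl: "u \<in> words S \<Longrightarrow> (u, u) \<in> pres_rel S R"
| pres_sym: "(u, v) \<in> pres_rel S R \<Longrightarrow> (v, u) \<in> pres_rel S R"
| pres_trans: "(u, v) \<in> pres_rel S R \<Longrightarrow> (v, w) \<in> pres_rel S R \<Longrightarrow> (u, w) \<in> pres_rel S R"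
| pres_cancel: "u \<in> words S \<Longrightarrow> v \<in> words S \<Longrightarrow> s \<in> S \<Longrightarrow>
    (u @ [(s, b), (s, \<not> b)] @ v, u @ v) \<in> pres_rel S R"
| pres_relator: "u \<in> words S \<Longrightarrow> v \<in> words S \<Longrightarrow> r \<in> R \<Longrightarrow> r \<in> words S \<Longrightarrow>
    (u @ r @ v, u @ v) \<in> pres_rel S R"

definition presented_group :: "'s set \<Rightarrow> 's word set \<Rightarrow> 's word set monoid" where
  "presented_group S R =
    \<lparr> carrier = words S // pres_rel S R,
      mult = (\<lambda>X Y. \<Union>x\<in>X. \<Union>y\<in>Y. pres_rel S R `` {x @ y}),
      one = pres_rel S R `` {[]} \<rparr>"

lemma pres_rel_words:
  "(u, v) \<in> pres_rel S R \<Longrightarrow> u \<in> words S \<and> v \<in> words S"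
  by (induction rule: pres_rel.induct) auto

lemma equiv_pres_rel: "equiv (words S) (pres_rel S R)"
proof (rule equivI)
  show "pres_rel S R \<subseteq> words S \<times> words S"
    using pres_rel_words by fast
  show "refl_on (words S) (pres_rel S R)"
    by (rule refl_onI) (rule pres_refl)
  show "sym (pres_rel S R)"
    by (rule symI) (rule pres_sym)
  show "trans (pres_rel S R)"
    by (rule transI) (rule pres_trans)
qed

lemma pres_rel_context:
  assumes "(u, v) \<in> pres_rel S R" "a \<in> words S" "b \<in> words S"
  shows "(a @ u @ b, a @ v @ b) \<in> pres_rel S R"
  using assms
proof (induction rule: pres_rel.induct)
  case (pres_refl u)
  then show ?case by (intro pres_rel.pres_refl) auto
next
  case (pres_sym u v)
  then show ?case by (blast intro: pres_rel.pres_sym)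
next
  case (pres_trans u v w)
  then show ?case by (blast intro: pres_rel.pres_trans)
next
  case (pres_cancel u v s c)
  then show ?case
    using pres_rel.pres_cancel[of "a @ u" S "v @ b" s c R] by simp
next
  case (pres_relator u v r)
  then show ?case
    using pres_rel.pres_relator[of "a @ u" S "v @ b" r R] by simp
qed

lemma pres_rel_append:
  assumes "(u, u') \<in> pres_rel S R" "(v, v') \<in> pres_rel S R"
  shows "(u @ v, u' @ v') \<in> pres_rel S R"
proof -
  have "(u @ v, u' @ v) \<in> pres_rel S R"
    using pres_rel_context[OF assms(1), of "[]" v] pres_rel_words[OF assms(2)] by simp
  moreover have "(u' @ v, u' @ v') \<in> pres_rel S R"
    using pres_rel_context[OF assms(2), of u' "[]"] pres_rel_words[OF assms(1)] by simp
  ultimately show ?thesis by (rule pres_trans)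
qed

lemma presented_group_mult:
  assumes "u \<in> words S" "v \<in> words S"
  shows "mult (presented_group S R) (pres_rel S R `` {u}) (pres_rel S R `` {v}) =
    pres_rel S R `` {u @ v}"
proof -
  have "congruent2 (pres_rel S R) (pres_rel S R) (\<lambda>x y. pres_rel S R `` {x @ y})"
    by (intro congruent2I' equiv_class_eq[OF equiv_pres_rel] pres_rel_append)
  from UN_equiv_class2[OF equiv_pres_rel equiv_pres_rel this assms] show ?thesis
    by (simp add: presented_group_def)
qed

lemma presented_group_carrier:
  "x \<in> carrier (presented_group S R) \<longleftrightarrow> (\<exists>u\<in>words S. x = pres_rel S R `` {u})"
  by (auto simp: presented_group_def quotient_def)

lemma words_inverse:
  "u \<in> words S \<Longrightarrow> rev (map (\<lambda>(s, b). (s, \<not> b)) u) \<in> words S"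
  by (induction u rule: lists.induct) auto

lemma presented_group_inverse:
  assumes "u \<in> words S"
  shows "(rev (map (\<lambda>(s, b). (s, \<not> b)) u) @ u, []) \<in> pres_rel S R"
  using assms
proof (induction u rule: lists.induct)
  case Nil
  then show ?case by (simp add: pres_refl)
next
  case (Cons l u)
  obtain s b where l: "l = (s, b)" by force
  let ?w = "rev (map (\<lambda>(s, b). (s, \<not> b)) u)"
  have "u \<in> words S" "s \<in> S" using Cons.hyps l by auto
  then have "(?w @ [(s, \<not> b), (s, \<not> \<not> b)] @ u, ?w @ u) \<in> pres_rel S R"
    by (intro pres_cancel words_inverse)
  from pres_trans[OF this Cons.IH] show ?case by (simp add: l)
qed

lemma group_presented_group: "group (presented_group S R)"
proof (rule groupI)
  let ?G = "presented_group S R"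
  have one: "\<one>\<^bsub>?G\<^esub> = pres_rel S R `` {[]}" by (simp add: presented_group_def)
  show "\<one>\<^bsub>?G\<^esub> \<in> carrier ?G"
    unfolding presented_group_carrier one by (intro bexI[of _ "[]"] refl) simp
  fix x assume x: "x \<in> carrier ?G"
  then obtain u where u: "u \<in> words S" "x = pres_rel S R `` {u}"
    unfolding presented_group_carrier by blast
  show "\<one>\<^bsub>?G\<^esub> \<otimes>\<^bsub>?G\<^esub> x = x"
    using presented_group_mult[of "[]" S u R] u one by simp
  let ?w = "rev (map (\<lambda>(s, b). (s, \<not> b)) u)"
  have w: "?w \<in> words S" by (rule words_inverse[OF u(1)])
  have "pres_rel S R `` {?w} \<otimes>\<^bsub>?G\<^esub> x = \<one>\<^bsub>?G\<^esub>"
    unfolding u(2) presented_group_mult[OF w u(1)] one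
    by (rule equiv_class_eq[OF equiv_pres_rel presented_group_inverse[OF u(1)]])
  moreover have "pres_rel S R `` {?w} \<in> carrier ?G"
    unfolding presented_group_carrier using w by (intro bexI[of _ ?w] refl)
  ultimately show "\<exists>y\<in>carrier ?G. y \<otimes>\<^bsub>?G\<^esub> x = \<one>\<^bsub>?G\<^esub>"
    by (intro bexI)
  fix y assume "y \<in> carrier ?G"
  then obtain v where v: "v \<in> words S" "y = pres_rel S R `` {v}"
    unfolding presented_group_carrier by blast
  have uv: "u @ v \<in> words S" using u v by simp
  show "x \<otimes>\<^bsub>?G\<^esub> y \<in> carrier ?G"
    unfolding presented_group_carrier u(2) v(2) presented_group_mult[OF u(1) v(1)]
    using uv by (intro bexI[of _ "u @ v"] refl)
  fix z assume "z \<in> carrier ?G"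
  then obtain t where t: "t \<in> words S" "z = pres_rel S R `` {t}"
    unfolding presented_group_carrier by blast
  have vt: "v @ t \<in> words S" using t v by simp
  show "x \<otimes>\<^bsub>?G\<^esub> y \<otimes>\<^bsub>?G\<^esub> z = x \<otimes>\<^bsub>?G\<^esub> (y \<otimes>\<^bsub>?G\<^esub> z)"
    unfolding u(2) v(2) t(2) presented_group_mult[OF u(1) v(1)] presented_group_mult[OF v(1) t(1)]
      presented_group_mult[OF uv t(1)] presented_group_mult[OF u(1) vt] by simp
qed

section \<open>Coxeter groups\<close>

definition coxeter_matrix :: "'s set \<Rightarrow> ('s \<Rightarrow> 's \<Rightarrow> enat) \<Rightarrow> bool" where
  "coxeter_matrix S m \<longleftrightarrow>
    (\<forall>r\<in>S. \<forall>s\<in>S. m r s = m s r) \<and>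
    (\<forall>s\<in>S. m s s = 1) \<and>
    (\<forall>r\<in>S. \<forall>s\<in>S. r \<noteq> s \<longrightarrow> 2 \<le> m r s)"

definition coxeter_relators :: "'s set \<Rightarrow> ('s \<Rightarrow> 's \<Rightarrow> enat) \<Rightarrow> 's word set" where
  "coxeter_relators S m =
    {concat (replicate n [(r, True), (s, True)]) | r s n. r \<in> S \<and> s \<in> S \<and> m r s = enat n}"

definition coxeter_group :: "'s set \<Rightarrow> ('s \<Rightarrow> 's \<Rightarrow> enat) \<Rightarrow> 's word set monoid" where
  "coxeter_group S m = presented_group S (coxeter_relators S m)"

definition coxeter_gen :: "'s set \<Rightarrow> ('s \<Rightarrow> 's \<Rightarrow> enat) \<Rightarrow> 's \<Rightarrow> 's word set" where
  "coxeter_gen S m s = pres_rel S (coxeter_relators S m) `` {[(s, True)]}"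

definition parabolic :: "'s set \<Rightarrow> ('s \<Rightarrow> 's \<Rightarrow> enat) \<Rightarrow> 's set \<Rightarrow> 's word set set" where
  "parabolic S m I = generate (coxeter_group S m) (coxeter_gen S m ` I)"

definition spherical :: "'s set \<Rightarrow> ('s \<Rightarrow> 's \<Rightarrow> enat) \<Rightarrow> 's set \<Rightarrow> bool" where
  "spherical S m I \<longleftrightarrow> finite (parabolic S m I)"

definition right_angled :: "('s \<Rightarrow> 's \<Rightarrow> enat) \<Rightarrow> 's set \<Rightarrow> bool" where
  "right_angled m I \<longleftrightarrow> (\<forall>r\<in>I. \<forall>s\<in>I. r \<noteq> s \<longrightarrow> m r s \<in> {2, \<infinity>})"

section \<open>Chamber systems\<close>

text \<open>\<open>adj_classes \<Delta> s\<close> is the partition of the chambers indexed by \<open>s\<close>.\<close>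

record ('c, 's) chamber_system =
  chambers :: "'c set"
  adj_classes :: "'s \<Rightarrow> 'c set set"

definition is_chamber_system :: "'s set \<Rightarrow> ('c, 's) chamber_system \<Rightarrow> bool" where
  "is_chamber_system S \<Delta> \<longleftrightarrow> (\<forall>s\<in>S. partition_on (chambers \<Delta>) (adj_classes \<Delta> s))"

definition adj :: "('c, 's) chamber_system \<Rightarrow> 's \<Rightarrow> 'c \<Rightarrow> 'c \<Rightarrow> bool" where
  "adj \<Delta> s x y \<longleftrightarrow> (\<exists>P\<in>adj_classes \<Delta> s. x \<in> P \<and> y \<in> P)"

definition subsystem :: "('c, 's) chamber_system \<Rightarrow> 'c set \<Rightarrow> ('c, 's) chamber_system" where
  "subsystem \<Delta> A =
    \<lparr> chambers = A, adj_classes = (\<lambda>s. {P \<inter> A | P. P \<in> adj_classes \<Delta> s} - {{}}) \<rparr>"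

definition chamber_iso ::
  "'s set \<Rightarrow> ('c, 's) chamber_system \<Rightarrow> ('d, 's) chamber_system \<Rightarrow> ('c \<Rightarrow> 'd) \<Rightarrow> bool" where
  "chamber_iso S \<Delta> \<Delta>' f \<longleftrightarrow>
    bij_betw f (chambers \<Delta>) (chambers \<Delta>') \<and>
    (\<forall>s\<in>S. \<forall>x\<in>chambers \<Delta>. \<forall>y\<in>chambers \<Delta>. adj \<Delta> s x y \<longleftrightarrow> adj \<Delta>' s (f x) (f y))"

definition is_gallery :: "('c, 's) chamber_system \<Rightarrow> 's set \<Rightarrow> 'c \<Rightarrow> 'c \<Rightarrow> 'c list \<Rightarrow> bool" where
  "is_gallery \<Delta> I x y cs \<longleftrightarrow>
    cs \<noteq> [] \<and> hd cs = x \<and> last cs = y \<and> set cs \<subseteq> chambers \<Delta> \<and>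
    successively (\<lambda>c d. \<exists>s\<in>I. adj \<Delta> s c d) cs"

text \<open>A gallery through \<open>n + 1\<close> chambers has length \<open>n\<close>. If no gallery joins the two chambers
  (which does not happen in a building) the value is unspecified.\<close>

definition chamber_dist :: "'s set \<Rightarrow> ('c, 's) chamber_system \<Rightarrow> 'c \<Rightarrow> 'c \<Rightarrow> nat" where
  "chamber_dist S \<Delta> x y = (LEAST n. \<exists>cs. is_gallery \<Delta> S x y cs \<and> length cs = Suc n)"

definition is_residue :: "('c, 's) chamber_system \<Rightarrow> 's set \<Rightarrow> 'c set \<Rightarrow> bool" where
  "is_residue \<Delta> I R \<longleftrightarrow> (\<exists>x\<in>chambers \<Delta>. R = {y. \<exists>cs. is_gallery \<Delta> I x y cs})"

definition residues_of :: "'s set \<Rightarrow> ('c, 's) chamber_system \<Rightarrow> 'c set set" where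
  "residues_of S \<Delta> = {R. \<exists>I\<subseteq>S. is_residue \<Delta> I R}"

text \<open>The panels of an \<open>I\<close>-residue are the panels of \<open>\<Delta>\<close> of type in \<open>I\<close> contained in it.\<close>

definition thin :: "('c, 's) chamber_system \<Rightarrow> 's set \<Rightarrow> 'c set \<Rightarrow> bool" where
  "thin \<Delta> I R \<longleftrightarrow> (\<forall>s\<in>I. \<forall>P. is_residue \<Delta> {s} P \<and> P \<subseteq> R \<longrightarrow> card P = 2)"

lemma is_chamber_system_subsystem:
  assumes "is_chamber_system S \<Delta>" "A \<subseteq> chambers \<Delta>"
  shows "is_chamber_system S (subsystem \<Delta> A)"
  unfolding is_chamber_system_def
proof
  fix s assume "s \<in> S"
  then have p: "partition_on (chambers \<Delta>) (adj_classes \<Delta> s)"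
    using assms(1) by (simp add: is_chamber_system_def)
  have "{P \<inter> A | P. P \<in> adj_classes \<Delta> s} = (\<inter>) A ` adj_classes \<Delta> s"
    by (auto simp: Int_commute)
  with partition_on_restrict[OF p, of A] assms(2)
  show "partition_on (chambers (subsystem \<Delta> A)) (adj_classes (subsystem \<Delta> A) s)"
    by (simp add: subsystem_def Int_absorb2)
qed

lemma adj_subsystem:
  "adj (subsystem \<Delta> A) s x y \<longleftrightarrow> x \<in> A \<and> y \<in> A \<and> adj \<Delta> s x y"
  unfolding adj_def subsystem_def by auto

section \<open>Buildings\<close>

definition coxeter_chambers ::
    "'s set \<Rightarrow> ('s \<Rightarrow> 's \<Rightarrow> enat) \<Rightarrow> ('s word set, 's) chamber_system" where
  "coxeter_chambers S m =
    \<lparr> chambers = carrier (coxeter_group S m),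
      adj_classes = (\<lambda>s. {{w, w \<otimes>\<^bsub>coxeter_group S m\<^esub> coxeter_gen S m s} | w.
        w \<in> carrier (coxeter_group S m)}) \<rparr>"

text \<open>An isomorphism of apartments fixing \<open>A \<inter> B\<close> has to fix \<open>A\<close> and \<open>B\<close>'s common simplices of
  every dimension, and not just their common chambers. The simplices of a building are its
  residues; a residue \<open>R\<close> lies in the apartment \<open>A\<close> as a simplex iff it meets \<open>A\<close>, and \<open>f\<close> fixes it
  iff it takes the residue \<open>R \<inter> A\<close> of \<open>A\<close> to the residue \<open>R \<inter> B\<close> of \<open>B\<close>.
  Fixing common chambers alone would not be enough: gluing together apartments freely along
  single chambers satisfies the resulting axioms, but in the chamber systems so obtained a residue
  can contain several chambers nearest to a given one.\<close>

definition fixes_intersection ::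
  "'s set \<Rightarrow> ('c, 's) chamber_system \<Rightarrow> 'c set \<Rightarrow> 'c set \<Rightarrow> ('c \<Rightarrow> 'c) \<Rightarrow> bool" where
  "fixes_intersection S \<Delta> A B f \<longleftrightarrow>
    (\<forall>x\<in>A \<inter> B. f x = x) \<and>
    (\<forall>R\<in>residues_of S \<Delta>. R \<inter> A \<noteq> {} \<and> R \<inter> B \<noteq> {} \<longrightarrow> f ` (R \<inter> A) = R \<inter> B)"

definition apartment_system ::
  "'s set \<Rightarrow> ('s \<Rightarrow> 's \<Rightarrow> enat) \<Rightarrow> ('c, 's) chamber_system \<Rightarrow> 'c set set \<Rightarrow> bool" where
  "apartment_system S m \<Delta> \<A> \<longleftrightarrow>
    (\<forall>A\<in>\<A>. A \<subseteq> chambers \<Delta> \<and> (\<exists>f. chamber_iso S (coxeter_chambers S m) (subsystem \<Delta> A) f)) \<and>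
    (\<forall>x\<in>chambers \<Delta>. \<forall>y\<in>chambers \<Delta>. \<exists>A\<in>\<A>. x \<in> A \<and> y \<in> A) \<and>
    (\<forall>A\<in>\<A>. \<forall>B\<in>\<A>. \<exists>f. chamber_iso S (subsystem \<Delta> A) (subsystem \<Delta> B) f \<and>
      fixes_intersection S \<Delta> A B f)"

definition building ::
  "'s set \<Rightarrow> ('s \<Rightarrow> 's \<Rightarrow> enat) \<Rightarrow> ('c, 's) chamber_system \<Rightarrow> bool" where
  "building S m \<Delta> \<longleftrightarrow>
    is_chamber_system S \<Delta> \<and>
    (\<exists>\<A>. apartment_system S m \<Delta> \<A> \<and>
      (\<forall>\<B>. apartment_system S m \<Delta> \<B> \<and> \<A> \<subseteq> \<B> \<longrightarrow> \<B> = \<A>))"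

section \<open>Projections and parallelism\<close>

definition proj :: "'s set \<Rightarrow> ('c, 's) chamber_system \<Rightarrow> 'c set \<Rightarrow> 'c \<Rightarrow> 'c" where
  "proj S \<Delta> R x =
    (THE c. c \<in> R \<and> (\<forall>d\<in>R. chamber_dist S \<Delta> x c \<le> chamber_dist S \<Delta> x d))"

definition parallel :: "'s set \<Rightarrow> ('c, 's) chamber_system \<Rightarrow> 'c set \<Rightarrow> 'c set \<Rightarrow> bool" where
  "parallel S \<Delta> R Q \<longleftrightarrow> proj S \<Delta> R ` Q = R \<and> proj S \<Delta> Q ` R = Q"

definition parallelism :: "'s set \<Rightarrow> ('c, 's) chamber_system \<Rightarrow> ('c set \<times> 'c set) set" where
  "parallelism S \<Delta> =
    {(R, Q). R \<in> residues_of S \<Delta> \<and> Q \<in> residues_of S \<Delta> \<and> parallel S \<Delta> R Q}"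

end

(* Apartments turn a building into a set with a Weyl distance delta. Two panels, of types s and t,
   are parallel iff s w = w t for the Weyl distance w between a chamber of one and a chamber of the
   other, and residues are parallel iff the projections between them are non-constant on every panel.
   Transitivity thus reduces to panels, and by induction on the distance (an r-descent of w replaces a
   panel of type s by a nearer parallel one inside a common residue of type {s, r}, which is then
   spherical) to panels within a spherical residue of rank 2. There it holds if the residue is
   right-angled (panels of the same type are all parallel) or thin (a panel has a unique opposite).
   If an s-panel of a spherical, not right-angled {s, r}-residue has three chambers x1, x2, x3, some
   chamber is opposite both x2 and x3, so the r-panels of x2 and x3 are parallel to a common panel,
   but they are not parallel to each other.
   On the group side this needs the exchange condition, read off the presentation by letting W act
   on reflections with signs, and the Tits representation, which shows that r and s commute only if
   m r s = 2 and that r s has infinite order if m r s is infinite. *)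

theory Submission
  imports Defs Complex_Main
begin

section \<open>Permutations and the left regular representation of a Coxeter group\<close>

text \<open>The obstacle to the induction on distance is that the nearer panel is obtained as a
  parallel of its predecessor, whereas it must be parallel to the fixed first panel P0. So P0 is
  projected to the rank 2 residue R in which the replacement takes place. The image is a panel of R,
  parallel to P0 and to the old panel, and the comparison becomes one of three panels of R. Since
  projections to panels of R factor through R, the result returns to P0. Such an R is spherical
  because two distinct parallel panels in a residue of rank 2 yield a braid relation. The relation
  \<open>separates\<close> (a projection is not constant on a panel) mediates between panels and
  residues: it survives enlarging the residue onto which one projects, which parallelism does not.
  Apartments enter through one delicate point. Adjacent chambers \<open>x\<close>, \<open>x'\<close>
  need not lie in a common apartment with \<open>y\<close>; the clause on residues in
  \<open>fixes_intersection\<close>, applied to a panel, supplies a substitute for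
  \<open>x'\<close>. All groups are realised by permutations of a type, so that words become sums in
  \<open>group_add\<close> and three actions (regular, on signed reflections, Tits) can be treated
  alike.\<close>

typedef 'a symm = "{f :: 'a \<Rightarrow> 'a. bij f}"
  morphisms app Symm
  by (rule exI[of _ id]) simp

instantiation symm :: (type) group_add
begin

definition zero_symm :: "'a symm" where
  "zero_symm = Symm id"

definition plus_symm :: "'a symm \<Rightarrow> 'a symm \<Rightarrow> 'a symm" where
  "plus_symm p q = Symm (app p \<circ> app q)"

definition uminus_symm :: "'a symm \<Rightarrow> 'a symm" where
  "uminus_symm p = Symm (inv_into UNIV (app p))"

definition minus_symm :: "'a symm \<Rightarrow> 'a symm \<Rightarrow> 'a symm" where
  "minus_symm p q = p + - q"

lemma app_Symm: "bij f \<Longrightarrow> app (Symm f) = f"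
  by (rule Symm_inverse) simp

lemma bij_app: "bij (app p)"
  using app by auto

lemma app_zero [simp]: "app 0 = id"
  by (simp add: zero_symm_def app_Symm)

lemma app_plus [simp]: "app (p + q) = app p \<circ> app q"
  by (simp add: plus_symm_def app_Symm bij_app bij_comp)

lemma app_uminus: "app (- p) = inv_into UNIV (app p)"
  by (simp add: uminus_symm_def app_Symm bij_app bij_imp_bij_inv)

instance
proof
  fix p q r :: "'a symm"
  show "p + q + r = p + (q + r)"
    by (simp add: app_inject[symmetric] comp_assoc)
  show "0 + p = p" "p + 0 = p"
    by (simp_all add: app_inject[symmetric])
  show "- p + p = 0"
    using bij_app[of p] by (simp add: app_inject[symmetric] app_uminus bij_is_inj)
  show "p + - q = p - q"
    by (simp add: minus_symm_def)
qed

end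

lemma symm_eqI: "(\<And>x. app p x = app q x) \<Longrightarrow> p = q"
  by (simp add: app_inject[symmetric] fun_eq_iff)

lemma app_Symm_involution:
  assumes "\<And>x. f (f x) = x"
  shows "app (Symm f) = f" and "Symm f + Symm f = 0"
proof -
  have "bij f" using assms by (metis involuntory_imp_bij)
  then show "app (Symm f) = f" by (rule app_Symm)
  then show "Symm f + Symm f = 0" using assms by (intro symm_eqI) simp
qed

text \<open>The identity outside the carrier makes left translation a bijection of the whole type,
  as \<open>symm\<close> requires.\<close>

definition reg :: "('a, 'b) monoid_scheme \<Rightarrow> 'a \<Rightarrow> 'a symm" where
  "reg G x = Symm (\<lambda>y. if y \<in> carrier G then x \<otimes>\<^bsub>G\<^esub> y else y)"

context group
begin

lemma app_reg:
  assumes "x \<in> carrier G"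
  shows "app (reg G x) y = (if y \<in> carrier G then x \<otimes> y else y)"
proof -
  have *: "inv x \<otimes> (x \<otimes> y) = y" "x \<otimes> (inv x \<otimes> y) = y" if "y \<in> carrier G" for y
    using that assms m_assoc[of "inv x" x y] m_assoc[of x "inv x" y] by auto
  have "bij (\<lambda>y. if y \<in> carrier G then x \<otimes> y else y)"
    by (rule o_bij[of "\<lambda>y. if y \<in> carrier G then inv x \<otimes> y else y"])
      (use assms in \<open>auto simp: fun_eq_iff *\<close>)
  then show ?thesis by (simp add: reg_def app_Symm)
qed

lemma reg_mult:
  "x \<in> carrier G \<Longrightarrow> y \<in> carrier G \<Longrightarrow> reg G (x \<otimes> y) = reg G x + reg G y"
  by (rule symm_eqI) (simp add: app_reg m_assoc)

lemma reg_one: "reg G \<one> = 0"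
  by (rule symm_eqI) (simp add: app_reg)

lemma reg_eq_iff:
  assumes "x \<in> carrier G" "y \<in> carrier G"
  shows "reg G x = reg G y \<longleftrightarrow> x = y"
proof
  assume "reg G x = reg G y"
  then have "app (reg G x) \<one> = app (reg G y) \<one>" by simp
  then show "x = y" using assms by (simp add: app_reg)
qed simp

end

section \<open>Evaluation of words and the universal property of the presentation\<close>

definition wval :: "('s \<Rightarrow> 'x::group_add) \<Rightarrow> 's word \<Rightarrow> 'x" where
  "wval h u = (\<Sum>(s, b)\<leftarrow>u. if b then h s else - h s)"

lemma wval_simps [simp]:
  "wval h [] = 0"
  "wval h ((s, b) # u) = (if b then h s else - h s) + wval h u"
  "wval h (u @ v) = wval h u + wval h v"
  by (simp_all add: wval_def)

abbreviation posw :: "'s list \<Rightarrow> 's word" where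
  "posw \<equiv> map (\<lambda>s. (s, True))"

lemma wval_posw: "wval h (posw u) = (\<Sum>s\<leftarrow>u. h s)"
  by (induction u) simp_all

abbreviation nmul :: "nat \<Rightarrow> 'x::group_add \<Rightarrow> 'x" where
  "nmul n x \<equiv> sum_list (replicate n x)"

text \<open>Each rule that generates the congruence preserves the value: cancellation because
  \<open>h s\<close> and \<open>- h s\<close> are inverse, insertion of a relator because its value
  is 0.\<close>

lemma pres_rel_wval:
  assumes "(u, v) \<in> pres_rel S R" "\<And>r. r \<in> R \<Longrightarrow> wval h r = 0"
  shows "wval h u = wval h v"
  using assms(1)
  by (induction rule: pres_rel.induct) (auto simp: assms(2) add.assoc[symmetric])

lemma wval_coxeter_relators:
  assumes "\<And>r s n. r \<in> S \<Longrightarrow> s \<in> S \<Longrightarrow> m r s = enat n \<Longrightarrow> nmul n (h r + h s) = 0"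
    and "w \<in> coxeter_relators S m"
  shows "wval h w = 0"
proof -
  obtain r s n where w: "r \<in> S" "s \<in> S" "m r s = enat n"
    "w = concat (replicate n [(r, True), (s, True)])"
    using assms(2) by (auto simp: coxeter_relators_def)
  have "wval h (concat (replicate k [(r, True), (s, True)])) = nmul k (h r + h s)" for k
    by (induction k) (simp_all add: add.assoc)
  then show ?thesis using assms(1) w by simp
qed

text \<open>The Coxeter group is replaced by its left regular representation, whose ambient type is
  of class \<open>group_add\<close>: no side conditions about carriers are needed there.\<close>

definition cgen :: "'s set \<Rightarrow> ('s \<Rightarrow> 's \<Rightarrow> enat) \<Rightarrow> 's \<Rightarrow> 's word set symm" where
  "cgen S m s = reg (coxeter_group S m) (coxeter_gen S m s)"

definition cls :: "'s set \<Rightarrow> ('s \<Rightarrow> 's \<Rightarrow> enat) \<Rightarrow> 's list \<Rightarrow> 's word set" where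
  "cls S m u = pres_rel S (coxeter_relators S m) `` {posw u}"

lemma group_coxeter_group: "group (coxeter_group S m)"
  unfolding coxeter_group_def by (rule group_presented_group)

lemma posw_words [simp]: "posw u \<in> words S \<longleftrightarrow> u \<in> lists S"
  by (induction u) auto

lemma cls_closed: "u \<in> lists S \<Longrightarrow> cls S m u \<in> carrier (coxeter_group S m)"
  unfolding coxeter_group_def presented_group_carrier cls_def by (rule bexI[of _ "posw u"]) auto

lemma cls_append:
  assumes "u \<in> lists S" "v \<in> lists S"
  shows "cls S m (u @ v) = cls S m u \<otimes>\<^bsub>coxeter_group S m\<^esub> cls S m v"
  using presented_group_mult[of "posw u" S "posw v"] assms
  unfolding coxeter_group_def cls_def by simp

lemma coxeter_gen_cls: "coxeter_gen S m s = cls S m [s]"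
  by (simp add: coxeter_gen_def cls_def)

lemma reg_cls:
  assumes "u \<in> lists S"
  shows "reg (coxeter_group S m) (cls S m u) = (\<Sum>s\<leftarrow>u. cgen S m s)"
  using assms
proof (induction u)
  case Nil
  have "cls S m [] = \<one>\<^bsub>coxeter_group S m\<^esub>"
    by (simp add: coxeter_group_def presented_group_def cls_def)
  then show ?case by (simp add: group.reg_one[OF group_coxeter_group])
next
  case (Cons s u)
  then have s: "[s] \<in> lists S" and u: "u \<in> lists S" by auto
  have "reg (coxeter_group S m) (cls S m ([s] @ u)) =
      reg (coxeter_group S m) (cls S m [s]) + reg (coxeter_group S m) (cls S m u)"
    unfolding cls_append[OF s u]
    by (rule group.reg_mult[OF group_coxeter_group cls_closed[OF s] cls_closed[OF u]])
  then show ?case using Cons.IH u by (simp add: cgen_def coxeter_gen_cls)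
qed

lemma cls_eq_iff:
  assumes "u \<in> lists S" "v \<in> lists S"
  shows "cls S m u = cls S m v \<longleftrightarrow> (\<Sum>s\<leftarrow>u. cgen S m s) = (\<Sum>s\<leftarrow>v. cgen S m s)"
  using group.reg_eq_iff[OF group_coxeter_group cls_closed[OF assms(1)] cls_closed[OF assms(2)]]
  by (simp add: reg_cls assms)

text \<open>Equality in the regular representation is equality of word classes, hence of values
  under any \<open>h\<close> that respects the Coxeter relations. The action on signed reflections
  and the Tits representation are the two instances used below.\<close>

lemma coxeter_universal:
  assumes "\<And>r s n. r \<in> S \<Longrightarrow> s \<in> S \<Longrightarrow> m r s = enat n \<Longrightarrow> nmul n (h r + h s) = 0"
    and "u \<in> lists S" "v \<in> lists S" "(\<Sum>s\<leftarrow>u. cgen S m s) = (\<Sum>s\<leftarrow>v. cgen S m s)"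
  shows "(\<Sum>s\<leftarrow>u. h s) = (\<Sum>s\<leftarrow>v. h s)"
proof -
  have "cls S m u = cls S m v" using assms(2-4) by (simp add: cls_eq_iff)
  then have "(posw u, posw v) \<in> pres_rel S (coxeter_relators S m)"
    unfolding cls_def by (rule eq_equiv_class[OF _ equiv_pres_rel]) (use assms(3) in simp)
  then have "wval h (posw u) = wval h (posw v)"
    by (rule pres_rel_wval) (rule wval_coxeter_relators[OF assms(1)])
  then show ?thesis by (simp add: wval_posw)
qed

lemma sum_list_concat_replicate_pair:
  "(\<Sum>s\<leftarrow>concat (replicate n [a, b]). h s) = nmul n (h a + h b :: 'x::group_add)"
  by (induction n) (simp_all add: add.assoc)

lemma cgen_relation:
  assumes "r \<in> S" "s \<in> S" "m r s = enat n"
  shows "nmul n (cgen S m r + cgen S m s) = 0"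
proof -
  let ?u = "concat (replicate n [r, s])"
  have u: "?u \<in> lists S" by (induction n) (use assms in auto)
  have "posw ?u = concat (replicate n [(r, True), (s, True)])"
    by (simp add: map_concat)
  then have "posw ?u \<in> coxeter_relators S m"
    using assms by (auto simp: coxeter_relators_def)
  then have "([] @ posw ?u @ [], [] @ []) \<in> pres_rel S (coxeter_relators S m)"
    using u by (intro pres_relator) auto
  then have "cls S m ?u = cls S m []"
    by (simp add: cls_def equiv_class_eq[OF equiv_pres_rel])
  then show ?thesis
    using cls_eq_iff[OF u, of "[]" m] by (simp add: sum_list_concat_replicate_pair)
qed

text \<open>Words without formal inverses suffice: \<open>m s s = 1\<close> makes \<open>s s\<close>
  a relator, which turns the inverse letter of \<open>s\<close> into \<open>s\<close>.\<close>

lemma carrier_coxeter_group: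
  assumes "coxeter_matrix S m"
  shows "carrier (coxeter_group S m) = cls S m ` lists S"
proof (intro equalityI subsetI)
  fix x assume "x \<in> carrier (coxeter_group S m)"
  then obtain u where u: "u \<in> words S" "x = pres_rel S (coxeter_relators S m) `` {u}"
    unfolding coxeter_group_def presented_group_carrier by blast
  have "(u, posw (map fst u)) \<in> pres_rel S (coxeter_relators S m)"
    using u(1)
  proof (induction u rule: lists.induct)
    case Nil
    show ?case by (simp add: pres_refl)
  next
    case (Cons l u)
    obtain s b where l: "l = (s, b)" by force
    have s: "s \<in> S" using Cons l by auto
    let ?R = "pres_rel S (coxeter_relators S m)"
    have 3: "(l # u, (s, True) # u) \<in> ?R"
    proof (cases b)
      case True
      then show ?thesis using l Cons by (intro back_subst[of "\<lambda>x. (l # u, x) \<in> ?R", OF pres_refl]) auto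
    next
      case False
      have "[(s, True), (s, True)] \<in> coxeter_relators S m"
        using s assms by (auto simp: coxeter_relators_def coxeter_matrix_def one_enat_def
            intro!: exI[of _ s] exI[of _ 1])
      then have 1: "([(s, False)] @ [(s, True), (s, True)] @ u, [(s, False)] @ u) \<in> ?R"
        using s Cons by (intro pres_relator) auto
      have 2: "([] @ [(s, False), (s, \<not> False)] @ ((s, True) # u), [] @ ((s, True) # u)) \<in> ?R"
        using s Cons by (intro pres_cancel) auto
      have "([(s, False)] @ u, (s, True) # u) \<in> ?R"
        by (rule pres_trans[OF pres_sym[OF 1]]) (use 2 in simp)
      then show ?thesis using False l by simp
    qed
    have 4: "([(s, True)] @ u @ [], [(s, True)] @ posw (map fst u) @ []) \<in> ?R"
      using Cons s by (intro pres_rel_context) auto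
    show ?case by (rule pres_trans[OF 3]) (use 4 l in simp)
  qed
  then have "x = cls S m (map fst u)"
    unfolding cls_def using u(2) equiv_class_eq[OF equiv_pres_rel] by metis
  moreover have "map fst u \<in> lists S" using u(1) by (induction u) auto
  ultimately show "x \<in> cls S m ` lists S" by blast
qed (auto intro: cls_closed)

lemma parabolic_cls:
  assumes "coxeter_matrix S m" "I \<subseteq> S"
  shows "parabolic S m I = cls S m ` lists I"
proof (intro equalityI subsetI)
  interpret group "coxeter_group S m" by (rule group_coxeter_group)
  have one: "\<one>\<^bsub>coxeter_group S m\<^esub> = cls S m []"
    by (simp add: coxeter_group_def presented_group_def cls_def)
  fix x assume "x \<in> parabolic S m I"
  then have "x \<in> generate (coxeter_group S m) (coxeter_gen S m ` I)" by (simp add: parabolic_def)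
  then show "x \<in> cls S m ` lists I"
  proof (induction rule: generate.induct)
    case one
    show ?case unfolding \<open>\<one>\<^bsub>coxeter_group S m\<^esub> = _\<close> by blast
  next
    case (incl h)
    then obtain s where s: "s \<in> I" "h = cls S m [s]" unfolding coxeter_gen_cls by auto
    show ?case unfolding s(2) using s(1) by (intro imageI) simp
  next
    case (inv h)
    then obtain s where s: "s \<in> I" "h = cls S m [s]" unfolding coxeter_gen_cls by auto
    have sS: "s \<in> S" using s assms(2) by auto
    have "m s s = enat 1" using assms(1) sS by (auto simp: coxeter_matrix_def one_enat_def)
    from cgen_relation[of s S s m 1, OF sS sS this]
    have "cls S m ([s] @ [s]) = cls S m []"
      using sS by (subst cls_eq_iff) auto
    then have "h \<otimes>\<^bsub>coxeter_group S m\<^esub> h = \<one>\<^bsub>coxeter_group S m\<^esub>"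
      unfolding one s(2) using cls_append[of "[s]" S "[s]" m] sS by auto
    moreover have "h \<in> carrier (coxeter_group S m)" unfolding s(2) using sS by (intro cls_closed) auto
    ultimately have "inv\<^bsub>coxeter_group S m\<^esub> h = h" by (metis inv_equality)
    moreover have "[s] \<in> lists I" using s(1) by simp
    ultimately show ?case unfolding s(2) by (simp only: imageI)
  next
    case (eng h1 h2)
    then obtain u v where uv: "u \<in> lists I" "v \<in> lists I" "h1 = cls S m u" "h2 = cls S m v" by auto
    moreover from uv have "u \<in> lists S" "v \<in> lists S" using assms(2) by auto
    ultimately have "h1 \<otimes>\<^bsub>coxeter_group S m\<^esub> h2 = cls S m (u @ v)"
      using cls_append[of u S v m] by simp
    moreover have "u @ v \<in> lists I" using uv by simp
    ultimately show ?case by (simp only: imageI)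
  qed
next
  fix x assume "x \<in> cls S m ` lists I"
  then obtain u where u: "u \<in> lists I" "x = cls S m u" by auto
  have "cls S m u \<in> generate (coxeter_group S m) (coxeter_gen S m ` I)"
    using u(1)
  proof (induction u rule: lists.induct)
    case Nil
    have "\<one>\<^bsub>coxeter_group S m\<^esub> = cls S m []"
      by (simp add: coxeter_group_def presented_group_def cls_def)
    then show ?case using generate.one[of "coxeter_group S m"] by metis
  next
    case (Cons s u)
    have "cls S m (s # u) = cls S m [s] \<otimes>\<^bsub>coxeter_group S m\<^esub> cls S m u"
      using Cons assms(2) cls_append[of "[s]" S u m] by auto
    moreover have "cls S m [s] \<in> generate (coxeter_group S m) (coxeter_gen S m ` I)"
      using Cons by (intro generate.incl) (auto simp: coxeter_gen_cls)
    ultimately show ?case using Cons.IH by (simp only: generate.eng)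
  qed
  then show "x \<in> parabolic S m I" using u by (simp add: parabolic_def)
qed

section \<open>The exchange condition\<close>

lemma involution_uminus: "a + a = 0 \<Longrightarrow> - a = (a :: 'w::group_add)"
  by (simp add: minus_unique)

lemma nmul_add: "nmul (m + n) (x :: 'w::group_add) = nmul m x + nmul n x"
  by (simp add: replicate_add)

lemma nmul_Suc_right: "nmul (Suc n) (x :: 'w::group_add) = nmul n x + x"
  using nmul_add[of n 1 x] by simp

text \<open>As in every dihedral group, the involution \<open>b\<close> conjugates the rotation
  \<open>a + b\<close> to its inverse.\<close>

lemma involution_flip:
  fixes a b :: "'w::group_add"
  assumes "a + a = 0" "b + b = 0"
  shows "b + nmul n (a + b) = - nmul n (a + b) + b"
proof (induction n)
  case (Suc n)
  have "b + (a + b) = - (a + b) + b"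
    using assms by (simp add: minus_add involution_uminus add.assoc)
  then have "b + nmul (Suc n) (a + b) = - (a + b) + (b + nmul n (a + b))"
    by (simp add: add.assoc[symmetric])
  also have "\<dots> = - nmul (Suc n) (a + b) + b"
    unfolding Suc nmul_Suc_right by (simp only: minus_add add.assoc)
  finally show ?case .
qed simp

lemma conj_eq_iff: "q + t - q = b \<longleftrightarrow> t = - q + (b + q)" for q t b :: "'w::group_add"
  unfolding diff_eq_eq by (metis minus_add_cancel add_minus_cancel)

lemma involution_conj_eq_iff:
  fixes a b x :: "'w::group_add"
  assumes "b + b = 0"
  shows "b + x + b = a \<longleftrightarrow> x = b + (a + b)"
proof -
  have *: "b + (b + y) = y" for y
    using assms by (simp add: add.assoc[symmetric])
  show ?thesis by (auto simp: add.assoc * assms)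
qed

text \<open>This is the classical action on signed reflections: conjugate by \<open>a\<close>, and
  flip the sign exactly at \<open>t = a\<close>. It is defined on all group elements
  \<open>t\<close>, not only on reflections, so that it is a permutation of a full type.\<close>

definition psi :: "'w::group_add \<Rightarrow> ('w \<times> bool) symm" where
  "psi a = Symm (\<lambda>(t, e). (a + t + a, e \<noteq> (t = a)))"

lemma app_psi:
  fixes a :: "'w::group_add"
  assumes "a + a = 0"
  shows "app (psi a) (t, e) = (a + t + a, e \<noteq> (t = a))"
proof -
  have *: "a + (a + x) = x" for x
    using assms by (simp add: add.assoc[symmetric])
  have "a + t + a = a \<longleftrightarrow> t = a" for t
    unfolding involution_conj_eq_iff[OF assms] by (simp add: assms)
  then have "(\<lambda>(t, e). (a + t + a, e \<noteq> (t = a))) ((\<lambda>(t, e). (a + t + a, e \<noteq> (t = a))) x) = x" for x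
    using assms by (cases x; simp add: add.assoc *; blast)
  from app_Symm_involution(1)[OF this]
  show "app (psi a) (t, e) = (a + t + a, e \<noteq> (t = a))"
    by (simp add: psi_def)
qed

text \<open>Each factor \<open>psi a + psi b\<close> tests \<open>t\<close> against two more
  reflections of the dihedral group: \<open>psi b\<close> against the one of index
  \<open>2 * n\<close>, then \<open>psi a\<close> against the one of index \<open>2 * n + 1\<close>.
  The sign records the number of hits modulo 2.\<close>

lemma app_nmul_psi:
  fixes a b :: "'w::group_add"
  assumes a: "a + a = 0" and b: "b + b = 0"
  shows "app (nmul n (psi a + psi b)) (t, e) =
    (nmul n (a + b) + t - nmul n (a + b),
     e \<noteq> odd (\<Sum>j<2 * n. of_bool (t = - nmul j (a + b) + b) :: nat))"
proof (induction n)
  case (Suc n)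
  define p where "p = a + b"
  define q where "q = nmul n p"
  have flip: "b + q = - q + b" unfolding q_def p_def by (rule involution_flip[OF a b])
  have uma: "- a = a" and umb: "- b = b" using a b by (simp_all add: involution_uminus)
  have ump: "- p = b + a" unfolding p_def by (simp add: minus_add uma umb)
  have 1: "q + t - q = b \<longleftrightarrow> t = - nmul (2 * n) p + b"
  proof -
    have "q + t - q = b \<longleftrightarrow> t = - q + (b + q)" by (rule conj_eq_iff)
    also have "- q + (b + q) = - nmul (2 * n) p + b"
      unfolding flip mult_2 nmul_add q_def[symmetric] by (simp only: minus_add add.assoc)
    finally show ?thesis .
  qed
  have 2: "b + (q + t - q) + b = a \<longleftrightarrow> t = - nmul (Suc (2 * n)) p + b"
  proof -
    have "b + (q + t - q) + b = a \<longleftrightarrow> q + t - q = - p + b"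
      unfolding involution_conj_eq_iff[OF b] ump by (simp only: add.assoc)
    also have "\<dots> \<longleftrightarrow> t = - q + (- p + (b + q))"
      unfolding conj_eq_iff by (simp only: add.assoc)
    also have "- q + (- p + (b + q)) = - nmul (n + Suc n) p + b"
      unfolding flip nmul_add replicate_Suc sum_list.Cons q_def[symmetric]
      by (simp only: minus_add add.assoc)
    finally show ?thesis by (simp add: mult_2)
  qed
  have 3: "a + (b + (q + t - q) + b) + a = nmul (Suc n) p + t - nmul (Suc n) p"
  proof -
    have "- nmul (Suc n) p = - q + b + a"
      unfolding replicate_Suc sum_list.Cons q_def[symmetric] by (simp only: minus_add ump add.assoc)
    then have "nmul (Suc n) p + t - nmul (Suc n) p = p + q + t + (- q + b + a)"
      unfolding sum_list.Cons replicate_Suc q_def[symmetric]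
      by (simp only: diff_conv_add_uminus[of "p + q + t"])
    then show ?thesis
      unfolding p_def by (simp only: add.assoc diff_conv_add_uminus)
  qed
  have "app (nmul (Suc n) (psi a + psi b)) (t, e) =
      app (psi a) (app (psi b) (app (nmul n (psi a + psi b)) (t, e)))"
    by simp
  also have "\<dots> = (nmul (Suc n) p + t - nmul (Suc n) p,
      ((e \<noteq> odd (\<Sum>j<2 * n. of_bool (t = - nmul j p + b) :: nat)) \<noteq>
       (t = - nmul (2 * n) p + b)) \<noteq> (t = - nmul (Suc (2 * n)) p + b))"
    unfolding Suc app_psi[OF a] app_psi[OF b] p_def[symmetric] q_def[symmetric] 1 2 3 ..
  finally show ?case by (auto simp flip: p_def)
qed simp

lemma sum_lessThan_add:
  fixes f :: "nat \<Rightarrow> nat"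
  shows "(\<Sum>j<n + k. f j) = (\<Sum>j<n. f j) + (\<Sum>j<k. f (n + j))"
  by (induction k) simp_all

lemma psi_relation:
  fixes a b :: "'w::group_add"
  assumes "a + a = 0" "b + b = 0" and n: "nmul n (a + b) = 0"
  shows "nmul n (psi a + psi b) = 0"
proof (rule symm_eqI)
  fix x :: "'w \<times> bool"
  obtain t e where x: "x = (t, e)" by force
  \<comment> \<open>As \<open>nmul n (a + b) = 0\<close>, the list of \<open>2 * n\<close>
    reflections has period \<open>n\<close>, so every \<open>t\<close> occurs in it an even number
    of times.\<close>
  have "even (\<Sum>j<2 * n. of_bool (t = - nmul j (a + b) + b) :: nat)"
    unfolding mult_2 sum_lessThan_add nmul_add n by simp
  then show "app (nmul n (psi a + psi b)) x = app 0 x"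
    unfolding x app_nmul_psi[OF assms(1,2)] n by simp
qed

definition wlen :: "'s set \<Rightarrow> ('s \<Rightarrow> 'w::group_add) \<Rightarrow> 'w \<Rightarrow> nat" where
  "wlen S g w = (LEAST n. \<exists>u\<in>lists S. length u = n \<and> (\<Sum>s\<leftarrow>u. g s) = w)"

lemma wlen_le: "u \<in> lists S \<Longrightarrow> wlen S g (\<Sum>s\<leftarrow>u. g s) \<le> length u"
  unfolding wlen_def by (rule Least_le) blast

lemma wlen_obtain:
  assumes "u \<in> lists S"
  obtains v where "v \<in> lists S" "(\<Sum>s\<leftarrow>v. g s) = (\<Sum>s\<leftarrow>u. g s)" "length v = wlen S g (\<Sum>s\<leftarrow>u. g s)"
proof -
  have "\<exists>v\<in>lists S. length v = wlen S g (\<Sum>s\<leftarrow>u. g s) \<and> (\<Sum>s\<leftarrow>v. g s) = (\<Sum>s\<leftarrow>u. g s)"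
    unfolding wlen_def by (rule LeastI[of _ "length u"]) (use assms in blast)
  then show ?thesis using that by blast
qed

text \<open>The second component of the action of a word \<open>u\<close> counts, modulo 2, the occurrences of
  \<open>t\<close> among the reflections attached to the letters of \<open>u\<close>; by the universal property this parity
  depends only on the group element.\<close>

lemma psi_flip_deletion:
  fixes g :: "'s \<Rightarrow> 'w::group_add"
  assumes inv: "\<And>s. s \<in> S \<Longrightarrow> g s + g s = 0" and "u \<in> lists S"
  shows "app (\<Sum>s\<leftarrow>u. psi (g s)) (t, e) =
      ((\<Sum>s\<leftarrow>u. g s) + t - (\<Sum>s\<leftarrow>u. g s), e \<noteq> snd (app (\<Sum>s\<leftarrow>u. psi (g s)) (t, False)))"
    and "snd (app (\<Sum>s\<leftarrow>u. psi (g s)) (t, False)) \<Longrightarrow>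
      \<exists>u1 a u2. u = u1 @ a # u2 \<and> (\<Sum>s\<leftarrow>u. g s) + t = (\<Sum>s\<leftarrow>u1 @ u2. g s)"
proof -
  have "\<forall>e. app (\<Sum>s\<leftarrow>u. psi (g s)) (t, e) =
      ((\<Sum>s\<leftarrow>u. g s) + t - (\<Sum>s\<leftarrow>u. g s), e \<noteq> snd (app (\<Sum>s\<leftarrow>u. psi (g s)) (t, False))) \<and>
    (snd (app (\<Sum>s\<leftarrow>u. psi (g s)) (t, False)) \<longrightarrow>
      (\<exists>u1 a u2. u = u1 @ a # u2 \<and> (\<Sum>s\<leftarrow>u. g s) + t = (\<Sum>s\<leftarrow>u1 @ u2. g s)))"
    using assms(2)
  proof (induction u rule: lists.induct)
    case (Cons s u)
    define w where "w = (\<Sum>s\<leftarrow>u. g s)"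
    define \<eta> where "\<eta> = snd (app (\<Sum>s\<leftarrow>u. psi (g s)) (t, False))"
    have s: "g s + g s = 0" using inv Cons by simp
    have IH: "app (\<Sum>s\<leftarrow>u. psi (g s)) (t, e) = (w + t - w, e \<noteq> \<eta>)" for e
      using Cons.IH unfolding w_def \<eta>_def by blast
    have app: "app (\<Sum>s\<leftarrow>s # u. psi (g s)) (t, e) =
        (g s + w + t - (g s + w), e \<noteq> (\<eta> \<noteq> (w + t - w = g s)))" for e
      by (simp add: IH app_psi[OF s])
        (auto simp only: minus_add involution_uminus[OF s] add.assoc diff_conv_add_uminus)
    have "\<exists>u1 a u2. s # u = u1 @ a # u2 \<and> g s + w + t = (\<Sum>s\<leftarrow>u1 @ u2. g s)"
      if "\<eta> \<noteq> (w + t - w = g s)"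
    proof (cases \<eta>)
      case True
      then obtain u1 a u2 where "u = u1 @ a # u2" "w + t = (\<Sum>s\<leftarrow>u1 @ u2. g s)"
        using Cons.IH unfolding w_def \<eta>_def by blast
      then show ?thesis by (intro exI[of _ "s # u1"] exI[of _ a] exI[of _ u2]) (simp add: add.assoc)
    next
      case False
      then have "w + t = g s + w" using that by (simp add: diff_eq_eq)
      then have "g s + w + t = w" using s by (metis add.assoc add_0_left)
      then show ?thesis by (intro exI[of _ "[]"] exI[of _ s] exI[of _ u]) (simp add: w_def)
    qed
    then show ?case unfolding app by (simp flip: w_def)
  qed simp
  then show "app (\<Sum>s\<leftarrow>u. psi (g s)) (t, e) =
      ((\<Sum>s\<leftarrow>u. g s) + t - (\<Sum>s\<leftarrow>u. g s), e \<noteq> snd (app (\<Sum>s\<leftarrow>u. psi (g s)) (t, False)))"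
    and "snd (app (\<Sum>s\<leftarrow>u. psi (g s)) (t, False)) \<Longrightarrow>
      \<exists>u1 a u2. u = u1 @ a # u2 \<and> (\<Sum>s\<leftarrow>u. g s) + t = (\<Sum>s\<leftarrow>u1 @ u2. g s)"
    by blast+
qed

lemma cgen_involution:
  assumes "coxeter_matrix S m" "s \<in> S"
  shows "cgen S m s + cgen S m s = 0"
proof -
  have "m s s = enat 1" using assms by (auto simp: coxeter_matrix_def one_enat_def)
  from cgen_relation[of s S s m 1, OF assms(2,2) this] show ?thesis by simp
qed

text \<open>If the word \<open>u\<close> flips the sign at the reflection \<open>s\<close>, the
  required letter of \<open>u\<close> is found by deletion. Otherwise \<open>u @ [s]\<close> flips
  it, hence so does a reduced word \<open>v\<close> of the same element. Deleting a letter of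
  \<open>v\<close> then gives a word for \<open>u\<close> shorter than \<open>v\<close>, against the
  assumption on lengths.\<close>

lemma coxeter_exchange:
  assumes "coxeter_matrix S m" and u: "u \<in> lists S" and s: "s \<in> S"
    and le: "wlen S (cgen S m) ((\<Sum>s\<leftarrow>u. cgen S m s) + cgen S m s) \<le> wlen S (cgen S m) (\<Sum>s\<leftarrow>u. cgen S m s)"
  shows "\<exists>u1 a u2. u = u1 @ a # u2 \<and> (\<Sum>s\<leftarrow>u. cgen S m s) + cgen S m s = (\<Sum>s\<leftarrow>u1 @ u2. cgen S m s)"
proof (cases "snd (app (\<Sum>r\<leftarrow>u. psi (cgen S m r)) (cgen S m s, False))")
  case True
  from psi_flip_deletion(2)[where g = "cgen S m", OF cgen_involution[OF assms(1)] u this]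
  show ?thesis by blast
next
  case False
  let ?g = "cgen S m"
  note inv = cgen_involution[OF assms(1)]
  have us: "u @ [s] \<in> lists S" using u s by simp
  obtain v where v: "v \<in> lists S" "(\<Sum>r\<leftarrow>v. ?g r) = (\<Sum>r\<leftarrow>u @ [s]. ?g r)"
    "length v = wlen S ?g (\<Sum>r\<leftarrow>u @ [s]. ?g r)"
    using wlen_obtain[OF us] by metis
  have "(\<Sum>r\<leftarrow>v. psi (?g r)) = (\<Sum>r\<leftarrow>u @ [s]. psi (?g r))"
    by (rule coxeter_universal[OF _ v(1) us v(2)]) (rule psi_relation[OF inv inv cgen_relation])
  \<comment> \<open>The appended letter acts first; it fixes the reflection \<open>?g s\<close> and
    flips its sign, and \<open>u\<close> does not flip it back.\<close>
  moreover have "snd (app (\<Sum>r\<leftarrow>u @ [s]. psi (?g r)) (?g s, False))"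
    using False psi_flip_deletion(1)[where g = ?g, OF inv u, of "?g s" True]
    by (simp add: app_psi[OF inv[OF s]] inv[OF s])
  ultimately obtain v1 a v2 where v12: "v = v1 @ a # v2" "(\<Sum>r\<leftarrow>v. ?g r) + ?g s = (\<Sum>r\<leftarrow>v1 @ v2. ?g r)"
    using psi_flip_deletion(2)[where g = ?g, OF inv v(1), of "?g s"] by auto
  have "(\<Sum>r\<leftarrow>u. ?g r) = (\<Sum>r\<leftarrow>v1 @ v2. ?g r)"
    using v12(2) v(2) inv[OF s] by (simp add: add.assoc)
  then have "wlen S ?g (\<Sum>r\<leftarrow>u. ?g r) \<le> length (v1 @ v2)"
    using wlen_le[of "v1 @ v2" S ?g] v(1) v12(1) by simp
  also have "\<dots> < length v" using v12 by simp
  finally show ?thesis using le v(3) by simp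
qed

section \<open>The Tits representation\<close>

definition trefl :: "('s \<Rightarrow> real) \<Rightarrow> 's \<Rightarrow> ('s \<Rightarrow> real) symm" where
  "trefl A a = Symm (\<lambda>f r. f r - 2 * f a * A r)"

lemma trefl:
  assumes "A a = 1"
  shows app_trefl: "app (trefl A a) f = (\<lambda>r. f r - 2 * f a * A r)"
    and trefl_involution: "trefl A a + trefl A a = 0"
proof -
  have "(\<lambda>f r. f r - 2 * f a * A r) ((\<lambda>f r. f r - 2 * f a * A r) f) = f" for f
    using assms by (auto simp: fun_eq_iff algebra_simps)
  from app_Symm_involution[OF this]
  show "app (trefl A a) f = (\<lambda>r. f r - 2 * f a * A r)" "trefl A a + trefl A a = 0"
    by (simp_all add: trefl_def)
qed

text \<open>A function splits into a part fixed by both reflections and a part in the plane of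
  \<open>A\<close> and \<open>B\<close>. On the plane the product of the two reflections is a
  rotation by \<open>2 * pi / n\<close>.\<close>

lemma trefl_relation:
  fixes A B :: "'s \<Rightarrow> real"
  assumes A: "A a = 1" "A b = - cos (pi / n)" and B: "B b = 1" "B a = - cos (pi / n)"
    and n: "n \<ge> 2"
  shows "nmul n (trefl A a + trefl B b) = 0"
proof (rule symm_eqI)
  fix f :: "'s \<Rightarrow> real"
  define \<theta> where "\<theta> = pi / n"
  define c where "c = cos \<theta>"
  have s0: "sin \<theta> \<noteq> 0"
  proof -
    have "0 < \<theta>" "\<theta> < pi" using n by (auto simp: \<theta>_def field_simps)
    then show ?thesis using sin_gt_zero by fastforce
  qed
  have c2: "1 - c\<^sup>2 \<noteq> 0"
    using s0 sin_cos_squared_add[of \<theta>] unfolding c_def by (metis add_diff_cancel_right' power_not_zero)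
  have Ab: "A b = - c" and Ba: "B a = - c" using A B by (simp_all add: c_def \<theta>_def)
  \<comment> \<open>The coefficients solve the linear system saying that the remainder
    \<open>h\<close> vanishes at \<open>a\<close> and \<open>b\<close>, so that both reflections fix
    \<open>h\<close>. Its determinant is the square of \<open>sin \<theta>\<close>.\<close>
  define \<alpha> \<beta> where "\<alpha> = (f a + c * f b) / (1 - c\<^sup>2)" and "\<beta> = (f b + c * f a) / (1 - c\<^sup>2)"
  define h where "h = (\<lambda>r. f r - \<alpha> * A r - \<beta> * B r)"
  have h: "h a = 0" "h b = 0"
    using c2 unfolding h_def \<alpha>_def \<beta>_def
    by (simp_all add: A(1) B(1) Ab Ba field_simps power2_eq_square)
  have step: "app (trefl A a + trefl B b) (\<lambda>r. h r + x * A r + y * B r) =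
      (\<lambda>r. h r + ((4 * c\<^sup>2 - 1) * x - 2 * c * y) * A r + (2 * c * x - y) * B r)" for x y
    by (rule ext) (simp add: app_trefl[of A a, OF A(1)] app_trefl[of B b, OF B(1)] h A(1) B(1) Ab Ba
        power2_eq_square algebra_simps)
  have rec: "sin ((x + 1) * \<theta>) = 2 * c * sin (x * \<theta>) - sin ((x - 1) * \<theta>)" for x
    unfolding c_def by (simp add: algebra_simps sin_add sin_diff)
  \<comment> \<open>These are values of Chebyshev polynomials of the second kind; they are the
    matrix entries of the powers of the rotation in the basis \<open>A\<close>,
    \<open>B\<close>.\<close>
  define S where "S x = sin (x * \<theta>) / sin \<theta>" for x
  have recS: "S (x + 1) = 2 * c * S x - S (x - 1)" for x
    unfolding S_def rec by (simp add: diff_divide_distrib)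
  have iter: "app (nmul k (trefl A a + trefl B b)) f =
      (\<lambda>r. h r + (S (2 * real k + 1) * \<alpha> - S (2 * real k) * \<beta>) * A r + (S (2 * real k) * \<alpha> - S (2 * real k - 1) * \<beta>) * B r)"
    for k
  proof (induction k)
    case 0
    have "S 1 = 1" "S 0 = 0" "S (- 1) = - 1" using s0 by (simp_all add: S_def)
    then show ?case by (simp add: h_def)
  next
    case (Suc k)
    have v: "S (2 * real k + 1) = 2 * c * S (2 * real k) - S (2 * real k - 1)"
      using recS[of "2 * real k"] by simp
    have v': "S (2 * real k + 2) = 2 * c * S (2 * real k + 1) - S (2 * real k)"
      using recS[of "2 * real k + 1"] by (simp add: algebra_simps)
    have w': "S (2 * real k + 3) = 2 * c * S (2 * real k + 2) - S (2 * real k + 1)"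
      using recS[of "2 * real k + 2"] by (simp add: algebra_simps)
    have "app (nmul (Suc k) (trefl A a + trefl B b)) f =
      app (trefl A a + trefl B b) (app (nmul k (trefl A a + trefl B b)) f)"
      by simp
    also have "\<dots> = (\<lambda>r. h r + (S (2 * real k + 3) * \<alpha> - S (2 * real k + 2) * \<beta>) * A r +
        (S (2 * real k + 2) * \<alpha> - S (2 * real k + 1) * \<beta>) * B r)"
      unfolding Suc.IH step w' v' v by (simp add: power2_eq_square algebra_simps)
    finally show ?case by (simp add: add.assoc algebra_simps)
  qed
  have "real n * \<theta> = pi" using n by (simp add: \<theta>_def)
  then have *: "(2 * real n + x) * \<theta> = x * \<theta> + 2 * pi" for x by (simp add: algebra_simps)
  have "S (2 * real n + x) = S x" for x unfolding S_def * by simp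
  from this[of 1] this[of 0] this[of "-1"] have "S (2 * real n + 1) = 1" "S (2 * real n) = 0" "S (2 * real n - 1) = - 1"
    using s0 by (simp_all add: S_def)
  then show "app (nmul n (trefl A a + trefl B b)) f = app 0 f"
    unfolding iter by (simp add: h_def)
qed

text \<open>The value \<open>- 1\<close> at \<infinity> is the limit of
  \<open>- cos (pi / n)\<close>.\<close>

definition tits_form :: "('s \<Rightarrow> 's \<Rightarrow> enat) \<Rightarrow> 's \<Rightarrow> 's \<Rightarrow> real" where
  "tits_form m s r = (case m r s of enat n \<Rightarrow> - cos (pi / n) | \<infinity> \<Rightarrow> - 1)"

abbreviation tits :: "('s \<Rightarrow> 's \<Rightarrow> enat) \<Rightarrow> 's \<Rightarrow> ('s \<Rightarrow> real) symm" where
  "tits m s \<equiv> trefl (tits_form m s) s"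

lemma tits_form_self:
  assumes "coxeter_matrix S m" "s \<in> S"
  shows "tits_form m s s = 1"
  using assms by (simp add: tits_form_def coxeter_matrix_def one_enat_def)

lemma tits_relation:
  assumes "coxeter_matrix S m" "r \<in> S" "s \<in> S" "m r s = enat n"
  shows "nmul n (tits m r + tits m s) = 0"
proof (cases "r = s")
  case True
  then have "n = 1" using assms by (simp add: coxeter_matrix_def one_enat_def)
  then show ?thesis using True tits_form_self[OF assms(1,3)] by (simp add: trefl_involution)
next
  case False
  have "2 \<le> m r s" "m s r = m r s" using False assms(1-3) by (auto simp: coxeter_matrix_def)
  then have "n \<ge> 2" using assms(4) by (simp add: numeral_eq_enat)
  then show ?thesis
    using assms \<open>m s r = m r s\<close> by (intro trefl_relation) (simp_all add: tits_form_self, simp_all add: tits_form_def)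
qed

lemma tits_universal:
  assumes "coxeter_matrix S m" "u \<in> lists S" "v \<in> lists S"
    "(\<Sum>s\<leftarrow>u. cgen S m s) = (\<Sum>s\<leftarrow>v. cgen S m s)"
  shows "(\<Sum>s\<leftarrow>u. tits m s) = (\<Sum>s\<leftarrow>v. tits m s)"
  by (rule coxeter_universal[OF tits_relation[OF assms(1)] assms(2-4)])

text \<open>On the indicator of \<open>r\<close>, the reflection of \<open>r\<close> changes the
  value at \<open>r\<close> from 1 to -1, while the reflection of \<open>s\<close> leaves it
  alone.\<close>

lemma cgen_inj:
  assumes "coxeter_matrix S m"
  shows "inj_on (cgen S m) S"
proof (rule inj_onI, rule ccontr)
  fix r s assume rs: "r \<in> S" "s \<in> S" "cgen S m r = cgen S m s" "r \<noteq> s"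
  then have "tits m r = tits m s" using tits_universal[OF assms, of "[r]" "[s]"] by simp
  then have "app (tits m r) (\<lambda>x. if x = r then 1 else 0) = app (tits m s) (\<lambda>x. if x = r then 1 else 0)"
    by simp
  from fun_cong[OF this, of r] show False
    using rs by (simp add: app_trefl tits_form_self[OF assms])
qed

text \<open>Applied to the indicator of \<open>r\<close>, the two orders of the product differ at
  \<open>r\<close> by four times the product of the form values. Since the form value is symmetric,
  commuting forces it to be 0, and among the values \<open>- cos (pi / n)\<close> with
  \<open>n \<ge> 2\<close>, and -1, only \<open>n = 2\<close> gives 0.\<close>

lemma cgen_commute_iff:
  assumes cm: "coxeter_matrix S m" and rs: "r \<in> S" "s \<in> S" "r \<noteq> s"
  shows "cgen S m r + cgen S m s = cgen S m s + cgen S m r \<longleftrightarrow> m r s = 2"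
proof
  assume eq: "cgen S m r + cgen S m s = cgen S m s + cgen S m r"
  then have "tits m r + tits m s = tits m s + tits m r"
    using tits_universal[OF cm, of "[r, s]" "[s, r]"] rs by simp
  then have "app (tits m r + tits m s) (\<lambda>x. if x = r then 1 else 0) =
    app (tits m s + tits m r) (\<lambda>x. if x = r then 1 else 0)" by simp
  from fun_cong[OF this, of r] have "tits_form m s r = 0 \<or> tits_form m r s = 0"
    using rs by (auto simp add: app_trefl tits_form_self[OF cm])
  moreover have sym: "m s r = m r s" and ge: "2 \<le> m r s"
    using cm rs by (auto simp: coxeter_matrix_def)
  ultimately have 0: "tits_form m s r = 0" by (simp add: tits_form_def)
  then obtain n where n: "m r s = enat n" by (auto simp: tits_form_def split: enat.splits)
  have "n \<ge> 2" using ge n by (simp add: numeral_eq_enat)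
  have "\<not> n > 2"
  proof
    assume "n > 2"
    then have "0 < pi / n" "pi / n < pi / 2" by (auto simp: field_simps)
    then have "cos (pi / n) > 0" by (intro cos_gt_zero) auto
    then show False using 0 n by (simp add: tits_form_def)
  qed
  then show "m r s = 2" using n \<open>n \<ge> 2\<close> by (simp add: numeral_eq_enat)
next
  assume "m r s = 2"
  then have "nmul 2 (cgen S m r + cgen S m s) = 0"
    using cgen_relation[of r S s m 2] rs by (simp add: numeral_eq_enat)
  then have "cgen S m r + cgen S m s = - (cgen S m r + cgen S m s)"
    by (simp add: numeral_2_eq_2 eq_neg_iff_add_eq_0)
  then show "cgen S m r + cgen S m s = cgen S m s + cgen S m r"
    using rs by (simp add: minus_add involution_uminus cgen_involution[OF cm] del: add_uminus_conv_diff)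
qed

text \<open>With form value -1 the product of the two reflections acts on the values at
  \<open>r\<close> and \<open>s\<close> as a shear instead of a rotation; starting from the
  indicator of \<open>s\<close>, these values grow linearly.\<close>

lemma cgen_infinite_order:
  assumes cm: "coxeter_matrix S m" and rs: "r \<in> S" "s \<in> S"
    and inf: "m r s = \<infinity>" and n: "nmul n (cgen S m r + cgen S m s) = 0"
  shows "n = 0"
proof -
  have ne: "r \<noteq> s" using cm inf rs by (auto simp: coxeter_matrix_def one_enat_def)
  have sym: "m s r = \<infinity>" using cm rs inf by (auto simp: coxeter_matrix_def)
  have B: "tits_form m s r = - 1" "tits_form m r s = - 1" using inf sym by (simp_all add: tits_form_def)
  have "(\<Sum>x\<leftarrow>concat (replicate n [r, s]). tits m x) = (\<Sum>x\<leftarrow>[]. tits m x)"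
    by (rule tits_universal[OF cm]) (use rs n in \<open>auto simp: sum_list_concat_replicate_pair split: if_splits\<close>)
  then have 0: "nmul n (tits m r + tits m s) = 0" by (simp add: sum_list_concat_replicate_pair)
  define f where "f = (\<lambda>x. if x = s then 1 else 0 :: real)"
  have "app (nmul k (tits m r + tits m s)) f r = - 2 * real k \<and>
    app (nmul k (tits m r + tits m s)) f s = 2 * real k + 1" for k
    using rs ne by (induction k)
      (simp_all add: f_def app_trefl tits_form_self[OF cm] B algebra_simps)
  from this[of n] show ?thesis unfolding 0 by (simp add: f_def ne)
qed

section \<open>Coxeter systems with the exchange condition\<close>

fun alt :: "'a \<Rightarrow> 'a \<Rightarrow> nat \<Rightarrow> 'a list" where
  "alt a b 0 = []"
| "alt a b (Suc n) = a # alt b a n"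

lemma length_alt [simp]: "length (alt a b n) = n"
  by (induction a b n rule: alt.induct) simp_all

lemma alt_in_lists: "a \<in> I \<Longrightarrow> b \<in> I \<Longrightarrow> alt a b n \<in> lists I"
  by (induction a b n rule: alt.induct) simp_all

lemma alt_add: "alt a b (n + k) = alt a b n @ (if even n then alt a b k else alt b a k)"
  by (induction a b n rule: alt.induct) simp_all

lemma alt_Suc_right: "alt a b (Suc n) = alt a b n @ [if even n then a else b]"
  using alt_add[of a b n 1] by simp

text \<open>Exchange is assumed already when the length does not increase, which includes equal
  lengths. That a letter always changes the length is then a consequence and needs no sign
  character. By \<open>gen_inj\<close>, a generator determines its type.\<close>

locale coxeter_system =
  fixes S :: "'s set" and g :: "'s \<Rightarrow> 'w::group_add"
  assumes gen_involution: "s \<in> S \<Longrightarrow> g s + g s = 0"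
    and exchange: "u \<in> lists S \<Longrightarrow> s \<in> S \<Longrightarrow>
      wlen S g ((\<Sum>r\<leftarrow>u. g r) + g s) \<le> wlen S g (\<Sum>r\<leftarrow>u. g r) \<Longrightarrow>
      \<exists>u1 a u2. u = u1 @ a # u2 \<and> (\<Sum>r\<leftarrow>u. g r) + g s = (\<Sum>r\<leftarrow>u1 @ u2. g r)"
    and gen_inj: "inj_on g S"
begin

section \<open>Standard subgroups and the length function\<close>

definition ev :: "'s list \<Rightarrow> 'w" where
  "ev u = (\<Sum>s\<leftarrow>u. g s)"

definition par :: "'s set \<Rightarrow> 'w set" where
  "par I = {w. \<exists>u\<in>lists I. ev u = w}"

abbreviation len :: "'w \<Rightarrow> nat" where
  "len \<equiv> wlen S g"

lemma ev_simps [simp]: "ev [] = 0" "ev (s # u) = g s + ev u" "ev (u @ v) = ev u + ev v"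
  by (simp_all add: ev_def)

lemma gen_uminus: "s \<in> S \<Longrightarrow> - g s = g s"
  by (simp add: gen_involution involution_uminus)

lemma gen_gen: "s \<in> S \<Longrightarrow> g s + (g s + w) = w" "s \<in> S \<Longrightarrow> w + g s + g s = w"
  using add.assoc[of "g s" "g s" w] add.assoc[of w "g s" "g s"] by (simp_all add: gen_involution)

lemma ev_rev: "u \<in> lists S \<Longrightarrow> ev (rev u) = - ev u"
  by (induction u rule: lists.induct) (simp_all add: minus_add gen_uminus)

lemma ev_par: "u \<in> lists I \<Longrightarrow> ev u \<in> par I"
  by (auto simp: par_def)

lemma par_mono: "I \<subseteq> J \<Longrightarrow> par I \<subseteq> par J"
  unfolding par_def using lists_mono by blast

lemma par_0: "0 \<in> par I"
  using ev_par[of "[]"] by simp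

lemma par_gen: "s \<in> I \<Longrightarrow> g s \<in> par I"
  using ev_par[of "[s]"] by simp

lemma par_add:
  assumes "v \<in> par I" "w \<in> par I"
  shows "v + w \<in> par I"
proof -
  obtain x y where "x \<in> lists I" "ev x = v" "y \<in> lists I" "ev y = w"
    using assms by (auto simp: par_def)
  then show ?thesis using ev_par[of "x @ y" I] by simp
qed

lemma par_uminus:
  assumes "I \<subseteq> S" "w \<in> par I"
  shows "- w \<in> par I"
proof -
  obtain u where u: "u \<in> lists I" "ev u = w" using assms(2) by (auto simp: par_def)
  moreover have "u \<in> lists S" "rev u \<in> lists I" using u assms(1) by auto
  ultimately show ?thesis using ev_par[of "rev u" I] by (simp add: ev_rev)
qed

lemma par_subset: "I \<subseteq> S \<Longrightarrow> w \<in> par I \<Longrightarrow> w \<in> par S"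
  using par_mono by blast

lemma len_le: "u \<in> lists S \<Longrightarrow> len (ev u) \<le> length u"
  unfolding ev_def by (rule wlen_le)

lemma reduced_word:
  assumes "w \<in> par S"
  obtains u where "u \<in> lists S" "ev u = w" "length u = len w"
proof -
  obtain v where "v \<in> lists S" "ev v = w" using assms by (auto simp: par_def)
  then show ?thesis using wlen_obtain[of v S g] that unfolding ev_def by blast
qed

lemma len_zero [simp]: "len 0 = 0"
  using len_le[of "[]"] by simp

lemma len_eq_0: "w \<in> par S \<Longrightarrow> len w = 0 \<longleftrightarrow> w = 0"
  by (rule reduced_word[of w]) auto

lemma len_add_le:
  assumes "v \<in> par S" "w \<in> par S"
  shows "len (v + w) \<le> len v + len w"
proof -
  obtain u where "u \<in> lists S" "ev u = v" "length u = len v" using reduced_word[OF assms(1)] .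
  moreover obtain u' where "u' \<in> lists S" "ev u' = w" "length u' = len w" using reduced_word[OF assms(2)] .
  ultimately show ?thesis using len_le[of "u @ u'"] by simp
qed

lemma len_uminus: "w \<in> par S \<Longrightarrow> len (- w) = len w"
proof -
  have *: "len (- w) \<le> len w" if w: "w \<in> par S" for w
  proof -
    obtain u where u: "u \<in> lists S" "ev u = w" "length u = len w" using reduced_word[OF w] .
    then have "rev u \<in> lists S" by auto
    from len_le[OF this] show ?thesis using u by (simp add: ev_rev)
  qed
  assume "w \<in> par S"
  then show ?thesis using *[of w] *[of "- w"] par_uminus[of S w] by simp
qed

lemma exchange_right:
  assumes "u \<in> lists S" "s \<in> S" "len (ev u + g s) \<le> len (ev u)"
  obtains u1 a u2 where "u = u1 @ a # u2" "ev u + g s = ev u1 + ev u2"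
  using exchange[of u s] assms unfolding ev_def by auto

text \<open>If the length stayed the same, exchange would delete a letter of a reduced word and
  represent the product by a word that is too short. The left version follows by inversion.\<close>

lemma len_gen_neq:
  assumes "w \<in> par S" "s \<in> S"
  shows "len (w + g s) \<noteq> len w" "len (g s + w) \<noteq> len w"
proof -
  have *: "len (w + g s) \<noteq> len w" if w: "w \<in> par S" for w
  proof
    assume eq: "len (w + g s) = len w"
    obtain u where u: "u \<in> lists S" "ev u = w" "length u = len w" using reduced_word[OF w] .
    obtain u1 a u2 where "u = u1 @ a # u2" "ev u + g s = ev u1 + ev u2"
      using exchange_right[OF u(1) assms(2)] u(2) eq by auto
    then show False using len_le[of "u1 @ u2"] u eq by simp
  qed
  show "len (w + g s) \<noteq> len w" by (rule *[OF assms(1)])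
  have "- w + g s = - (g s + w)" using assms by (simp add: minus_add gen_uminus)
  then show "len (g s + w) \<noteq> len w"
    using *[of "- w"] assms by (simp add: par_uminus len_uminus par_add par_gen)
qed

lemma len_gen: "s \<in> S \<Longrightarrow> len (g s) = 1"
  using len_gen_neq(1)[of 0 s] len_le[of "[s]"] par_0 by simp

lemma gen_neq_0: "s \<in> S \<Longrightarrow> g s \<noteq> 0"
  using len_gen by force

lemma len_add_gen:
  assumes "w \<in> par S" "s \<in> S"
  shows "len (w + g s) = Suc (len w) \<or> Suc (len (w + g s)) = len w"
    and "len (g s + w) = Suc (len w) \<or> Suc (len (g s + w)) = len w"
proof -
  have p: "g s \<in> par S" "w + g s \<in> par S" "g s + w \<in> par S" using assms par_add par_gen by auto
  show "len (w + g s) = Suc (len w) \<or> Suc (len (w + g s)) = len w"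
    using len_add_le[OF assms(1) p(1)] len_add_le[OF p(2) p(1)] len_gen_neq[OF assms] len_gen[OF assms(2)] assms
    by (simp add: gen_gen) arith
  show "len (g s + w) = Suc (len w) \<or> Suc (len (g s + w)) = len w"
    using len_add_le[OF p(1) assms(1)] len_add_le[OF p(1) p(3)] len_gen_neq[OF assms] len_gen[OF assms(2)] assms
    by (simp add: gen_gen) arith
qed

text \<open>Exchange only deletes letters, so reducing a word over \<open>I\<close> never leaves
  \<open>I\<close>. Length inside a standard subgroup is therefore length in the whole
  group.\<close>

lemma par_reduced_word:
  assumes "I \<subseteq> S" "w \<in> par I"
  obtains u where "u \<in> lists I" "ev u = w" "length u = len w"
proof -
  obtain v where v: "v \<in> lists I" "ev v = w" using assms(2) by (auto simp: par_def)
  have "\<exists>u\<in>lists I. ev u = ev v \<and> length u = len (ev v)" using v(1)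
  proof (induction v rule: rev_induct)
    case (snoc s v)
    then obtain u where u: "u \<in> lists I" "ev u = ev v" "length u = len (ev v)" by auto
    have s: "s \<in> I" "s \<in> S" "u \<in> lists S" using snoc u assms(1) by auto
    have "ev u \<in> par S" using s ev_par by auto
    from len_add_gen(1)[OF this s(2)] show ?case
    proof
      assume "len (ev u + g s) = Suc (len (ev u))"
      then show ?thesis using u s by (intro bexI[of _ "u @ [s]"]) auto
    next
      assume l: "Suc (len (ev u + g s)) = len (ev u)"
      then obtain u1 a u2 where "u = u1 @ a # u2" "ev u + g s = ev u1 + ev u2"
        using exchange_right[OF s(3,2)] by auto
      then show ?thesis using u l by (intro bexI[of _ "u1 @ u2"]) auto
    qed
  qed simp
  then show ?thesis using that v(2) by blast
qed

lemma par_lastE: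
  assumes "I \<subseteq> S" "w \<in> par I" "w \<noteq> 0"
  obtains s v where "s \<in> I" "v \<in> par I" "w = v + g s" "len w = Suc (len v)"
proof -
  obtain u where u: "u \<in> lists I" "ev u = w" "length u = len w" using par_reduced_word[OF assms(1,2)] .
  have "u \<noteq> []" using u assms(3) by auto
  then obtain v s where v: "u = v @ [s]" by (metis rev_exhaust)
  have vs: "s \<in> I" "v \<in> lists I" using u v by auto
  have vS: "v \<in> lists S" "s \<in> S" using vs assms(1) by auto
  have "len (ev v) \<le> length v" using len_le vS by blast
  moreover have "len (ev v + g s) \<le> len (ev v) + 1"
    using len_add_le[OF ev_par[OF vS(1)] par_gen[OF vS(2)]] len_gen[OF vS(2)] by simp
  ultimately have "len w = Suc (len (ev v))" using u v by auto
  then show ?thesis using that[OF vs(1) ev_par[OF vs(2)]] u v by simp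
qed

lemma par_firstE:
  assumes "I \<subseteq> S" "w \<in> par I" "w \<noteq> 0"
  obtains s v where "s \<in> I" "v \<in> par I" "w = g s + v" "len w = Suc (len v)"
proof -
  have "- w \<in> par I" "- w \<noteq> 0" using assms par_uminus by auto
  from par_lastE[OF assms(1) this] obtain s v where *: "s \<in> I" "v \<in> par I" "- w = v + g s" "len (- w) = Suc (len v)" .
  have "w = g s + - v" using *(1,3) assms(1) gen_uminus by (metis minus_add minus_minus subsetD)
  moreover have "len w = Suc (len (- v))"
    using *(4) len_uminus[OF par_subset[OF assms(1,2)]] len_uminus[OF par_subset[OF assms(1) *(2)]] by simp
  ultimately show ?thesis using that[OF *(1) par_uminus[OF assms(1) *(2)]] by blast
qed

section \<open>Minimal coset representatives\<close>

definition rmin :: "'s set \<Rightarrow> 'w \<Rightarrow> bool" where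
  "rmin J w \<longleftrightarrow> (\<forall>t\<in>J. len w < len (w + g t))"

text \<open>At the first letter of \<open>v\<close> where lengths fail to add, exchange deletes a
  letter either from the reduced word of \<open>w\<close>, producing a shorter element of the coset,
  or from that of \<open>v'\<close>, producing too short a word for \<open>v\<close>.\<close>

lemma coset_min_len_add:
  assumes J: "J \<subseteq> S" and w: "w \<in> par S" and min: "\<And>v. v \<in> par J \<Longrightarrow> len w \<le> len (w + v)"
    and v: "v \<in> par J"
  shows "len (w + v) = len w + len v"
  using v
proof (induction "len v" arbitrary: v)
  case 0
  then show ?case using len_eq_0 par_subset[OF J] by simp
next
  case (Suc n)
  then have "v \<noteq> 0" by auto
  from par_lastE[OF J Suc.prems this] obtain s v'
    where s: "s \<in> J" "v' \<in> par J" "v = v' + g s" "len v = Suc (len v')" .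
  have IH: "len (w + v') = len w + len v'" using Suc.hyps s by simp
  have sS: "s \<in> S" and v'S: "v' \<in> par S" using s J par_subset by auto
  have wv': "w + v' \<in> par S" using w v'S by (rule par_add)
  show ?case
  proof (rule ccontr)
    assume ne: "len (w + v) \<noteq> len w + len v"
    have le: "len (w + v' + g s) \<le> len (w + v')"
      using len_add_gen(1)[OF wv' sS] IH s ne by (simp add: add.assoc)
    obtain uw where uw: "uw \<in> lists S" "ev uw = w" "length uw = len w" using reduced_word[OF w] .
    obtain uv where uv: "uv \<in> lists J" "ev uv = v'" "length uv = len v'" using par_reduced_word[OF J s(2)] .
    have uvS: "uv \<in> lists S" using uv J by auto
    have "uw @ uv \<in> lists S" "len (ev (uw @ uv) + g s) \<le> len (ev (uw @ uv))"
      using uw uvS uv le by auto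
    from exchange_right[OF this(1) sS this(2)] uw(2) uv(2)
    obtain u1 a u2 where d: "uw @ uv = u1 @ a # u2" "w + v' + g s = ev u1 + ev u2"
      by (metis ev_simps(3))
    from d(1) obtain us where "uw = u1 @ us \<and> us @ uv = a # u2 \<or> uw @ us = u1 \<and> uv = us @ a # u2"
      by (auto simp: append_eq_append_conv2)
    then consider k where "uw = u1 @ a # k" "u2 = k @ uv" | k where "u1 = uw @ k" "uv = k @ a # u2"
      by (cases us) (use that(2)[of "[]"] in auto)
    then show False
    proof cases
      case 1
      have "w + v = ev u1 + ev k + v'" using d(2) 1 uv s(3) by (simp add: add.assoc)
      then have "w + v + - v' = ev (u1 @ k)" by (simp add: add.assoc[symmetric])
      moreover have "v + - v' \<in> par J" using Suc.prems s(2) by (simp only: par_add par_uminus[OF J])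
      ultimately have "len w \<le> len (ev (u1 @ k))" using min by (metis add.assoc)
      then show False using len_le[of "u1 @ k"] uw 1 by auto
    next
      case 2
      have "w + v = w + (ev k + ev u2)" using d(2) 2 uw s(3) by (simp add: add.assoc)
      then have "v = ev (k @ u2)" by simp
      then show False using len_le[of "k @ u2"] uv 2 uvS s(4) by auto
    qed
  qed
qed

text \<open>The local condition \<open>rmin\<close> implies global minimality: if
  \<open>w + v0\<close> is shortest in the coset and \<open>v0\<close> is not 0, then a last letter
  of \<open>- v0\<close> shortens \<open>w\<close>.\<close>

lemma rmin_len_add:
  assumes J: "J \<subseteq> S" and w: "w \<in> par S" and min: "rmin J w" and v: "v \<in> par J"
  shows "len (w + v) = len w + len v"
proof -
  obtain v0 where v0: "v0 \<in> par J" "\<And>v. v \<in> par J \<Longrightarrow> len (w + v0) \<le> len (w + v)"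
    using ex_has_least_nat[of "\<lambda>v. v \<in> par J" 0 "\<lambda>v. len (w + v)"] par_0 by blast
  have w0: "w + v0 \<in> par S" using w v0 par_subset[OF J] by (simp add: par_add)
  have m: "len (w + v0) \<le> len (w + v0 + v)" if "v \<in> par J" for v
    using v0(2)[of "v0 + v"] that v0(1) by (simp add: par_add add.assoc)
  have add: "len (w + v0 + v) = len (w + v0) + len v" if "v \<in> par J" for v
    by (rule coset_min_len_add[OF J w0 m that])
  have nv0: "- v0 \<in> par J" using v0 par_uminus[OF J] by simp
  have "v0 = 0"
  proof (rule ccontr)
    assume "v0 \<noteq> 0"
    then have "- v0 \<noteq> 0" by simp
    from par_lastE[OF J nv0 this] obtain t v' where t: "t \<in> J" "v' \<in> par J" "- v0 = v' + g t" "len (- v0) = Suc (len v')" .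
    have "w + g t = w + v0 + (- v0 + g t)" by (simp add: add.assoc)
    also have "- v0 + g t = v'" using t J gen_gen by auto
    finally have "len (w + g t) = len (w + v0) + len v'" using add t by simp
    moreover have "len w = len (w + v0) + len (- v0)" using add[OF nv0] by (simp add: add.assoc)
    ultimately show False using min t unfolding rmin_def by force
  qed
  then show ?thesis using add[OF v] by simp
qed

text \<open>This is Deodhar's lemma. If some \<open>t\<close> shortens \<open>g s + u\<close>,
  exchange deletes a letter of \<open>s # x\<close> with \<open>x\<close> reduced for
  \<open>u\<close>; a letter of \<open>x\<close> cannot be deleted, since \<open>t\<close> would
  then shorten \<open>u\<close>, so it is \<open>s\<close>.\<close>

lemma rmin_gen_add:
  assumes J: "J \<subseteq> S" and u: "u \<in> par S" and min: "rmin J u" and s: "s \<in> S" and up: "len u < len (g s + u)"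
  shows "rmin J (g s + u) \<or> (\<exists>t\<in>J. g s + u = u + g t)"
proof (rule ccontr)
  assume neg: "\<not> ?thesis"
  then obtain t where t: "t \<in> J" "len (g s + u + g t) \<le> len (g s + u)" unfolding rmin_def by force
  have tS: "t \<in> S" using t J by auto
  obtain x where x: "x \<in> lists S" "ev x = u" "length x = len u" using reduced_word[OF u] .
  have "s # x \<in> lists S" "len (ev (s # x) + g t) \<le> len (ev (s # x))" using x s t(2) by auto
  from exchange_right[OF this(1) tS this(2)] x(2)
  obtain u1 a u2 where d: "s # x = u1 @ a # u2" "g s + u + g t = ev u1 + ev u2"
    by (metis ev_simps(2))
  from d(1) consider "u1 = []" "u2 = x" | k where "u1 = s # k" "x = k @ a # u2"
    by (auto simp: Cons_eq_append_conv)
  then show False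
  proof cases
    case 1
    then have "g s + u + g t = u" using d x by simp
    then have "g s + u = u + g t" using gen_gen(2)[OF tS] by metis
    then show False using neg t by blast
  next
    case 2
    then have "u + g t = ev (k @ u2)" using d(2) by (simp add: add.assoc)
    then show False using len_le[of "k @ u2"] 2 x min t by (auto simp: rmin_def)
  qed
qed

section \<open>Dihedral subgroups\<close>

lemma reduced_dihedral_word:
  assumes "u \<in> lists {s, r}" "s \<in> S" "r \<in> S" "length u = len (ev u)"
  shows "u = alt s r (length u) \<or> u = alt r s (length u)"
  using assms(1,4)
proof (induction u rule: lists.induct)
  case (Cons a u)
  have uS: "u \<in> lists S" and aS: "a \<in> S" using Cons assms by auto
  have *: "length u = len (ev u)"
    using len_le[OF uS] len_add_gen(2)[OF ev_par[OF uS] aS] Cons.prems by auto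
  show ?case
  proof (cases u)
    case (Cons b u')
    have "a \<noteq> b"
    proof
      assume "a = b"
      then have "ev (a # u) = ev u'" using Cons gen_gen(1)[OF aS] by simp
      then show False using len_le[of u'] Cons Cons.prems uS \<open>length (a # u) = len (ev (a # u))\<close> by simp
    qed
    then show ?thesis using Cons.IH[OF *] Cons \<open>a \<in> {s, r}\<close> by auto
  next
    case Nil
    then show ?thesis using \<open>a \<in> {s, r}\<close> by auto
  qed
qed simp

lemma dihedral_element:
  assumes "w \<in> par {s, r}" "s \<in> S" "r \<in> S"
  shows "w = ev (alt s r (len w)) \<or> w = ev (alt r s (len w))"
proof -
  have "{s, r} \<subseteq> S" using assms by simp
  from par_reduced_word[OF this assms(1)] obtain u
    where u: "u \<in> lists {s, r}" "ev u = w" "length u = len w" .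
  then show ?thesis using reduced_dihedral_word[OF u(1) assms(2,3)] by metis
qed

text \<open>The braid relation rewrites the first \<open>n\<close> letters of a longer alternating
  word so that the last of them equals the next letter and cancels.\<close>

lemma dihedral_len_le:
  assumes s: "s \<in> S" and r: "r \<in> S" and n: "n > 0" and eq: "ev (alt s r n) = ev (alt r s n)"
    and w: "w \<in> par {s, r}"
  shows "len w \<le> n"
proof -
  have *: "len (ev (alt a b (n + Suc k))) < n + Suc k"
    if ab: "a \<in> S" "b \<in> S" and eq: "ev (alt a b n) = ev (alt b a n)" for a b k
  proof -
    obtain n' where n': "n = Suc n'" using n by (cases n) auto
    have "ev (alt a b (n + Suc k)) = ev (alt b a n) + ev (if even n then alt a b (Suc k) else alt b a (Suc k))"
      unfolding alt_add by (simp add: eq)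
    also have "alt b a n = alt b a n' @ [if even n' then b else a]"
      using alt_add[of b a n' 1] n' by simp
    also have "ev \<dots> + ev (if even n then alt a b (Suc k) else alt b a (Suc k)) =
        ev (alt b a n' @ (if even n then alt b a k else alt a b k))"
      using ab n' by (simp add: add.assoc gen_gen)
    also have "len \<dots> \<le> length (alt b a n' @ (if even n then alt b a k else alt a b k))"
      using ab by (intro len_le) (auto simp: alt_in_lists)
    also have "\<dots> = n' + k" by simp
    finally show ?thesis using n' by linarith
  qed
  show ?thesis
  proof (rule ccontr)
    assume "\<not> len w \<le> n"
    then obtain k where k: "len w = n + Suc k" by (metis add_Suc_right less_natE not_le)
    then show False
      using dihedral_element[OF w s r] *[OF s r eq, of k] *[OF r s eq[symmetric], of k] by force
  qed
qed

lemma dihedral_finite: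
  assumes s: "s \<in> S" and r: "r \<in> S" and n: "n > 0" and eq: "ev (alt s r n) = ev (alt r s n)"
  shows "finite (par {s, r})"
proof (rule finite_subset)
  show "par {s, r} \<subseteq> (\<lambda>k. ev (alt s r k)) ` {..n} \<union> (\<lambda>k. ev (alt r s k)) ` {..n}"
    using dihedral_len_le[OF assms] dihedral_element[OF _ s r] by blast
qed simp

text \<open>The second equation says that \<open>g s + w\<close> is the longest element.\<close>

lemma dihedral_conj:
  assumes s: "s \<in> S" and r: "r \<in> S" and t: "t \<in> {s, r}" and w: "w \<in> par {s, r}" "w \<noteq> 0"
    and up: "len w < len (g s + w)" and eq: "g s + w = w + g t"
  shows "w = ev (alt r s (len w))" "ev (alt s r (Suc (len w))) = ev (alt r s (Suc (len w)))"
proof -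
  have srS: "{s, r} \<subseteq> S" and tS: "t \<in> S" using s r t by auto
  have wS: "w \<in> par S" using par_subset[OF srS w(1)] .
  define n where "n = len w"
  have n0: "n > 0" using w(2) len_eq_0[OF wS] by (simp add: n_def)
  have lsw: "len (g s + w) = Suc n" using len_add_gen(2)[OF wS s] up by (simp add: n_def)
  show w1: "w = ev (alt r s (len w))"
  proof (rule ccontr)
    assume "w \<noteq> ev (alt r s (len w))"
    then have "w = ev (alt s r n)" using dihedral_element[OF w(1) s r] n_def by blast
    moreover obtain n' where n': "n = Suc n'" using n0 by (cases n) auto
    ultimately have "g s + w = ev (alt r s n')" using gen_gen(1)[OF s] by simp
    then show False using len_le[of "alt r s n'"] s r n' lsw by (simp add: alt_in_lists)
  qed
  \<comment> \<open>This is a second reduced word for \<open>g s + w\<close>. Reduced words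
    alternate and this one begins with \<open>r\<close>, whereas \<open>g s + w\<close> also has the
    word beginning with \<open>s\<close>: a braid relation.\<close>
  have "alt r s n @ [t] \<in> lists {s, r}" using t by (auto simp: alt_in_lists)
  moreover have ev: "ev (alt r s n @ [t]) = g s + w" using w1 eq n_def by simp
  ultimately have "alt r s n @ [t] = alt s r (Suc n) \<or> alt r s n @ [t] = alt r s (Suc n)"
    using reduced_dihedral_word[of "alt r s n @ [t]" s r] s r lsw by simp
  moreover have "r = s" if "alt r s n @ [t] = alt s r (Suc n)"
    using that n0 by (cases n) auto
  ultimately have "alt r s n @ [t] = alt r s (Suc n)" by auto
  then have "ev (alt r s (Suc n)) = g s + w" using ev by metis
  also have "\<dots> = ev (alt s r (Suc n))" using w1 by (simp flip: n_def)
  finally show "ev (alt s r (Suc (len w))) = ev (alt r s (Suc (len w)))" by (simp only: n_def)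
qed

text \<open>Each of \<open>g s + w\<close> and \<open>g s + w'\<close> has maximal length, so
  \<open>w\<close> and \<open>w'\<close> have equal length; both are alternating words beginning
  with \<open>r\<close>. The condition \<open>w \<noteq> 0\<close> excludes the trivial solution
  \<open>t = s\<close>.\<close>

lemma dihedral_conj_unique:
  assumes s: "s \<in> S" and r: "r \<in> S"
    and t: "t \<in> {s, r}" and w: "w \<in> par {s, r}" "w \<noteq> 0" "len w < len (g s + w)" "g s + w = w + g t"
    and t': "t' \<in> {s, r}" and w': "w' \<in> par {s, r}" "w' \<noteq> 0" "len w' < len (g s + w')" "g s + w' = w' + g t'"
  shows "w = w'"
proof -
  note c = dihedral_conj[OF s r t w] and c' = dihedral_conj[OF s r t' w']
  have p: "g s + w \<in> par {s, r}" "g s + w' \<in> par {s, r}" by (rule par_add[OF par_gen w(1)], simp) (rule par_add[OF par_gen w'(1)], simp)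
  have "len (g s + w') \<le> Suc (len w)" by (rule dihedral_len_le[OF s r _ c(2) p(2)]) simp
  moreover have "len (g s + w) \<le> Suc (len w')" by (rule dihedral_len_le[OF s r _ c'(2) p(1)]) simp
  ultimately have "len w = len w'" using w(3) w'(3) by simp
  then show ?thesis using c(1) c'(1) by metis
qed

text \<open>A longest element is shortened by both generators, so it has reduced words beginning
  with \<open>r\<close> and with \<open>s\<close>. Removing the first letter of one, or the last
  letter of the other, leaves the same word, which is \<open>a\<close>.\<close>

lemma dihedral_longest:
  assumes s: "s \<in> S" and r: "r \<in> S" and fin: "finite (par {s, r})"
  obtains w0 a t where "w0 \<in> par {s, r}" "a \<in> par {s, r}" "t \<in> {s, r}" "w0 = g r + a" "g r + a = a + g t"
    "len (g s + w0) < len w0"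
proof -
  have srS: "{s, r} \<subseteq> S" using s r by auto
  have "Max (len ` par {s, r}) \<in> len ` par {s, r}"
    using fin par_0[of "{s, r}"] by (intro Max_in) auto
  then obtain w0 where w0: "w0 \<in> par {s, r}" "len w0 = Max (len ` par {s, r})" by auto
  have max: "len w \<le> len w0" if "w \<in> par {s, r}" for w
    using that fin w0(2) by simp
  have w0S: "w0 \<in> par S" using par_subset[OF srS w0(1)] .
  have desc: "Suc (len (g x + w0)) = len w0" if "x \<in> {s, r}" for x
  proof -
    have "x \<in> S" using that srS by blast
    from len_add_gen(2)[OF w0S this] max[OF par_add[OF par_gen[OF that] w0(1)]] show ?thesis by linarith
  qed
  define n where "n = len (g r + w0)"
  have word: "w0 = ev (alt x y (Suc n))" if xy: "{x, y} = {s, r}" for x y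
  proof -
    have x: "x \<in> {s, r}" unfolding xy[symmetric] by simp
    have xS: "x \<in> S" "y \<in> S" using xy srS by blast+
    have l: "len w0 = Suc n" using desc[of r] by (simp add: n_def)
    then have lx: "len (g x + w0) = n" using desc[OF x] by simp
    have "g x + w0 \<in> par {s, r}" by (rule par_add[OF par_gen[OF x] w0(1)])
    then obtain u where u: "u \<in> lists {s, r}" "ev u = g x + w0" "length u = n"
      unfolding lx[symmetric] by (rule par_reduced_word[OF srS])
    have ev: "ev (x # u) = w0" using u gen_gen xS by simp
    have "x # u \<in> lists {x, y}" unfolding xy using u(1) x by simp
    moreover have "length (x # u) = len (ev (x # u))" unfolding ev l using u(3) by simp
    ultimately have "x # u = alt x y (Suc n) \<or> x # u = alt y x (Suc n)"
      using reduced_dihedral_word[of "x # u" x y] xS u(3) by simp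
    then have "x # u = alt x y (Suc n)" by auto
    then show ?thesis using ev by simp
  qed
  define a where "a = ev (alt s r n)"
  define t where "t = (if even n then s else r)"
  have "w0 = g r + a" using word[of r s] by (simp add: a_def doubleton_eq_iff)
  moreover have "w0 = a + g t" unfolding word[OF refl] alt_Suc_right a_def t_def by simp
  moreover have "a \<in> par {s, r}" by (simp add: a_def ev_par alt_in_lists)
  moreover have "t \<in> {s, r}" by (simp add: t_def)
  moreover have "len (g s + w0) < len w0" using desc[of s] by simp
  ultimately show ?thesis using that w0(1) by metis
qed

lemma commuting_conj:
  assumes s: "s \<in> S" and r: "r \<in> S" and com: "g s + g r = g r + g s" and w: "w \<in> par {s, r}"
  shows "g s + w = w + g s"
proof -
  obtain u where "u \<in> lists {s, r}" "ev u = w" using w by (auto simp: par_def)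
  moreover have "g s + ev u = ev u + g s" if "u \<in> lists {s, r}" for u
    using that
  proof (induction u rule: lists.induct)
    case (Cons a u)
    have "g s + g a = g a + g s" using Cons com by auto
    then have "g s + (g a + ev u) = g a + (g s + ev u)" by (simp flip: add.assoc)
    then show ?case using Cons.IH by (simp add: add.assoc)
  qed simp
  ultimately show ?thesis by blast
qed

end

section \<open>Buildings as Weyl distance spaces\<close>

text \<open>Weak axioms for a Weyl distance: \<open>delta_step\<close> leaves open which of the two
  values occurs, even when \<open>s\<close> lengthens the distance. The missing uniqueness is
  derived in \<open>nearest_in_panel_unique\<close>. By contrast \<open>delta_split\<close> holds
  for every factorization, reduced or not.\<close>

locale weyl_building = coxeter_system S g for S :: "'s set" and g :: "'s \<Rightarrow> 'w::group_add" +
  fixes C :: "'c set" and \<delta> :: "'c \<Rightarrow> 'c \<Rightarrow> 'w"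
  assumes delta_par: "x \<in> C \<Longrightarrow> y \<in> C \<Longrightarrow> \<delta> x y \<in> par S"
    and delta_eq_0: "x \<in> C \<Longrightarrow> y \<in> C \<Longrightarrow> \<delta> x y = 0 \<longleftrightarrow> x = y"
    and delta_commute: "x \<in> C \<Longrightarrow> y \<in> C \<Longrightarrow> \<delta> y x = - \<delta> x y"
    and delta_step: "x \<in> C \<Longrightarrow> x' \<in> C \<Longrightarrow> y \<in> C \<Longrightarrow> s \<in> S \<Longrightarrow> \<delta> x x' = g s \<Longrightarrow>
      \<delta> x' y = \<delta> x y \<or> \<delta> x' y = g s + \<delta> x y"
    and delta_split: "x \<in> C \<Longrightarrow> y \<in> C \<Longrightarrow> v \<in> par S \<Longrightarrow> w \<in> par S \<Longrightarrow> \<delta> x y = v + w \<Longrightarrow>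
      \<exists>z\<in>C. \<delta> x z = v \<and> \<delta> z y = w"
    and delta_extend: "x \<in> C \<Longrightarrow> w \<in> par S \<Longrightarrow> \<exists>y\<in>C. \<delta> x y = w"
begin

lemma delta_gen_commute: "x \<in> C \<Longrightarrow> y \<in> C \<Longrightarrow> s \<in> S \<Longrightarrow> \<delta> x y = g s \<Longrightarrow> \<delta> y x = g s"
  using delta_commute[of x y] gen_uminus by simp

lemma minus_gen: "s \<in> S \<Longrightarrow> w - g s = w + g s"
  using add_uminus_conv_diff[of w "g s"] gen_uminus by simp

lemma len_delta_commute: "x \<in> C \<Longrightarrow> y \<in> C \<Longrightarrow> len (\<delta> y x) = len (\<delta> x y)"
  using delta_commute[of x y] len_uminus[OF delta_par] by simp

lemma delta_step_right:
  assumes "x \<in> C" "y \<in> C" "y' \<in> C" "s \<in> S" "\<delta> y y' = g s"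
  shows "\<delta> x y' = \<delta> x y \<or> \<delta> x y' = \<delta> x y + g s"
proof -
  have "\<delta> x y' = - \<delta> y' x" "\<delta> y x = - \<delta> x y" using delta_commute assms by blast+
  then show ?thesis using delta_step[OF assms(2,3,1,4,5)] gen_uminus[OF assms(4)]
    by (auto simp: minus_add minus_gen[OF assms(4)])
qed

text \<open>Uniqueness of the chamber of a panel nearest to \<open>y\<close>: if two adjacent chambers were
  equally near, moving \<open>y\<close> one step towards one of them would keep this so.\<close>

lemma nearest_in_panel_unique:
  assumes "x \<in> C" "x' \<in> C" "y \<in> C" "s \<in> S" "\<delta> x x' = g s" "\<delta> x' y = \<delta> x y"
  shows "\<not> len (\<delta> x y) < len (g s + \<delta> x y)"
  using assms(3,6)
proof (induction "len (\<delta> x y)" arbitrary: y rule: less_induct)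
  case less
  note xS = assms(1,2,4,5)
  define w where "w = \<delta> x y"
  have w: "w \<in> par S" "\<delta> x' y = w" using less delta_par xS by (auto simp: w_def)
  show ?case unfolding w_def[symmetric]
  proof
    assume up: "len w < len (g s + w)"
    have "w \<noteq> 0"
    proof
      assume "w = 0"
      then have "x = y" "x' = y"
        using delta_eq_0[OF xS(1) less.prems(1)] delta_eq_0[OF xS(2) less.prems(1)] w(2) by (simp_all add: w_def)
      then show False using gen_neq_0[OF xS(3)] delta_eq_0[OF xS(1,2)] xS(4) by simp
    qed
    from par_lastE[OF subset_refl w(1) this] obtain t v where
      t: "t \<in> S" "v \<in> par S" "w = v + g t" "len w = Suc (len v)" .
    from delta_split[OF xS(1) less.prems(1) t(2) par_gen[OF t(1)]] t(3)
    obtain z where z: "z \<in> C" "\<delta> x z = v" "\<delta> z y = g t" by (auto simp: w_def)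
    have "\<delta> x' z = w \<or> \<delta> x' z = v"
      using delta_step_right[OF xS(2) less.prems(1) z(1) t(1) delta_gen_commute[OF z(1) less.prems(1) t(1) z(3)]]
      unfolding w(2) t(3) by (simp add: gen_gen(2)[OF t(1)])
    moreover have "\<delta> x' z = v \<or> \<delta> x' z = g s + v"
      using delta_step[OF xS(1,2) z(1) xS(3,4)] z(2) by simp
    ultimately consider "\<delta> x' z = v" | "w = g s + v" by auto
    then show False
    proof cases
      case 1
      then have "\<not> len v < len (g s + v)" using less.hyps[of z] z t(4) by (simp add: w_def)
      moreover have "len (g s + w) \<le> len (g s + v) + len (g t)"
        using len_add_le[OF par_add[OF par_gen[OF xS(3)] t(2)] par_gen[OF t(1)]] t(3) by (simp add: add.assoc)
      ultimately show False using up t(4) len_gen[OF t(1)] by simp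
    next
      case 2
      then have "g s + w = v" using gen_gen(1)[OF xS(3)] by simp
      then show False using up t(4) by simp
    qed
  qed
qed

lemma delta_up:
  assumes "x \<in> C" "x' \<in> C" "y \<in> C" "s \<in> S" "\<delta> x x' = g s" "len (\<delta> x y) < len (g s + \<delta> x y)"
  shows "\<delta> x' y = g s + \<delta> x y"
  using delta_step[OF assms(1-5)] nearest_in_panel_unique[OF assms(1-5)] assms(6) by auto

lemma delta_up_right:
  assumes "x \<in> C" "y \<in> C" "y' \<in> C" "s \<in> S" "\<delta> y y' = g s" "len (\<delta> x y) < len (\<delta> x y + g s)"
  shows "\<delta> x y' = \<delta> x y + g s"
proof -
  have 1: "\<delta> x y' = - \<delta> y' x" "\<delta> y x = - \<delta> x y" using delta_commute assms by blast+
  have "g s + \<delta> y x = - (\<delta> x y + g s)" using 1 gen_uminus[OF assms(4)] by (simp add: minus_add)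
  then have "len (\<delta> y x) < len (g s + \<delta> y x)"
    using assms(6) 1 delta_par[OF assms(1,2)] par_gen[OF assms(4)] by (simp add: len_uminus par_add)
  from delta_up[OF assms(2,3,1,4,5) this] show ?thesis
    using 1 by (simp add: minus_add minus_gen[OF assms(4)])
qed

text \<open>Along a reduced word for \<open>\<delta> y z\<close> the distance from \<open>x\<close>
  grows at each letter, by \<open>rmin_len_add\<close>, and a growing step is determined by
  \<open>delta_up_right\<close>.\<close>

lemma delta_gate:
  assumes J: "J \<subseteq> S" and C: "x \<in> C" "y \<in> C" "z \<in> C"
    and min: "rmin J (\<delta> x y)" and v: "\<delta> y z \<in> par J"
  shows "\<delta> x z = \<delta> x y + \<delta> y z"
  using C(3) v
proof (induction "len (\<delta> y z)" arbitrary: z)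
  case 0
  then have "\<delta> y z = 0" using len_eq_0 par_subset[OF J] by simp
  then show ?case using delta_eq_0[OF C(2) 0(2)] by simp
next
  case (Suc n)
  then have "\<delta> y z \<noteq> 0" by auto
  from par_lastE[OF J Suc.prems(2) this] obtain t v where
    t: "t \<in> J" "v \<in> par J" "\<delta> y z = v + g t" "len (\<delta> y z) = Suc (len v)" .
  have tS: "t \<in> S" "v \<in> par S" using t J par_subset by auto
  from delta_split[OF C(2) Suc.prems(1) tS(2) par_gen[OF tS(1)] t(3)]
  obtain z' where z': "z' \<in> C" "\<delta> y z' = v" "\<delta> z' z = g t" by auto
  have IH: "\<delta> x z' = \<delta> x y + v" using Suc.hyps(1)[of z'] Suc.hyps(2) z' t by simp
  note l = rmin_len_add[OF J delta_par[OF C(1,2)] min]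
  have "len (\<delta> x z') < len (\<delta> x z' + g t)"
    using l[OF t(2)] l[OF Suc.prems(2)] t IH by (simp add: add.assoc)
  from delta_up_right[OF C(1) z'(1) Suc.prems(1) tS(1) z'(3) this] show ?case
    using IH t(3) by (simp add: add.assoc)
qed

lemma delta_par_trans:
  assumes J: "J \<subseteq> S" and C: "x \<in> C" "y \<in> C" "z \<in> C" and u: "\<delta> x y \<in> par J" and v: "\<delta> y z \<in> par J"
  shows "\<delta> x z \<in> par J"
  using C(3) v
proof (induction "len (\<delta> y z)" arbitrary: z)
  case 0
  then have "\<delta> y z = 0" using len_eq_0 par_subset[OF J] by simp
  then show ?case using delta_eq_0[OF C(2) 0(2)] u by simp
next
  case (Suc n)
  then have "\<delta> y z \<noteq> 0" by auto
  from par_lastE[OF J Suc.prems(2) this] obtain t v where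
    t: "t \<in> J" "v \<in> par J" "\<delta> y z = v + g t" "len (\<delta> y z) = Suc (len v)" .
  have tS: "t \<in> S" "v \<in> par S" using t J par_subset by auto
  from delta_split[OF C(2) Suc.prems(1) tS(2) par_gen[OF tS(1)] t(3)]
  obtain z' where z': "z' \<in> C" "\<delta> y z' = v" "\<delta> z' z = g t" by auto
  have IH: "\<delta> x z' \<in> par J" using Suc.hyps(1)[of z'] Suc.hyps(2) z' t by simp
  then have "\<delta> x z' + g t \<in> par J" by (rule par_add[OF _ par_gen[OF t(1)]])
  then show ?case using delta_step_right[OF C(1) z'(1) Suc.prems(1) tS(1) z'(3)] IH by auto
qed

section \<open>Residues and panels\<close>

definition res :: "'s set \<Rightarrow> 'c \<Rightarrow> 'c set" where
  "res J x = {y \<in> C. \<delta> x y \<in> par J}"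

lemma res_C: "y \<in> res J x \<Longrightarrow> y \<in> C"
  by (simp add: res_def)

lemma res_self: "x \<in> C \<Longrightarrow> x \<in> res J x"
  using delta_eq_0[of x x] par_0 by (simp add: res_def)

lemma res_eq:
  assumes J: "J \<subseteq> S" and x: "x \<in> C" and y: "y \<in> res J x"
  shows "res J y = res J x"
proof -
  have yC: "y \<in> C" and xy: "\<delta> x y \<in> par J" using y by (auto simp: res_def)
  have yx: "\<delta> y x \<in> par J" using delta_commute[OF x yC] par_uminus[OF J xy] by simp
  show ?thesis unfolding res_def
    using delta_par_trans[OF J x yC _ xy] delta_par_trans[OF J yC x _ yx] by auto
qed

lemma par_singleton:
  assumes "s \<in> S"
  shows "par {s} = {0, g s}"
proof (intro equalityI subsetI)
  fix w assume "w \<in> par {s}"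
  then obtain u where "u \<in> lists {s}" "ev u = w" by (auto simp: par_def)
  moreover have "ev u \<in> {0, g s}" if "u \<in> lists {s}" for u
    using that by (induction u rule: lists.induct) (auto simp: gen_involution[OF assms])
  ultimately show "w \<in> {0, g s}" by blast
qed (auto simp: par_0 par_gen)

lemma panel_iff: "s \<in> S \<Longrightarrow> x \<in> C \<Longrightarrow> y \<in> res {s} x \<longleftrightarrow> y \<in> C \<and> (y = x \<or> \<delta> x y = g s)"
  using delta_eq_0[of x y] by (auto simp: res_def par_singleton)

lemma panel_other:
  assumes "s \<in> S" "x \<in> C"
  obtains y where "y \<in> res {s} x" "y \<noteq> x" "\<delta> x y = g s"
proof -
  obtain y where "y \<in> C" "\<delta> x y = g s" using delta_extend[OF assms(2) par_gen[OF assms(1)]] by auto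
  moreover have "y \<noteq> x" using calculation delta_eq_0[OF assms(2,2)] gen_neq_0[OF assms(1)] by auto
  ultimately show ?thesis using that panel_iff[OF assms] by blast
qed

lemma delta_panel:
  assumes "s \<in> S" "x \<in> C" "p \<in> res {s} x" "q \<in> res {s} x" "p \<noteq> q"
  shows "\<delta> p q = g s"
proof -
  have "{s} \<subseteq> S" using assms by simp
  from res_eq[OF this assms(2,3)] have "q \<in> res {s} p" using assms by simp
  then show ?thesis using panel_iff[OF assms(1) res_C[OF assms(3)]] assms(5) by auto
qed

section \<open>Projections to residues\<close>

definition pr :: "'c set \<Rightarrow> 'c \<Rightarrow> 'c" where
  "pr R x = (THE c. c \<in> R \<and> (\<forall>d\<in>R. len (\<delta> x c) \<le> len (\<delta> x d)))"

lemma res_delta: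
  assumes J: "J \<subseteq> S" and "r \<in> C" "c \<in> res J r" "d \<in> res J r"
  shows "\<delta> c d \<in> par J"
  using res_eq[OF assms(1-3)] assms(4) by (auto simp: res_def)

lemma gate_dist:
  assumes J: "J \<subseteq> S" and r: "r \<in> C" and x: "x \<in> C" and c: "c \<in> res J r" and min: "rmin J (\<delta> x c)"
    and d: "d \<in> res J r"
  shows "\<delta> x d = \<delta> x c + \<delta> c d" "len (\<delta> x d) = len (\<delta> x c) + len (\<delta> c d)"
proof -
  have C: "c \<in> C" "d \<in> C" using c d res_C by auto
  have cd: "\<delta> c d \<in> par J" by (rule res_delta[OF J r c d])
  show *: "\<delta> x d = \<delta> x c + \<delta> c d" by (rule delta_gate[OF J x C min cd])
  show "len (\<delta> x d) = len (\<delta> x c) + len (\<delta> c d)"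
    unfolding * by (rule rmin_len_add[OF J delta_par[OF x C(1)] min cd])
qed

lemma pr_eqI:
  assumes J: "J \<subseteq> S" and r: "r \<in> C" and x: "x \<in> C" and c: "c \<in> res J r" and min: "rmin J (\<delta> x c)"
  shows "pr (res J r) x = c"
  unfolding pr_def
proof (rule the_equality)
  show "c \<in> res J r \<and> (\<forall>d\<in>res J r. len (\<delta> x c) \<le> len (\<delta> x d))"
    using c by (auto dest: gate_dist(2)[OF assms])
  fix d assume d: "d \<in> res J r \<and> (\<forall>e\<in>res J r. len (\<delta> x d) \<le> len (\<delta> x e))"
  then have "len (\<delta> x d) \<le> len (\<delta> x c)" using c by blast
  then have "len (\<delta> c d) = 0" using gate_dist(2)[OF assms, of d] d by linarith
  then show "d = c"
    using len_eq_0[OF delta_par] delta_eq_0[of c d] res_C[OF c] res_C[of d J r] d by simp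
qed

lemma rmin_minimal:
  assumes J: "J \<subseteq> S" and r: "r \<in> C" and x: "x \<in> C" and c: "c \<in> res J r"
    and min: "\<And>d. d \<in> res J r \<Longrightarrow> len (\<delta> x c) \<le> len (\<delta> x d)"
  shows "rmin J (\<delta> x c)"
  unfolding rmin_def
proof
  fix t assume t: "t \<in> J"
  have tS: "t \<in> S" and cC: "c \<in> C" using t J c res_C by auto
  have xc: "\<delta> x c \<in> par S" by (rule delta_par[OF x cC])
  have "\<delta> x c = (\<delta> x c + g t) + g t" using gen_gen(2)[OF tS] by simp
  from delta_split[OF x cC par_add[OF xc par_gen[OF tS]] par_gen[OF tS] this]
  obtain d where d: "d \<in> C" "\<delta> x d = \<delta> x c + g t" "\<delta> d c = g t" by auto
  have "\<delta> c d = g t" by (rule delta_gen_commute[OF d(1) cC tS d(3)])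
  then have "d \<in> res J c" using d par_gen[OF t] by (simp add: res_def)
  then have "d \<in> res J r" using res_eq[OF J r c] by simp
  then show "len (\<delta> x c) < len (\<delta> x c + g t)"
    using min d(2) len_gen_neq(1)[OF xc tS] by fastforce
qed

lemma pr_gate:
  assumes J: "J \<subseteq> S" and r: "r \<in> C" and x: "x \<in> C"
  shows "pr (res J r) x \<in> res J r" "rmin J (\<delta> x (pr (res J r) x))"
proof -
  obtain c where c: "c \<in> res J r" "\<And>d. d \<in> res J r \<Longrightarrow> len (\<delta> x c) \<le> len (\<delta> x d)"
    using ex_has_least_nat[of "\<lambda>c. c \<in> res J r" r "\<lambda>c. len (\<delta> x c)"] res_self[OF r] by blast
  have min: "rmin J (\<delta> x c)" by (rule rmin_minimal[OF J r x c])
  show "pr (res J r) x \<in> res J r" "rmin J (\<delta> x (pr (res J r) x))"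
    using pr_eqI[OF J r x c(1) min] c min by auto
qed

lemma pr_min:
  assumes "J \<subseteq> S" "r \<in> C" "x \<in> C" "d \<in> res J r"
  shows "len (\<delta> x (pr (res J r) x)) \<le> len (\<delta> x d)"
  using gate_dist(2)[OF assms(1-3) pr_gate[OF assms(1-3)] assms(4)] by linarith

lemma pr_self:
  assumes "J \<subseteq> S" "r \<in> C" "x \<in> res J r"
  shows "pr (res J r) x = x"
proof (rule pr_eqI[OF assms(1,2) res_C[OF assms(3)] assms(3)])
  show "rmin J (\<delta> x x)"
    using delta_eq_0[of x x] res_C[OF assms(3)] assms(1) len_gen by (auto simp: rmin_def)
qed

text \<open>The Weyl distance from \<open>x\<close> to the gate \<open>d\<close> of \<open>c\<close>
  is the sum of those through the gate \<open>c\<close>, with lengths adding; minimality of the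
  second summand thus carries over to the sum.\<close>

lemma pr_comp:
  assumes J: "J \<subseteq> K" and K: "K \<subseteq> S" and r: "r \<in> C" and q: "q \<in> res K r" and x: "x \<in> C"
  shows "pr (res J q) (pr (res K r) x) = pr (res J q) x"
proof -
  have JS: "J \<subseteq> S" and qC: "q \<in> C" using J K q res_C by auto
  define c where "c = pr (res K r) x"
  have c: "c \<in> res K r" "rmin K (\<delta> x c)" using pr_gate[OF K r x] by (auto simp: c_def)
  have cC: "c \<in> C" using c res_C by auto
  define d where "d = pr (res J q) c"
  have d: "d \<in> res J q" "rmin J (\<delta> c d)" using pr_gate[OF JS qC cC] by (auto simp: d_def)
  have "res J q \<subseteq> res K q" using par_mono[OF J] by (auto simp: res_def)
  then have dK: "d \<in> res K r" using d res_eq[OF K r q] by auto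
  have cd: "\<delta> c d \<in> par K" by (rule res_delta[OF K r c(1) dK])
  note add = rmin_len_add[OF K delta_par[OF x cC] c(2)]
  have xd: "\<delta> x d = \<delta> x c + \<delta> c d" by (rule gate_dist(1)[OF K r x c dK])
  have "rmin J (\<delta> x d)" unfolding rmin_def
  proof
    fix t assume t: "t \<in> J"
    then have "\<delta> c d + g t \<in> par K" using J by (intro par_add[OF cd par_gen]) auto
    from add[OF this] add[OF cd] show "len (\<delta> x d) < len (\<delta> x d + g t)"
      using d(2) t by (simp add: xd rmin_def add.assoc)
  qed
  then have "pr (res J q) x = d" by (rule pr_eqI[OF JS qC x d(1)])
  then show ?thesis by (simp add: c_def d_def)
qed

section \<open>Projections between a panel and a residue\<close>

definition pll :: "'c set \<Rightarrow> 'c set \<Rightarrow> bool" where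
  "pll R Q \<longleftrightarrow> pr R ` Q = R \<and> pr Q ` R = Q"

lemma pll_sym: "pll R Q \<Longrightarrow> pll Q R"
  by (auto simp: pll_def)

lemma pll_refl: "J \<subseteq> S \<Longrightarrow> r \<in> C \<Longrightarrow> pll (res J r) (res J r)"
  by (simp add: pll_def pr_self)

text \<open>Changing the chambers within the two panels replaces \<open>w\<close> by
  \<open>g s + w\<close> or \<open>w + g t\<close>, and the relation
  \<open>g s + w = w + g t\<close> survives both changes.\<close>

lemma panel_conj_elements:
  assumes s: "s \<in> S" and t: "t \<in> S" and C: "x \<in> C" "q \<in> C" and conj: "g s + \<delta> x q = \<delta> x q + g t"
    and p: "p \<in> res {s} x" and q': "q' \<in> res {t} q"
  shows "g s + \<delta> p q' = \<delta> p q' + g t"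
proof -
  have pC: "p \<in> C" "q' \<in> C" using p q' res_C by auto
  have 1: "\<delta> p q = \<delta> x q \<or> \<delta> p q = g s + \<delta> x q"
    using p delta_step[OF C(1) pC(1) C(2) s] panel_iff[OF s C(1)] by auto
  have c1: "g s + \<delta> p q = \<delta> p q + g t"
    using 1
  proof
    assume e: "\<delta> p q = g s + \<delta> x q"
    show ?thesis unfolding e gen_gen(1)[OF s] unfolding conj gen_gen(2)[OF t] ..
  qed (use conj in simp)
  have "\<delta> p q' = \<delta> p q \<or> \<delta> p q' = \<delta> p q + g t"
    using q' delta_step_right[OF pC(1) C(2) pC(2) t] panel_iff[OF t C(2)] by auto
  then show ?thesis using c1 by (auto simp: add.assoc[symmetric])
qed

lemma panel_pr_onto:
  assumes s: "s \<in> S" and t: "t \<in> S" and C: "x \<in> C" "q \<in> C" and conj: "g s + \<delta> x q = \<delta> x q + g t"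
  shows "pr (res {t} q) ` res {s} x = res {t} q"
proof (intro equalityI subsetI)
  have tS: "{t} \<subseteq> S" using t by simp
  fix z assume "z \<in> pr (res {t} q) ` res {s} x"
  then show "z \<in> res {t} q" using pr_gate(1)[OF tS C(2)] res_C by auto
next
  have tS: "{t} \<subseteq> S" using t by simp
  fix z assume z: "z \<in> res {t} q"
  have zC: "z \<in> C" using z res_C by auto
  have c: "g s + \<delta> x z = \<delta> x z + g t" by (rule panel_conj_elements[OF s t C conj res_self[OF C(1)] z])
  have xz: "\<delta> x z \<in> par S" by (rule delta_par[OF C(1) zC])
  show "z \<in> pr (res {t} q) ` res {s} x"
  proof (cases "len (\<delta> x z) < len (\<delta> x z + g t)")
    case True
    then have "pr (res {t} q) x = z" by (intro pr_eqI[OF tS C(2) C(1) z]) (simp add: rmin_def)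
    then show ?thesis using res_self[OF C(1)] by blast
  next
    case False
    \<comment> \<open>When \<open>x\<close> itself does not project to \<open>z\<close>, the chamber
      \<open>p\<close> of its panel at distance \<open>g s + \<delta> x z\<close> from
      \<open>z\<close> does: multiplying by \<open>g s\<close> on the left is multiplying by
      \<open>g t\<close> on the right.\<close>
    have "\<delta> x z = g s + (g s + \<delta> x z)" using gen_gen(1)[OF s] by simp
    from delta_split[OF C(1) zC par_gen[OF s] par_add[OF par_gen[OF s] xz] this]
    obtain p where p: "p \<in> C" "\<delta> x p = g s" "\<delta> p z = g s + \<delta> x z" by auto
    have "len (\<delta> p z) < len (\<delta> p z + g t)"
      using False len_gen_neq(1)[OF xz t] p(3) c by (simp add: gen_gen(2)[OF t])
    then have "pr (res {t} q) p = z" by (intro pr_eqI[OF tS C(2) p(1) z]) (simp add: rmin_def)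
    moreover have "p \<in> res {s} x" using p panel_iff[OF s C(1)] by simp
    ultimately show ?thesis by blast
  qed
qed

lemma uminus_conj: "a + w = w + b \<Longrightarrow> - b + - w = - w + - a" for a b w :: "'x::group_add"
  by (simp only: minus_add[symmetric])

lemma conj_delta_flip:
  assumes "s \<in> S" "t \<in> S" "x \<in> C" "q \<in> C" "g s + \<delta> x q = \<delta> x q + g t"
  shows "g t + \<delta> q x = \<delta> q x + g s"
  using uminus_conj[OF assms(5)] gen_uminus[OF assms(1)] gen_uminus[OF assms(2)]
  unfolding delta_commute[OF assms(3,4)] by simp

lemma panel_pll:
  assumes s: "s \<in> S" and t: "t \<in> S" and C: "x \<in> C" "q \<in> C" and conj: "g s + \<delta> x q = \<delta> x q + g t"
  shows "pll (res {s} x) (res {t} q)"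
proof -
  from panel_pr_onto[OF t s C(2,1) conj_delta_flip[OF assms]] panel_pr_onto[OF assms] show ?thesis by (simp add: pll_def)
qed

definition separates :: "'c set \<Rightarrow> 'c set \<Rightarrow> bool" where
  "separates T P \<longleftrightarrow> (\<exists>p\<in>P. \<exists>q\<in>P. pr T p \<noteq> pr T q)"

lemma separates_onto_panel:
  assumes "s \<in> S" "x \<in> C" "pr T ` P = res {s} x"
  shows "separates T P"
proof -
  obtain y where y: "y \<in> res {s} x" "y \<noteq> x" using panel_other[OF assms(1,2)] by blast
  have "x \<in> pr T ` P" "y \<in> pr T ` P" using y res_self[OF assms(2)] assms(3) by auto
  then show ?thesis using y(2) unfolding separates_def by blast
qed

text \<open>By Deodhar's lemma the alternative is that \<open>g s + \<delta> x c\<close> is again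
  minimal; then \<open>c\<close> would be the gate of every chamber of the panel and the projection
  constant.\<close>

lemma separates_conj:
  assumes s: "s \<in> S" and K: "K \<subseteq> S" and r: "r \<in> C" and x: "x \<in> C" and c: "c \<in> res K r"
    and min: "rmin K (\<delta> x c)" and up: "len (\<delta> x c) < len (g s + \<delta> x c)"
    and sep: "separates (res K r) (res {s} x)"
  shows "\<exists>t\<in>K. g s + \<delta> x c = \<delta> x c + g t"
proof -
  have cC: "c \<in> C" using c res_C by auto
  have "\<not> rmin K (g s + \<delta> x c)"
  proof
    assume r': "rmin K (g s + \<delta> x c)"
    have "pr (res K r) p = c" if p: "p \<in> res {s} x" for p
    proof (cases "p = x")
      case True
      then show ?thesis using pr_eqI[OF K r x c min] by simp
    next
      case False
      have pC: "p \<in> C" "\<delta> x p = g s" using p False panel_iff[OF s x] by auto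
      have "\<delta> p c = g s + \<delta> x c" by (rule delta_up[OF x pC(1) cC s pC(2) up])
      then show ?thesis using pr_eqI[OF K r pC(1) c] r' by simp
    qed
    then show False using sep unfolding separates_def by blast
  qed
  then show ?thesis using rmin_gen_add[OF K delta_par[OF x cC] min s up] by simp
qed

text \<open>Start from the chamber \<open>p\<close> of the panel nearest to the residue, so that
  \<open>s\<close> lengthens the distance to its gate \<open>c\<close>. The type \<open>t\<close>
  given by \<open>separates_conj\<close> is that of the image, the \<open>t\<close>-panel of
  \<open>c\<close>.\<close>

lemma separates_panel:
  assumes s: "s \<in> S" and K: "K \<subseteq> S" and r: "r \<in> C" and x: "x \<in> C"
    and sep: "separates (res K r) (res {s} x)"
  obtains c t where "t \<in> K" "c \<in> res K r" "pr (res K r) ` res {s} x = res {t} c" "pll (res {s} x) (res {t} c)"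
proof -
  have sS: "{s} \<subseteq> S" using s by simp
  let ?P = "res {s} x" and ?T = "res K r"
  obtain p where p: "p \<in> ?P" "\<And>p'. p' \<in> ?P \<Longrightarrow> len (\<delta> p (pr ?T p)) \<le> len (\<delta> p' (pr ?T p'))"
    using ex_has_least_nat[of "\<lambda>p. p \<in> ?P" x "\<lambda>p. len (\<delta> p (pr ?T p))"] res_self[OF x] by blast
  have pC: "p \<in> C" using p res_C by auto
  have P: "?P = res {s} p" using res_eq[OF sS x p(1)] by simp
  define c where "c = pr ?T p"
  have c: "c \<in> ?T" "rmin K (\<delta> p c)" using pr_gate[OF K r pC] by (auto simp: c_def)
  have cC: "c \<in> C" using c res_C by auto
  have pc: "\<delta> p c \<in> par S" by (rule delta_par[OF pC cC])
  have "len (\<delta> p c) \<le> len (g s + \<delta> p c)"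
  proof -
    have "\<delta> p c = g s + (g s + \<delta> p c)" using gen_gen(1)[OF s] by simp
    from delta_split[OF pC cC par_gen[OF s] par_add[OF par_gen[OF s] pc] this]
    obtain p' where p': "p' \<in> C" "\<delta> p p' = g s" "\<delta> p' c = g s + \<delta> p c" by auto
    have "p' \<in> ?P" using p' panel_iff[OF s pC] P by simp
    then show ?thesis using p(2) pr_min[OF K r p'(1) c(1)] p'(3) unfolding c_def by fastforce
  qed
  then have up: "len (\<delta> p c) < len (g s + \<delta> p c)" using len_gen_neq(2)[OF pc s] by simp
  have "separates ?T (res {s} p)" using sep P by simp
  from separates_conj[OF s K r pC c up this] obtain t where t: "t \<in> K" "g s + \<delta> p c = \<delta> p c + g t" by auto
  have tS: "t \<in> S" "{t} \<subseteq> S" "{t} \<subseteq> K" using t K by auto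
  have pll: "pll ?P (res {t} c)" unfolding P by (rule panel_pll[OF s tS(1) pC cC t(2)])
  have "pr ?T p' = pr (res {t} c) p'" if p': "p' \<in> ?P" for p'
  proof (cases "p' = p")
    case True
    have "rmin {t} (\<delta> p c)" using c(2) t by (simp add: rmin_def)
    from pr_eqI[OF tS(2) cC pC res_self[OF cC] this] show ?thesis using True c_def by simp
  next
    case False
    have p'C: "p' \<in> C" "\<delta> p p' = g s" using p' False panel_iff[OF s pC] P by auto
    have e: "\<delta> p' c = \<delta> p c + g t" using delta_up[OF pC p'C(1) cC s p'C(2) up] t(2) by simp
    \<comment> \<open>The chamber \<open>d\<close> of the \<open>t\<close>-panel of \<open>c\<close>
      has the same distance from \<open>p'\<close> as \<open>c\<close> has from \<open>p\<close>;
      hence it is the gate of \<open>p'\<close> both in the panel and in the residue.\<close>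
    from delta_split[OF p'C(1) cC pc par_gen[OF tS(1)] e]
    obtain d where d: "d \<in> C" "\<delta> p' d = \<delta> p c" "\<delta> d c = g t" by auto
    have "d \<in> res {t} c" using d delta_gen_commute[OF d(1) cC tS(1) d(3)] panel_iff[OF tS(1) cC] by simp
    moreover have "d \<in> ?T" using res_eq[OF K r c(1)] par_mono[OF tS(3)] calculation by (auto simp: res_def)
    moreover have "rmin {t} (\<delta> p' d)" "rmin K (\<delta> p' d)" using c(2) t d(2) by (auto simp: rmin_def)
    ultimately show ?thesis using pr_eqI[OF tS(2) cC p'C(1)] pr_eqI[OF K r p'C(1)] by simp
  qed
  then have "pr ?T ` ?P = res {t} c" using pll by (simp add: pll_def)
  then show ?thesis using that[OF t(1) c(1)] pll by blast
qed

lemma panel_pllI: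
  assumes s: "s \<in> S" and t: "t \<in> S" and C: "x \<in> C" "q \<in> C" and "pr (res {t} q) ` res {s} x = res {t} q"
  shows "pll (res {s} x) (res {t} q)"
proof -
  have tS: "{t} \<subseteq> S" using t by simp
  have sep: "separates (res {t} q) (res {s} x)" by (rule separates_onto_panel[OF t C(2) assms(5)])
  obtain c t' where *: "t' \<in> {t}" "c \<in> res {t} q" "pr (res {t} q) ` res {s} x = res {t'} c"
    "pll (res {s} x) (res {t'} c)"
    by (rule separates_panel[OF s tS C(2,1) sep])
  show ?thesis using *(1,4) res_eq[OF tS C(2) *(2)] by simp
qed

section \<open>Parallel residues of arbitrary rank: Weyl distances conjugating one set of generators
  to another\<close>

definition conj_gens :: "'s set \<Rightarrow> 's set \<Rightarrow> 'w \<Rightarrow> bool" where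
  "conj_gens I K w \<longleftrightarrow> (\<forall>s\<in>I. \<exists>t\<in>K. g s + w = w + g t) \<and> (\<forall>t\<in>K. \<exists>s\<in>I. g s + w = w + g t)"

lemma conj_gens_uminus:
  assumes "I \<subseteq> S" "K \<subseteq> S" "conj_gens I K w"
  shows "conj_gens K I (- w)"
proof -
  have *: "g t + - w = - w + g s" if "s \<in> I" "t \<in> K" "g s + w = w + g t" for s t
  proof -
    have "s \<in> S" "t \<in> S" using that assms by auto
    from uminus_conj[OF that(3), unfolded gen_uminus[OF this(1)] gen_uminus[OF this(2)]] show ?thesis .
  qed
  show ?thesis using assms(3) * unfolding conj_gens_def by metis
qed

lemma conj_gens_par:
  assumes "conj_gens I K w" "v \<in> par K"
  shows "\<exists>v'\<in>par I. v' + w = w + v"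
proof -
  obtain u where "u \<in> lists K" "ev u = v" using assms(2) by (auto simp: par_def)
  moreover have "\<exists>v'\<in>par I. v' + w = w + ev u" if "u \<in> lists K" for u
    using that
  proof (induction u rule: lists.induct)
    case Nil
    show ?case by (intro bexI[of _ 0] par_0) simp
  next
    case (Cons t u)
    then obtain v' where v': "v' \<in> par I" "v' + w = w + ev u" by blast
    obtain s where s: "s \<in> I" "g s + w = w + g t" using assms(1) Cons by (auto simp: conj_gens_def)
    have "g s + v' + w = g s + w + ev u" using v'(2) by (simp add: add.assoc)
    also have "\<dots> = w + ev (t # u)" by (simp add: s(2) add.assoc)
    finally show ?case using par_add[OF par_gen[OF s(1)] v'(1)] by blast
  qed
  ultimately show ?thesis by blast
qed

lemma conj_gens_pr_onto:
  assumes I: "I \<subseteq> S" and K: "K \<subseteq> S" and C: "x \<in> C" "c \<in> C"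
    and conj: "conj_gens I K (\<delta> x c)" and min: "rmin K (\<delta> x c)"
  shows "pr (res K c) ` res I x = res K c"
proof (intro equalityI subsetI)
  fix z assume "z \<in> pr (res K c) ` res I x"
  then show "z \<in> res K c" using pr_gate(1)[OF K C(2)] res_C by auto
next
  fix z assume z: "z \<in> res K c"
  then have zC: "z \<in> C" and cz: "\<delta> c z \<in> par K" by (auto simp: res_def)
  have "\<delta> x z = \<delta> x c + \<delta> c z" by (rule delta_gate[OF K C zC min cz])
  moreover obtain v where v: "v \<in> par I" "v + \<delta> x c = \<delta> x c + \<delta> c z"
    using conj_gens_par[OF conj cz] by blast
  ultimately have "\<delta> x z = v + \<delta> x c" by simp
  from delta_split[OF C(1) zC par_subset[OF I v(1)] delta_par[OF C] this]
  obtain y where y: "y \<in> C" "\<delta> x y = v" "\<delta> y z = \<delta> x c" by auto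
  have "pr (res K c) y = z" using pr_eqI[OF K C(2) y(1) z] min y(3) by simp
  moreover have "y \<in> res I x" using y v by (simp add: res_def)
  ultimately show "z \<in> pr (res K c) ` res I x" by blast
qed

lemma nearest_pair:
  assumes I: "I \<subseteq> S" and K: "K \<subseteq> S" and C: "r \<in> C" "q \<in> C"
  obtains x c where "x \<in> C" "c \<in> C" "res I r = res I x" "res K q = res K c" "rmin K (\<delta> x c)" "rmin I (\<delta> c x)"
proof -
  let ?A = "res I r \<times> res K q"
  have "(r, q) \<in> ?A" using res_self C by simp
  from ex_has_least_nat[of "\<lambda>z. z \<in> ?A", OF this, of "\<lambda>(x, c). len (\<delta> x c)"]
  obtain x c where x: "x \<in> res I r" and c: "c \<in> res K q"
    and min: "\<And>y d. y \<in> res I r \<Longrightarrow> d \<in> res K q \<Longrightarrow> len (\<delta> x c) \<le> len (\<delta> y d)"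
    by (auto simp del: split_paired_Ex)
  have xc: "x \<in> C" "c \<in> C" using x c res_C by auto
  have "rmin K (\<delta> x c)"
    by (rule rmin_minimal[OF K C(2) xc(1) c min[OF x]])
  moreover have "rmin I (\<delta> c x)"
  proof (rule rmin_minimal[OF I C(1) xc(2) x])
    fix d assume d: "d \<in> res I r"
    have "len (\<delta> x c) \<le> len (\<delta> d c)" by (rule min[OF d c])
    then show "len (\<delta> c x) \<le> len (\<delta> c d)"
      using len_delta_commute[OF xc] len_delta_commute[OF res_C[OF d] xc(2)] by simp
  qed
  ultimately show ?thesis using that xc res_eq[OF I C(1) x] res_eq[OF K C(2) c] by blast
qed

lemma rmin_left:
  assumes "I \<subseteq> S" "w \<in> par S" "rmin I (- w)" "s \<in> I"
  shows "len w < len (g s + w)"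
proof -
  have s: "s \<in> S" using assms by auto
  have "- w + g s = - (g s + w)" using gen_uminus[OF s] by (simp add: minus_add)
  then show ?thesis using assms(3,4) len_uminus[OF assms(2)] len_uminus[OF par_add[OF par_gen[OF s] assms(2)]]
    by (auto simp: rmin_def)
qed

lemma rmin_delta_left:
  assumes "I \<subseteq> S" "x \<in> C" "c \<in> C" "rmin I (\<delta> c x)" "s \<in> I"
  shows "len (\<delta> x c) < len (g s + \<delta> x c)"
  using rmin_left[OF assms(1) delta_par[OF assms(2,3)] _ assms(5)] assms(4) delta_commute[OF assms(2,3)] by simp

text \<open>It suffices to look at a nearest pair of chambers: separation in the two directions
  gives the two halves of \<open>conj_gens\<close>, and then both projections are onto.\<close>

lemma pllI_separates:
  assumes I: "I \<subseteq> S" and K: "K \<subseteq> S" and C: "r \<in> C" "q \<in> C"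
    and 1: "\<And>s x. s \<in> I \<Longrightarrow> x \<in> res I r \<Longrightarrow> separates (res K q) (res {s} x)"
    and 2: "\<And>s x. s \<in> K \<Longrightarrow> x \<in> res K q \<Longrightarrow> separates (res I r) (res {s} x)"
  shows "pll (res I r) (res K q)"
proof -
  obtain x c where xc: "x \<in> C" "c \<in> C" "res I r = res I x" "res K q = res K c" "rmin K (\<delta> x c)" "rmin I (\<delta> c x)"
    by (rule nearest_pair[OF I K C])
  have xI: "x \<in> res I r" and cK: "c \<in> res K q" using xc res_self by auto
  have "\<exists>t\<in>K. g s + \<delta> x c = \<delta> x c + g t" if s: "s \<in> I" for s
    by (rule separates_conj[OF _ K C(2) xc(1) cK xc(5) rmin_delta_left[OF I xc(1,2,6) s] 1[OF s xI]])
      (use s I in blast)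
  moreover have "\<exists>s\<in>I. g s + \<delta> x c = \<delta> x c + g t" if t: "t \<in> K" for t
  proof -
    have tS: "t \<in> S" using t K by blast
    from separates_conj[OF tS I C(1) xc(2) xI xc(6) rmin_delta_left[OF K xc(2,1,5) t] 2[OF t cK]]
    obtain s where s: "s \<in> I" "g t + \<delta> c x = \<delta> c x + g s" by auto
    then have "s \<in> S" using I by blast
    then have "g s + \<delta> x c = \<delta> x c + g t"
      using conj_delta_flip[OF tS _ xc(2,1) s(2)] by simp
    then show ?thesis using s by blast
  qed
  ultimately have conj: "conj_gens I K (\<delta> x c)" by (simp add: conj_gens_def)
  have "conj_gens K I (\<delta> c x)" using conj_gens_uminus[OF I K conj] delta_commute[OF xc(1,2)] by simp
  from conj_gens_pr_onto[OF K I xc(2,1) this xc(6)] conj_gens_pr_onto[OF I K xc(1,2) conj xc(5)]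
  show ?thesis unfolding xc(3,4) by (simp add: pll_def)
qed

text \<open>Were the projection constant on the \<open>s\<close>-panel of \<open>x\<close>, a
  neighbour \<open>x'\<close> of \<open>x\<close> would be farther than \<open>x\<close> from every
  chamber of the other residue. Then \<open>x'\<close> would be the projection of none of
  them.\<close>

lemma pll_separates_nearest:
  assumes I: "I \<subseteq> S" and K: "K \<subseteq> S" and C: "x \<in> C" "c \<in> C" and pll: "pll (res I x) (res K c)"
    and min: "rmin K (\<delta> x c)" "rmin I (\<delta> c x)" and s: "s \<in> I"
  shows "separates (res K c) (res {s} x)"
proof (rule ccontr)
  assume "\<not> ?thesis"
  then have const: "pr (res K c) p = pr (res K c) x" if "p \<in> res {s} x" for p
    using that res_self[OF C(1)] unfolding separates_def by blast
  have sS: "s \<in> S" using s I by auto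
  obtain x' where x': "x' \<in> res {s} x" "\<delta> x x' = g s" using panel_other[OF sS C(1)] by blast
  have x'C: "x' \<in> C" using x' res_C by auto
  have "x' \<in> res I x" using x' x'C par_gen[OF s] by (simp add: res_def)
  then have "x' \<in> pr (res I x) ` res K c" using pll by (simp add: pll_def)
  then obtain q where q: "q \<in> res K c" "pr (res I x) q = x'" by blast
  have qC: "q \<in> C" using q res_C by auto
  have "pr (res K c) x = c" by (rule pr_eqI[OF K C(2,1) res_self[OF C(2)] min(1)])
  then have "pr (res K c) x' = c" using const[OF x'(1)] by simp
  then have min': "rmin K (\<delta> x' c)" using pr_gate(2)[OF K C(2) x'C] by simp
  have "\<delta> x' c = g s + \<delta> x c"
    by (rule delta_up[OF C(1) x'C C(2) sS x'(2) rmin_delta_left[OF I C min(2) s]])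
  then have "len (\<delta> x c) < len (\<delta> x' c)" using rmin_delta_left[OF I C min(2) s] by simp
  then have "len (\<delta> x q) < len (\<delta> x' q)"
    using gate_dist(2)[OF K C(2,1) res_self[OF C(2)] min(1) q(1)]
      gate_dist(2)[OF K C(2) x'C res_self[OF C(2)] min' q(1)] by linarith
  moreover have "len (\<delta> q x') \<le> len (\<delta> q x)" using pr_min[OF I C(1) qC res_self[OF C(1)]] q(2) by simp
  ultimately show False using len_delta_commute[OF qC] C(1) x'C by simp
qed

lemma pll_conj_gens:
  assumes I: "I \<subseteq> S" and K: "K \<subseteq> S" and C: "r \<in> C" "q \<in> C" and pll: "pll (res I r) (res K q)"
  obtains x c where "x \<in> C" "c \<in> C" "res I r = res I x" "res K q = res K c" "rmin K (\<delta> x c)" "rmin I (\<delta> c x)"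
    "conj_gens I K (\<delta> x c)"
proof -
  obtain x c where xc: "x \<in> C" "c \<in> C" "res I r = res I x" "res K q = res K c" "rmin K (\<delta> x c)" "rmin I (\<delta> c x)"
    by (rule nearest_pair[OF I K C])
  have pll: "pll (res I x) (res K c)" using pll xc by simp
  have "\<exists>t\<in>K. g s + \<delta> x c = \<delta> x c + g t" if s: "s \<in> I" for s
    by (rule separates_conj[OF _ K xc(2,1) res_self[OF xc(2)] xc(5) rmin_delta_left[OF I xc(1,2,6) s]
          pll_separates_nearest[OF I K xc(1,2) pll xc(5,6) s]])
      (use s I in blast)
  moreover have "\<exists>s\<in>I. g s + \<delta> x c = \<delta> x c + g t" if t: "t \<in> K" for t
  proof -
    have tS: "t \<in> S" using t K by blast
    from separates_conj[OF tS I xc(1,2) res_self[OF xc(1)] xc(6) rmin_delta_left[OF K xc(2,1,5) t]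
        pll_separates_nearest[OF K I xc(2,1) pll_sym[OF pll] xc(6,5) t]]
    obtain s where s: "s \<in> I" "g t + \<delta> c x = \<delta> c x + g s" by auto
    then have "s \<in> S" using I by blast
    then have "g s + \<delta> x c = \<delta> x c + g t"
      using conj_delta_flip[OF tS _ xc(2,1) s(2)] by simp
    then show ?thesis using s by blast
  qed
  ultimately have "conj_gens I K (\<delta> x c)" by (simp add: conj_gens_def)
  then show ?thesis using that xc by blast
qed

text \<open>Conjugation by \<open>w\<close> provides, for an arbitrary chamber \<open>y\<close> of
  the first residue, a gate \<open>z\<close> at the same Weyl distance \<open>w\<close>. An
  \<open>s\<close>-neighbour of \<open>y\<close> is at distance \<open>w + g t\<close> from
  \<open>z\<close>, which is not minimal, so it has another gate.\<close>

lemma pll_separates: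
  assumes I: "I \<subseteq> S" and K: "K \<subseteq> S" and C: "r \<in> C" "q \<in> C" and pll: "pll (res I r) (res K q)"
    and s: "s \<in> I" and y: "y \<in> res I r"
  shows "separates (res K q) (res {s} y)"
proof -
  obtain x c where xc: "x \<in> C" "c \<in> C" "res I r = res I x" "res K q = res K c" "rmin K (\<delta> x c)" "rmin I (\<delta> c x)"
    "conj_gens I K (\<delta> x c)"
    by (rule pll_conj_gens[OF I K C pll])
  define w where "w = \<delta> x c"
  have sS: "s \<in> S" using s I by auto
  have up: "len w < len (g s + w)" unfolding w_def by (rule rmin_delta_left[OF I xc(1,2,6) s])
  have yC: "y \<in> C" and xy: "\<delta> x y \<in> par I" using y xc by (auto simp: res_def)
  have cy: "\<delta> c y = \<delta> c x + \<delta> x y" by (rule delta_gate[OF I xc(2,1) yC xc(6) xy])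
  obtain v where v: "v \<in> par K" "v + \<delta> c x = \<delta> c x + \<delta> x y"
    using conj_gens_par[OF conj_gens_uminus[OF I K xc(7)] xy] delta_commute[OF xc(1,2)] by auto
  have "\<delta> y c = - (v + \<delta> c x)" using delta_commute[OF xc(2) yC] cy v by simp
  then have yc: "\<delta> y c = w + - v" using delta_commute[OF xc(1,2)] unfolding w_def by (simp only: minus_add minus_minus)
  have wS: "w \<in> par S" unfolding w_def by (rule delta_par[OF xc(1,2)])
  have nv: "- v \<in> par K" by (rule par_uminus[OF K v(1)])
  from delta_split[OF yC xc(2) wS par_subset[OF K nv] yc]
  obtain z where z: "z \<in> C" "\<delta> y z = w" "\<delta> z c = - v" by auto
  have "\<delta> c z = v" using delta_commute[OF z(1) xc(2)] z(3) by simp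
  then have zK: "z \<in> res K c" using z v by (simp add: res_def)
  have pry: "pr (res K c) y = z" by (rule pr_eqI[OF K xc(2) yC zK]) (use xc(5) z(2) w_def in simp)
  obtain y' where y': "y' \<in> res {s} y" "\<delta> y y' = g s" using panel_other[OF sS yC] by blast
  have y'C: "y' \<in> C" using y' res_C by auto
  obtain t where t: "t \<in> K" "g s + w = w + g t" using xc(7) s unfolding w_def conj_gens_def by blast
  have tS: "t \<in> S" using t K by auto
  have e: "\<delta> y' z = w + g t" using delta_up[OF yC y'C z(1) sS y'(2)] up t z by simp
  have "pr (res K c) y' \<noteq> z"
  proof
    assume "pr (res K c) y' = z"
    then have "rmin K (w + g t)" using pr_gate(2)[OF K xc(2) y'C] e by simp
    then have "len (w + g t) < len (w + g t + g t)" using t by (simp add: rmin_def)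
    then show False using up t(2) by (simp add: gen_gen(2)[OF tS])
  qed
  then show ?thesis unfolding separates_def xc(4) using pry y' res_self[OF yC] by blast
qed

end

section \<open>Transitivity of parallelism\<close>

context weyl_building
begin

text \<open>The rank 2 condition in terms of Weyl distance: for a finite \<open>par {s, r}\<close>
  with \<open>s \<noteq> r\<close>, right-angled means that the two generators commute.\<close>

definition thin_or_commuting :: bool where
  "thin_or_commuting \<longleftrightarrow> (\<forall>s\<in>S. \<forall>r\<in>S. \<forall>x\<in>C. s \<noteq> r \<longrightarrow> finite (par {s, r}) \<longrightarrow>
    g s + g r = g r + g s \<or> (\<forall>a\<in>{s, r}. \<forall>y\<in>res {s, r} x. card (res {a} y) = 2))"

lemma res_mono: "I \<subseteq> J \<Longrightarrow> res I x \<subseteq> res J x"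
  using par_mono by (auto simp: res_def)

text \<open>Two chambers at the same distance from \<open>x\<close> have, by induction, the same
  predecessor; besides it their common panel contains only one chamber.\<close>

lemma thin_delta_inj:
  assumes J: "J \<subseteq> S" and r: "r \<in> C" and thin: "\<And>a y. a \<in> J \<Longrightarrow> y \<in> res J r \<Longrightarrow> card (res {a} y) = 2"
    and C: "x \<in> res J r" "y \<in> res J r" "z \<in> res J r" and eq: "\<delta> x y = \<delta> x z"
  shows "y = z"
  using C(2,3) eq
proof (induction "len (\<delta> x y)" arbitrary: y z)
  case 0
  have xC: "x \<in> C" "y \<in> C" "z \<in> C" using C(1) 0 res_C by blast+
  have "\<delta> x y = 0" using 0(1) len_eq_0[OF delta_par[OF xC(1,2)]] by simp
  then show ?case using 0(4) delta_eq_0[OF xC(1,2)] delta_eq_0[OF xC(1,3)] by simp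
next
  case (Suc n)
  have xC: "x \<in> C" "y \<in> C" "z \<in> C" using C(1) Suc.prems res_C by blast+
  have "\<delta> x y \<noteq> 0" using Suc.hyps(2) by auto
  from par_lastE[OF J res_delta[OF J r C(1) Suc.prems(1)] this] obtain a v where
    a: "a \<in> J" "v \<in> par J" "\<delta> x y = v + g a" "len (\<delta> x y) = Suc (len v)" .
  have aS: "a \<in> S" "v \<in> par S" using a J par_subset by auto
  from delta_split[OF xC(1,2) aS(2) par_gen[OF aS(1)] a(3)]
  obtain y' where y': "y' \<in> C" "\<delta> x y' = v" "\<delta> y' y = g a" by auto
  have "\<delta> x z = v + g a" using a(3) Suc.prems(3) by simp
  from delta_split[OF xC(1,3) aS(2) par_gen[OF aS(1)] this]
  obtain z' where z': "z' \<in> C" "\<delta> x z' = v" "\<delta> z' z = g a" by auto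
  have R: "y' \<in> res J r" "z' \<in> res J r"
    unfolding res_eq[OF J r C(1), symmetric] using y' z' a(2) by (simp_all add: res_def)
  have "y' = z'" using Suc.hyps(1)[of y' z'] Suc.hyps(2) a(4) y'(2) z'(2) R by simp
  then have P: "y \<in> res {a} y'" "z \<in> res {a} y'" "y' \<in> res {a} y'"
    using y' z' xC panel_iff[OF aS(1) y'(1)] by auto
  have ne: "y \<noteq> y'" "z \<noteq> y'"
    using y'(3) z'(3) \<open>y' = z'\<close> gen_neq_0[OF aS(1)] delta_eq_0[OF y'(1) y'(1)] by auto
  show "y = z"
  proof (rule ccontr)
    assume "y \<noteq> z"
    then have "card {y', y, z} = 3" using ne by auto
    moreover have "card {y', y, z} \<le> card (res {a} y')"
      using P thin[OF a(1) R(1)] by (intro card_mono card_ge_0_finite) auto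
    ultimately show False using thin[OF a(1) R(1)] by simp
  qed
qed

lemma dihedral_conj_finite:
  assumes "s \<in> S" "r \<in> S" "t \<in> {s, r}" "w \<in> par {s, r}" "w \<noteq> 0" "len w < len (g s + w)" "g s + w = w + g t"
  shows "finite (par {s, r})"
  using dihedral_finite[OF assms(1,2) _ dihedral_conj(2)[OF assms]] by simp

text \<open>In the non-commuting case the \<open>s\<close>-panel of \<open>x\<close> has a unique opposite panel, because the
  residue is thin; in the commuting case any two panels of type \<open>s\<close> in the residue are parallel.\<close>

lemma rank2_parallel_trans:
  assumes H: thin_or_commuting
    and s: "s \<in> S" and r: "r \<in> S" and ne: "s \<noteq> r" and x: "x \<in> C"
    and y: "y \<in> res {s, r} x" and t: "t \<in> {s, r}" and z: "z \<in> res {s, r} x" and t': "t' \<in> {s, r}"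
    and T: "pll (res {s} x) (res {t} y)" and Q: "pll (res {s} x) (res {t'} z)"
    and TP: "res {t} y \<noteq> res {s} x"
  shows "pll (res {t} y) (res {t'} z)"
proof (cases "res {t'} z = res {s} x")
  case True
  then show ?thesis using T pll_sym by simp
next
  case QP: False
  have J: "{s, r} \<subseteq> S" and tS: "t \<in> S" "t' \<in> S" using s r t t' by auto
  have sub: "{s} \<subseteq> S" "{t} \<subseteq> S" "{t'} \<subseteq> S" using s tS by auto
  have yz: "y \<in> C" "z \<in> C" using y z res_C by auto
  have opp: "\<exists>x'\<in>res {s} x. \<exists>c\<in>res {a} b. \<delta> x' c \<in> par {s, r} \<and> \<delta> x' c \<noteq> 0 \<and>
      len (\<delta> x' c) < len (g s + \<delta> x' c) \<and> g s + \<delta> x' c = \<delta> x' c + g a \<and>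
      x' \<in> res {s, r} x \<and> c \<in> res {s, r} x"
    if b: "b \<in> res {s, r} x" and a: "a \<in> {s, r}" and p: "pll (res {s} x) (res {a} b)"
      and neq: "res {a} b \<noteq> res {s} x" for a b
  proof -
    have aS: "a \<in> S" "{a} \<subseteq> S" and bC: "b \<in> C" using a s r b res_C by auto
    obtain x' c where xc: "x' \<in> C" "c \<in> C" "res {s} x = res {s} x'" "res {a} b = res {a} c"
      "rmin {a} (\<delta> x' c)" "rmin {s} (\<delta> c x')" "conj_gens {s} {a} (\<delta> x' c)"
      by (rule pll_conj_gens[OF sub(1) aS(2) x bC p])
    have sub': "res {s} x \<subseteq> res {s, r} x" "res {a} b \<subseteq> res {s, r} b"
      using a by (auto intro!: res_mono)
    have x': "x' \<in> res {s} x" and c: "c \<in> res {a} b" using xc res_self by auto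
    have R: "x' \<in> res {s, r} x" "c \<in> res {s, r} x" using x' c sub' res_eq[OF J x b] by blast+
    have conj: "g s + \<delta> x' c = \<delta> x' c + g a" using xc(7) by (simp add: conj_gens_def)
    have "\<delta> x' c \<noteq> 0"
    proof
      assume 0: "\<delta> x' c = 0"
      then have "x' = c" "s = a"
        using delta_eq_0[OF xc(1,2)] conj inj_onD[OF gen_inj _ s aS(1)] by simp_all
      then show False using neq xc(3,4) by simp
    qed
    moreover have "\<delta> x' c \<in> par {s, r}" by (rule res_delta[OF J x R])
    moreover have "len (\<delta> x' c) < len (g s + \<delta> x' c)" by (rule rmin_delta_left[OF sub(1) xc(1,2,6)]) simp
    ultimately show ?thesis using x' c R conj by blast
  qed
  from opp[OF y t T TP] obtain x1 y1 where 1: "x1 \<in> res {s} x" "y1 \<in> res {t} y"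
    "\<delta> x1 y1 \<in> par {s, r}" "\<delta> x1 y1 \<noteq> 0" "len (\<delta> x1 y1) < len (g s + \<delta> x1 y1)"
    "g s + \<delta> x1 y1 = \<delta> x1 y1 + g t" "x1 \<in> res {s, r} x" "y1 \<in> res {s, r} x" by blast
  from opp[OF z t' Q QP] obtain x2 z2 where 2: "x2 \<in> res {s} x" "z2 \<in> res {t'} z"
    "\<delta> x2 z2 \<in> par {s, r}" "\<delta> x2 z2 \<noteq> 0" "len (\<delta> x2 z2) < len (g s + \<delta> x2 z2)"
    "g s + \<delta> x2 z2 = \<delta> x2 z2 + g t'" "x2 \<in> res {s, r} x" "z2 \<in> res {s, r} x" by blast
  have T1: "res {t} y = res {t} y1" by (rule res_eq[OF sub(2) yz(1) 1(2), symmetric])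
  have Q1: "res {t'} z = res {t'} z2" by (rule res_eq[OF sub(3) yz(2) 2(2), symmetric])
  \<comment> \<open>Both panels differ from the \<open>s\<close>-panel of \<open>x\<close>, so both
    distances are the unique nonzero solution found in \<open>dihedral_conj_unique\<close>.\<close>
  have w: "\<delta> x2 z2 = \<delta> x1 y1"
    by (rule dihedral_conj_unique[OF s r t' 2(3-6) t 1(3-6)])
  have "g t = g t'" using 1(6) 2(6) unfolding w by simp
  then have tt': "t' = t" using inj_onD[OF gen_inj _ tS] by simp
  have C: "x1 \<in> C" "y1 \<in> C" "x2 \<in> C" "z2 \<in> C" using 1 2 res_C by auto
  show ?thesis
  proof (cases "g s + g r = g r + g s")
    case com: True
    have "g s + \<delta> x1 y1 = \<delta> x1 y1 + g s" by (rule commuting_conj[OF s r com 1(3)])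
    then have "g t = g s" using 1(6) by simp
    then have "t = s" by (rule inj_onD[OF gen_inj _ tS(1) s])
    moreover have "g s + \<delta> y1 z2 = \<delta> y1 z2 + g s"
      by (rule commuting_conj[OF s r com res_delta[OF J x 1(8) 2(8)]])
    ultimately show ?thesis unfolding T1 Q1 unfolding tt' using panel_pll[OF s s C(2,4)] by simp
  next
    case False
    from H[unfolded thin_or_commuting_def, rule_format, OF s r x ne dihedral_conj_finite[OF s r t 1(3-6)]]
    have thin: "card (res {a} b) = 2" if "a \<in> {s, r}" "b \<in> res {s, r} x" for a b
      using False that by blast
    have "y1 \<in> res {t} z2"
    proof (cases "x1 = x2")
      case True
      then have "y1 = z2" using thin_delta_inj[OF J x thin 1(7,8) 2(8)] w by simp
      then show ?thesis using res_self C by simp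
    next
      case False
      have d: "\<delta> x2 x1 = g s" by (rule delta_panel[OF s x 2(1) 1(1)]) (use False in simp)
      \<comment> \<open>The nearest chambers \<open>x1\<close> and \<open>x2\<close> may differ.
        Moving from \<open>x2\<close> to \<open>x1\<close> corresponds to a \<open>t\<close>-step at
        the other end, so the \<open>t\<close>-panel of \<open>z2\<close> contains a chamber
        \<open>z3\<close> at distance \<open>\<delta> x1 y1\<close> from \<open>x1\<close>.\<close>
      have "\<delta> x1 z2 = g s + \<delta> x2 z2" by (rule delta_up[OF C(3,1,4) s d 2(5)])
      then have e: "\<delta> x1 z2 = \<delta> x1 y1 + g t" using 1(6) w by simp
      from delta_split[OF C(1,4) delta_par[OF C(1,2)] par_gen[OF tS(1)] e]
      obtain z3 where z3: "z3 \<in> C" "\<delta> x1 z3 = \<delta> x1 y1" "\<delta> z3 z2 = g t" by auto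
      have "z3 \<in> res {s, r} x" unfolding res_eq[OF J x 1(7), symmetric] using z3 1(3) by (simp add: res_def)
      from thin_delta_inj[OF J x thin 1(7,8) this] z3(2) have "y1 = z3" by simp
      then show ?thesis
        using z3 delta_gen_commute[OF z3(1) C(4) tS(1) z3(3)] panel_iff[OF tS(1) C(4)] by simp
    qed
    then have "res {t} y1 = res {t} z2" by (rule res_eq[OF sub(2) C(4)])
    then show ?thesis unfolding T1 Q1 unfolding tt' using pll_refl[OF sub(2) C(4)] by simp
  qed
qed

section \<open>Induction along the distance between parallel panels\<close>

lemma separates_comp:
  assumes J: "J \<subseteq> K" and K: "K \<subseteq> S" and r: "r \<in> C" and q: "q \<in> res K r" and P: "P \<subseteq> C"
    and sep: "separates (res J q) P"
  shows "separates (res K r) P"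
  using sep pr_comp[OF J K r q] P unfolding separates_def by (metis subsetD)

lemma pr_comp_image:
  assumes J: "J \<subseteq> K" and K: "K \<subseteq> S" and r: "r \<in> C" and q: "q \<in> res K r" and P: "P \<subseteq> C"
  shows "pr (res J q) ` pr (res K r) ` P = pr (res J q) ` P"
  unfolding image_image using pr_comp[OF J K r q] P by (intro image_cong) auto

lemma pll_separates_panel:
  assumes "s \<in> S" "t \<in> S" "x \<in> C" "q \<in> C" "pll (res {s} x) (res {t} q)"
  shows "separates (res {t} q) (res {s} x)"
  using separates_onto_panel[OF assms(2,4)] assms(5) by (simp add: pll_def)

lemma res_subset: "res J x \<subseteq> C"
  by (auto simp: res_def)

text \<open>The induction moves the middle panel, given by \<open>s\<close> and \<open>x\<close>,
  towards the fixed panel of \<open>q\<close>. The condition that \<open>s\<close> lengthens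
  \<open>\<delta> x q\<close> ensures that a letter \<open>r\<close> shortening it differs from
  \<open>s\<close>.\<close>

lemma panel_trans:
  assumes H: thin_or_commuting and s0: "s0 \<in> S" and x0: "x0 \<in> C"
    and "s \<in> S" "t \<in> S" "x \<in> C" "q \<in> C" "g s + \<delta> x q = \<delta> x q + g t"
    "len (\<delta> x q) < len (g s + \<delta> x q)" "pll (res {s0} x0) (res {s} x)"
  shows "pll (res {s0} x0) (res {t} q)"
  using assms(4-10)
proof (induction "len (\<delta> x q)" arbitrary: s x rule: less_induct)
  case less
  note s = less.prems(1) and t = less.prems(2) and x = less.prems(3) and q = less.prems(4)
    and conj = less.prems(5) and up = less.prems(6) and P0 = less.prems(7)
  define w where "w = \<delta> x q"
  have wS: "w \<in> par S" unfolding w_def by (rule delta_par[OF x q])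
  show ?case
  proof (cases "w = 0")
    case True
    then have "x = q" "g s = g t" using delta_eq_0[OF x q] conj w_def by auto
    then have "s = t" using inj_onD[OF gen_inj _ s t] by simp
    then show ?thesis using P0 \<open>x = q\<close> by simp
  next
    case False
    from par_firstE[OF subset_refl wS False] obtain r w1 where
      r: "r \<in> S" "w1 \<in> par S" "w = g r + w1" "len w = Suc (len w1)" .
    have rw: "len (g r + w) < len w" using r gen_gen(1)[OF r(1)] by simp
    have ne: "s \<noteq> r" using rw up w_def by auto
    have J: "{s, r} \<subseteq> S" and sub: "{s} \<subseteq> S" "{t} \<subseteq> S" "{s} \<subseteq> {s, r}" using s r t by auto
    have Q: "pll (res {s} x) (res {t} q)" by (rule panel_pll[OF s t x q conj])
    define R where "R = res {s, r} x"
    have sepQ: "separates R (res {t} q)" unfolding R_def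
      by (rule separates_comp[OF sub(3) J x res_self[OF x] res_subset])
        (rule pll_separates_panel[OF t s q x pll_sym[OF Q]])
    define y where "y = pr R q"
    have y: "y \<in> R" "rmin {s, r} (\<delta> q y)" using pr_gate[OF J x q] by (auto simp: y_def R_def)
    have yC: "y \<in> C" using y res_C R_def by auto
    \<comment> \<open>Since \<open>y\<close> is the gate of \<open>q\<close>, the distance
      \<open>w\<close> factors as \<open>- b + - a\<close> with adding lengths. The letter
      \<open>r\<close> shortens \<open>w\<close>, so \<open>y\<close> is not \<open>x\<close> and is
      nearer to \<open>q\<close>.\<close>
    define a b where "a = \<delta> q y" and "b = \<delta> y x"
    have aS: "a \<in> par S" and bS: "b \<in> par S" using delta_par q yC x by (auto simp: a_def b_def)
    have xR: "x \<in> R" using res_self[OF x] by (simp add: R_def)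
    have qx: "\<delta> q x = a + b" "len (\<delta> q x) = len a + len b"
      using gate_dist[OF J x q _ y(2), of x] y(1) xR by (auto simp: R_def a_def b_def)
    have wab: "w = - b + - a" using delta_commute[OF q x] qx(1) unfolding w_def by (simp only: minus_add)
    have lw: "len w = len a + len b" using qx(2) len_delta_commute[OF x q] by (simp add: w_def)
    have "\<delta> q x = - w" using delta_commute[OF x q] by (simp add: w_def)
    have b0: "b \<noteq> 0"
    proof
      assume "b = 0"
      then have "y = x" using delta_eq_0[OF yC x] by (simp add: b_def)
      then have "rmin {s, r} (- w)" using y(2) \<open>\<delta> q x = - w\<close> by simp
      from rmin_left[OF J wS this, of r] rw show False by simp
    qed
    have la: "len a < len w" using lw b0 len_eq_0[OF bS] by simp
    have "g t + \<delta> q x = \<delta> q x + g s" by (rule conj_delta_flip[OF s t x q conj])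
    \<comment> \<open>\<open>g t + a + b\<close> is the inverse of \<open>g s + w\<close> and so
      longer than \<open>w\<close>; the summand \<open>b\<close> accounts for at most
      \<open>len b\<close> of this.\<close>
    have upt: "len a < len (g t + a)"
    proof -
      have "g t + a + b = - (g s + w)"
        using \<open>g t + \<delta> q x = \<delta> q x + g s\<close> qx(1) \<open>\<delta> q x = - w\<close> gen_uminus[OF s]
        by (simp only: minus_add add.assoc)
      then have "len (g t + a + b) = len (g s + w)"
        using len_uminus[OF par_add[OF par_gen[OF s] wS]] by simp
      moreover have "len (g t + a + b) \<le> len (g t + a) + len b"
        by (rule len_add_le[OF par_add[OF par_gen[OF t] aS] bS])
      ultimately show ?thesis using up lw by (simp add: w_def)
    qed
    obtain t1 where t1: "t1 \<in> {s, r}" "g t + a = a + g t1"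
      using separates_conj[OF t J x q y(1)[unfolded R_def] y(2) upt[unfolded a_def] sepQ[unfolded R_def]]
      unfolding a_def by blast
    have t1S: "t1 \<in> S" "{t1} \<subseteq> S" "{t1} \<subseteq> {s, r}" using t1 J by auto
    have yq: "\<delta> y q = - a" using delta_commute[OF q yC] by (simp add: a_def)
    have xy: "\<delta> x y = - b" using delta_commute[OF yC x] by (simp add: b_def)
    have conj1: "g t1 + \<delta> y q = \<delta> y q + g t"
      by (rule conj_delta_flip[OF t t1S(1) q yC t1(2)[unfolded a_def]])
    have up1: "len (\<delta> y q) < len (g t1 + \<delta> y q)"
      by (rule rmin_delta_left[OF J yC q y(2) t1(1)])
    have "g s + - b + - a = - b + g t1 + - a"
      using conj conj1 unfolding w_def[symmetric] wab yq by (simp only: add.assoc)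
    then have conj2: "g s + \<delta> x y = \<delta> x y + g t1" unfolding xy by (simp only: add_right_cancel)
    have PT: "pll (res {s} x) (res {t1} y)" by (rule panel_pll[OF s t1S(1) x yC conj2])
    \<comment> \<open>\<open>rank2_parallel_trans\<close> needs two distinct panels here. If they
      coincided, \<open>w\<close> would begin with \<open>s\<close>, although \<open>s\<close>
      lengthens it.\<close>
    have TP: "res {t1} y \<noteq> res {s} x"
    proof
      assume "res {t1} y = res {s} x"
      then have "y \<in> res {s} x" using res_self[OF yC, of "{t1}"] by simp
      then have "\<delta> x y = g s" using panel_iff[OF s x] b0 delta_eq_0[OF x x] xy by auto
      then have "w = g s + - a" using wab xy by simp
      then have "g s + w = - a" by (simp only: gen_gen(1)[OF s])
      then show False using up la len_uminus[OF aS] by (simp add: w_def)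
    qed
    have "pll (res {s0} x0) (res {t1} y)"
    proof -
      let ?P0 = "res {s0} x0"
      have "separates R ?P0" unfolding R_def
        by (rule separates_comp[OF sub(3) J x res_self[OF x] res_subset])
          (rule pll_separates_panel[OF s0 s x0 x P0])
      then obtain z t' where z: "t' \<in> {s, r}" "z \<in> R" "pr R ` ?P0 = res {t'} z" "pll ?P0 (res {t'} z)"
        unfolding R_def by (rule separates_panel[OF s0 J x x0])
      have zC: "z \<in> C" and t'S: "t' \<in> S" using z J res_C R_def by auto
      \<comment> \<open>By composition of projections, the image of P0 in \<open>R\<close> projects
        onto the \<open>s\<close>-panel of \<open>x\<close> just as P0 does; hence it is parallel to
        that panel.\<close>
      have "pr (res {s} x) ` res {t'} z = pr (res {s} x) ` ?P0"
        using pr_comp_image[OF sub(3) J x res_self[OF x] res_subset, of "{s0}" x0] z(3) by (simp add: R_def)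
      then have "pr (res {s} x) ` res {t'} z = res {s} x" using P0 by (simp add: pll_def)
      then have "pll (res {s} x) (res {t'} z)" by (rule pll_sym[OF panel_pllI[OF t'S s zC x]])
      then have "pll (res {t1} y) (res {t'} z)"
        using rank2_parallel_trans[OF H s r(1) ne x _ t1(1) _ z(1) PT _ TP] y(1) z(2) by (simp add: R_def)
      then have "pr (res {t1} y) ` pr R ` ?P0 = res {t1} y" using z(3) by (simp add: pll_def)
      then have "pr (res {t1} y) ` ?P0 = res {t1} y"
        using pr_comp_image[OF t1S(3) J x y(1)[unfolded R_def] res_subset, of "{s0}" x0] by (simp add: R_def)
      then show ?thesis by (rule panel_pllI[OF s0 t1S(1) x0 yC])
    qed
    moreover have "len (\<delta> y q) < len (\<delta> x q)" using la yq len_uminus[OF aS] by (simp add: w_def)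
    ultimately show ?thesis using less.hyps[OF _ t1S(1) t yC q conj1 up1] by simp
  qed
qed

lemma panel_parallel_trans:
  assumes H: thin_or_commuting and S: "a \<in> S" "b \<in> S" "c \<in> S" and C: "x \<in> C" "y \<in> C" "z \<in> C"
    and 1: "pll (res {a} x) (res {b} y)" and 2: "pll (res {b} y) (res {c} z)"
  shows "pll (res {a} x) (res {c} z)"
proof -
  have sub: "{b} \<subseteq> S" "{c} \<subseteq> S" using S by auto
  obtain y' z' where yz: "y' \<in> C" "z' \<in> C" "res {b} y = res {b} y'" "res {c} z = res {c} z'"
    "rmin {c} (\<delta> y' z')" "rmin {b} (\<delta> z' y')" "conj_gens {b} {c} (\<delta> y' z')"
    by (rule pll_conj_gens[OF sub C(2,3) 2])
  have "g b + \<delta> y' z' = \<delta> y' z' + g c" using yz(7) by (simp add: conj_gens_def)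
  moreover have "len (\<delta> y' z') < len (g b + \<delta> y' z')"
    by (rule rmin_delta_left[OF sub(1) yz(1,2,6)]) simp
  ultimately show ?thesis
    using panel_trans[OF H S(1) C(1) S(2,3) yz(1,2)] 1 unfolding yz(3,4) by simp
qed

text \<open>A panel of the first residue is followed through both projections: it is parallel to a
  panel of the middle residue, and that one to a panel of the last, so transitivity for panels
  applies.\<close>

lemma parallel_trans_separates:
  assumes H: thin_or_commuting and sub: "I \<subseteq> S" "J \<subseteq> S" "K \<subseteq> S" and C: "r \<in> C" "q \<in> C" "p \<in> C"
    and 1: "pll (res I r) (res J q)" and 2: "pll (res J q) (res K p)"
    and s: "s \<in> I" and x: "x \<in> res I r"
  shows "separates (res K p) (res {s} x)"
proof -
  have sS: "s \<in> S" and xC: "x \<in> C" using s sub x res_C by auto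
  have sep1: "separates (res J q) (res {s} x)" by (rule pll_separates[OF sub(1,2) C(1,2) 1 s x])
  obtain y t where y: "t \<in> J" "y \<in> res J q" "pll (res {s} x) (res {t} y)"
    by (rule separates_panel[OF sS sub(2) C(2) xC sep1])
  have tS: "t \<in> S" and yC: "y \<in> C" using y sub res_C by auto
  have sep2: "separates (res K p) (res {t} y)" by (rule pll_separates[OF sub(2,3) C(2,3) 2 y(1,2)])
  obtain z u where z: "u \<in> K" "z \<in> res K p" "pll (res {t} y) (res {u} z)"
    by (rule separates_panel[OF tS sub(3) C(3) yC sep2])
  have uS: "u \<in> S" "{u} \<subseteq> K" and zC: "z \<in> C" using z sub res_C by auto
  have "pll (res {s} x) (res {u} z)" by (rule panel_parallel_trans[OF H sS tS uS(1) xC yC zC y(3) z(3)])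
  from pll_separates_panel[OF sS uS(1) xC zC this]
  show ?thesis by (rule separates_comp[OF uS(2) sub(3) C(3) z(2) res_subset])
qed

lemma parallel_trans:
  assumes H: thin_or_commuting and sub: "I \<subseteq> S" "J \<subseteq> S" "K \<subseteq> S" and C: "r \<in> C" "q \<in> C" "p \<in> C"
    and 1: "pll (res I r) (res J q)" and 2: "pll (res J q) (res K p)"
  shows "pll (res I r) (res K p)"
  using parallel_trans_separates[OF H sub C 1 2]
    parallel_trans_separates[OF H sub(3,2,1) C(3,2,1) pll_sym[OF 2] pll_sym[OF 1]]
  by (rule pllI_separates[OF sub(1,3) C(1,3)])

section \<open>Failure of transitivity in a residue that is neither thin nor right-angled\<close>

lemma panel_third:
  assumes s: "s \<in> S" and x: "x \<in> C" and card: "card (res {s} x) \<noteq> 2"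
  obtains y z where "y \<in> res {s} x" "z \<in> res {s} x" "y \<noteq> x" "z \<noteq> x" "y \<noteq> z"
proof -
  obtain y where y: "y \<in> res {s} x" "y \<noteq> x" using panel_other[OF s x] by blast
  \<comment> \<open>An infinite panel has \<open>card\<close> 0 and is covered by the hypothesis as
    well.\<close>
  have "res {s} x \<noteq> {x, y}" using card y(2) by auto
  then obtain z where "z \<in> res {s} x" "z \<noteq> x" "z \<noteq> y" using y res_self[OF x] by auto
  then show ?thesis using that y by blast
qed

text \<open>A chamber \<open>y\<close> opposite both \<open>x2\<close> and \<open>x3\<close> has a panel parallel to the \<open>r\<close>-panels of both.
  It is obtained from a third chamber \<open>x\<close> of the common \<open>s\<close>-panel.\<close>

lemma not_parallel_trans:
  assumes s: "s \<in> S" and r: "r \<in> S" and fin: "finite (par {s, r})" and nc: "g s + g r \<noteq> g r + g s"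
    and x: "x \<in> C" and card: "card (res {s} x) \<noteq> 2"
  obtains x2 x3 t y where "x2 \<in> C" "x3 \<in> C" "t \<in> S" "y \<in> C"
    "pll (res {r} x2) (res {t} y)" "pll (res {t} y) (res {r} x3)" "\<not> pll (res {r} x2) (res {r} x3)"
proof -
  obtain x2 x3 where x23: "x2 \<in> res {s} x" "x3 \<in> res {s} x" "x2 \<noteq> x" "x3 \<noteq> x" "x2 \<noteq> x3"
    by (rule panel_third[OF s x card])
  have C: "x2 \<in> C" "x3 \<in> C" using x23 res_C by auto
  have d: "\<delta> x x2 = g s" "\<delta> x x3 = g s" "\<delta> x2 x3 = g s"
    using delta_panel[OF s x] x23 res_self[OF x] by auto
  obtain w0 a t where w0: "w0 \<in> par {s, r}" "a \<in> par {s, r}" "t \<in> {s, r}" "w0 = g r + a" "g r + a = a + g t"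
    "len (g s + w0) < len w0"
    by (rule dihedral_longest[OF s r fin])
  have J: "{s, r} \<subseteq> S" and tS: "t \<in> S" using s r w0(3) by auto
  have w0S: "w0 \<in> par S" by (rule par_subset[OF J w0(1)])
  \<comment> \<open>From \<open>x\<close> the letter \<open>s\<close> lengthens this distance to
    \<open>w0\<close>, so every other chamber of the \<open>s\<close>-panel of \<open>x\<close> is
    at distance \<open>w0\<close> from \<open>y\<close>.\<close>
  obtain y where y: "y \<in> C" "\<delta> x y = g s + w0" using delta_extend[OF x par_add[OF par_gen[OF s] w0S]] by auto
  have up: "len (\<delta> x y) < len (g s + \<delta> x y)" using w0(6) y(2) gen_gen(1)[OF s] by simp
  have dy: "\<delta> x2 y = w0" "\<delta> x3 y = w0"
    using delta_up[OF x C(1) y(1) s d(1) up] delta_up[OF x C(2) y(1) s d(2) up] y(2) gen_gen(1)[OF s] by simp_all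
  have "g r + w0 = a" using w0(4) gen_gen(1)[OF r] by simp
  moreover have "w0 + g t = a" using w0(4,5) gen_gen(2)[OF tS] by simp
  ultimately have conj: "g r + w0 = w0 + g t" by simp
  have p2: "pll (res {r} x2) (res {t} y)" by (rule panel_pll[OF r tS C(1) y(1)]) (simp add: dy conj)
  have p3: "pll (res {r} x3) (res {t} y)" by (rule panel_pll[OF r tS C(2) y(1)]) (simp add: dy conj)
  have rS: "{r} \<subseteq> S" using r by simp
  have ne: "g s \<noteq> g r" using nc by auto
  have l: "len (g s) < len (g s + g r)" "len (g s) < len (g r + g s)"
  proof -
    have "g s + g r \<noteq> 0" "g r + g s \<noteq> 0"
      using ne gen_uminus[OF s] gen_uminus[OF r] by (auto simp: add_eq_0_iff2)
    then have "len (g s + g r) \<noteq> 0" "len (g r + g s) \<noteq> 0"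
      using len_eq_0 par_add par_gen s r by simp_all
    moreover have "len (g s + g r) \<noteq> 1" "len (g r + g s) \<noteq> 1"
      using len_gen_neq[OF par_gen[OF s] r] len_gen[OF s] by simp_all
    ultimately show "len (g s) < len (g s + g r)" "len (g s) < len (g r + g s)"
      using len_gen[OF s] by simp_all
  qed
  have m: "rmin {r} (g s)" using l by (simp add: rmin_def)
  have m': "rmin {r} (g r + g s)"
    using rmin_gen_add[OF rS par_gen[OF s] m r l(2)] nc by auto
  \<comment> \<open>The distances from the \<open>r\<close>-panel of \<open>x2\<close> to
    \<open>x3\<close> are \<open>g s\<close> and \<open>g r + g s\<close>. Both are
    \<open>{r}\<close>-minimal, the second by Deodhar's lemma since the generators do not commute;
    thus the whole panel projects to \<open>x3\<close>.\<close>
  have "pr (res {r} x3) p = x3" if p: "p \<in> res {r} x2" for p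
  proof (rule pr_eqI[OF rS C(2) res_C[OF p] res_self[OF C(2)]])
    show "rmin {r} (\<delta> p x3)"
    proof (cases "p = x2")
      case True
      then show ?thesis using m d(3) by simp
    next
      case False
      then have "\<delta> x2 p = g r" using p panel_iff[OF r C(1)] by simp
      from delta_up[OF C(1) res_C[OF p] C(2) r this] show ?thesis using l(2) d(3) m' by simp
    qed
  qed
  then have "\<not> separates (res {r} x3) (res {r} x2)" unfolding separates_def by simp
  then have "\<not> pll (res {r} x2) (res {r} x3)" using pll_separates_panel[OF r r C] by blast
  then show ?thesis using that[OF C tS y(1) p2 pll_sym[OF p3]] by blast
qed

end

section \<open>The Weyl distance of an apartment system\<close>

lemma coxeter_system_cgen:
  assumes "coxeter_matrix S m"
  shows "coxeter_system S (cgen S m)"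
  using cgen_involution[OF assms] coxeter_exchange[OF assms] cgen_inj[OF assms]
  by unfold_locales blast+

locale apartments =
  fixes S :: "'s set" and m :: "'s \<Rightarrow> 's \<Rightarrow> enat" and \<Delta> :: "('c, 's) chamber_system" and \<A> :: "'c set set"
  assumes matrix: "coxeter_matrix S m"
    and system: "is_chamber_system S \<Delta>"
    and apts: "apartment_system S m \<Delta> \<A>"
begin

abbreviation gen :: "'s \<Rightarrow> 's word set symm" where
  "gen \<equiv> cgen S m"

abbreviation C :: "'c set" where
  "C \<equiv> chambers \<Delta>"

sublocale coxeter_system S gen
  by (rule coxeter_system_cgen[OF matrix])

lemma par_eq: "I \<subseteq> S \<Longrightarrow> par I = reg (coxeter_group S m) ` parabolic S m I"
proof -
  assume I: "I \<subseteq> S"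
  have "reg (coxeter_group S m) (cls S m u) = ev u" if "u \<in> lists I" for u
    using reg_cls[of u S m] that I by (auto simp: ev_def)
  then show ?thesis unfolding parabolic_cls[OF matrix I] par_def image_image by (auto simp: image_iff)
qed

lemma spherical_iff: "I \<subseteq> S \<Longrightarrow> spherical S m I \<longleftrightarrow> finite (par I)"
proof -
  assume I: "I \<subseteq> S"
  have "parabolic S m I \<subseteq> carrier (coxeter_group S m)"
    unfolding parabolic_cls[OF matrix I] carrier_coxeter_group[OF matrix] using lists_mono[OF I] by blast
  then have "inj_on (reg (coxeter_group S m)) (parabolic S m I)"
    using group.reg_eq_iff[OF group_coxeter_group] by (intro inj_onI) blast
  then show ?thesis unfolding par_eq[OF I] spherical_def by (rule finite_image_iff[symmetric])
qed

section \<open>Charts: isomorphisms of the Coxeter chamber system onto apartments, read in the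
  regular representation\<close>

definition chart :: "'c set \<Rightarrow> ('s word set symm \<Rightarrow> 'c) \<Rightarrow> bool" where
  "chart A \<phi> \<longleftrightarrow> bij_betw \<phi> (par S) A \<and>
    (\<forall>s\<in>S. \<forall>v\<in>par S. \<forall>w\<in>par S. adj \<Delta> s (\<phi> v) (\<phi> w) \<longleftrightarrow> w = v \<or> w = v + gen s)"

lemma adj_coxeter_chambers:
  assumes s: "s \<in> S" and u: "u \<in> lists S" and v: "v \<in> lists S"
  shows "adj (coxeter_chambers S m) s (cls S m u) (cls S m v) \<longleftrightarrow> ev v = ev u \<or> ev v = ev u + gen s"
proof -
  have us: "u @ [s] \<in> lists S" "[s] \<in> lists S" "v @ [s] \<in> lists S" using u v s by auto
  have eq: "cls S m x = cls S m y \<longleftrightarrow> ev x = ev y" if "x \<in> lists S" "y \<in> lists S" for x y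
    using cls_eq_iff[OF that] by (simp add: ev_def)
  have mult: "cls S m x \<otimes>\<^bsub>coxeter_group S m\<^esub> coxeter_gen S m s = cls S m (x @ [s])" if "x \<in> lists S" for x
    unfolding coxeter_gen_cls by (rule cls_append[OF that us(2), symmetric])
  have "adj (coxeter_chambers S m) s (cls S m u) (cls S m v) \<longleftrightarrow>
      (\<exists>w\<in>cls S m ` lists S. {cls S m u, cls S m v} \<subseteq> {w, w \<otimes>\<^bsub>coxeter_group S m\<^esub> coxeter_gen S m s})"
    unfolding adj_def coxeter_chambers_def carrier_coxeter_group[OF matrix] chamber_system.simps
      Setcompr_eq_image by simp
  also have "\<dots> \<longleftrightarrow> (\<exists>x\<in>lists S. {cls S m u, cls S m v} \<subseteq> {cls S m x, cls S m (x @ [s])})"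
    by (simp add: mult cong: bex_cong)
  also have "\<dots> \<longleftrightarrow> (\<exists>x\<in>lists S. {ev u, ev v} \<subseteq> {ev x, ev x + gen s})"
  proof (rule bex_cong[OF refl])
    fix x assume x: "x \<in> lists S"
    then have xs: "x @ [s] \<in> lists S" using s by simp
    show "{cls S m u, cls S m v} \<subseteq> {cls S m x, cls S m (x @ [s])} \<longleftrightarrow> {ev u, ev v} \<subseteq> {ev x, ev x + gen s}"
      unfolding insert_subset insert_iff eq[OF u x] eq[OF v x] eq[OF u xs] eq[OF v xs] by simp
  qed
  also have "\<dots> \<longleftrightarrow> ev v = ev u \<or> ev v = ev u + gen s"
  proof
    assume "\<exists>x\<in>lists S. {ev u, ev v} \<subseteq> {ev x, ev x + gen s}"
    then obtain x where "ev u = ev x \<or> ev u = ev x + gen s" "ev v = ev x \<or> ev v = ev x + gen s" by auto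
    then show "ev v = ev u \<or> ev v = ev u + gen s" using gen_gen(2)[OF s] by auto
  next
    assume "ev v = ev u \<or> ev v = ev u + gen s"
    then show "\<exists>x\<in>lists S. {ev u, ev v} \<subseteq> {ev x, ev x + gen s}" using u by blast
  qed
  finally show ?thesis .
qed

lemma chart_exists:
  assumes "A \<in> \<A>"
  obtains \<phi> where "chart A \<phi>"
proof -
  let ?G = "coxeter_group S m"
  obtain f where f: "chamber_iso S (coxeter_chambers S m) (subsystem \<Delta> A) f"
    using apts assms unfolding apartment_system_def by blast
  have bij: "bij_betw f (carrier ?G) A"
    using f by (simp add: chamber_iso_def coxeter_chambers_def subsystem_def)
  have inj: "inj_on (reg ?G) (carrier ?G)"
    using group.reg_eq_iff[OF group_coxeter_group] by (intro inj_onI) blast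
  have reg: "reg ?G (cls S m u) = ev u" if "u \<in> lists S" for u
    using reg_cls[OF that] by (simp add: ev_def)
  have "reg ?G ` carrier ?G = par S"
    unfolding carrier_coxeter_group[OF matrix] image_image par_def using reg by (auto simp: image_iff)
  then have bij_reg: "bij_betw (reg ?G) (carrier ?G) (par S)" using inj by (simp add: bij_betw_def)
  define \<phi> where "\<phi> w = f (inv_into (carrier ?G) (reg ?G) w)" for w
  have "bij_betw \<phi> (par S) A"
    using bij_betw_trans[OF bij_betw_inv_into[OF bij_reg] bij] unfolding \<phi>_def comp_def .
  moreover have "adj \<Delta> s (\<phi> v) (\<phi> w) \<longleftrightarrow> w = v \<or> w = v + gen s"
    if s: "s \<in> S" and vw: "v \<in> par S" "w \<in> par S" for s v w
  proof -
    obtain x y where xy: "x \<in> lists S" "ev x = v" "y \<in> lists S" "ev y = w" using vw by (auto simp: par_def)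
    have \<phi>: "\<phi> v = f (cls S m x)" "\<phi> w = f (cls S m y)"
      unfolding \<phi>_def xy(2,4)[symmetric] reg[OF xy(1), symmetric] reg[OF xy(3), symmetric]
      by (simp_all add: inv_into_f_f[OF inj cls_closed] xy(1,3))
    have "cls S m x \<in> chambers (coxeter_chambers S m)" "cls S m y \<in> chambers (coxeter_chambers S m)"
      using xy by (simp_all add: coxeter_chambers_def cls_closed)
    then have "adj (coxeter_chambers S m) s (cls S m x) (cls S m y) \<longleftrightarrow>
        adj (subsystem \<Delta> A) s (f (cls S m x)) (f (cls S m y))"
      using f s unfolding chamber_iso_def by blast
    moreover have "f (cls S m x) \<in> A" "f (cls S m y) \<in> A"
      using bij_betwE[OF bij] cls_closed[OF xy(1)] cls_closed[OF xy(3)] by auto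
    ultimately show ?thesis unfolding \<phi> adj_coxeter_chambers[OF s xy(1,3)] adj_subsystem xy(2,4) by blast
  qed
  ultimately have "chart A \<phi>" unfolding chart_def by blast
  then show ?thesis by (rule that)
qed

lemma chart_in: "chart A \<phi> \<Longrightarrow> v \<in> par S \<Longrightarrow> \<phi> v \<in> A"
  unfolding chart_def using bij_betwE by blast

lemma chart_onto:
  assumes "chart A \<phi>" "x \<in> A"
  obtains v where "v \<in> par S" "\<phi> v = x"
  using assms unfolding chart_def bij_betw_def by blast

lemma chart_inj: "chart A \<phi> \<Longrightarrow> v \<in> par S \<Longrightarrow> w \<in> par S \<Longrightarrow> \<phi> v = \<phi> w \<longleftrightarrow> v = w"
  unfolding chart_def bij_betw_def inj_on_def by blast

lemma chart_adj:
  "chart A \<phi> \<Longrightarrow> s \<in> S \<Longrightarrow> v \<in> par S \<Longrightarrow> w \<in> par S \<Longrightarrow> adj \<Delta> s (\<phi> v) (\<phi> w) \<longleftrightarrow> w = v \<or> w = v + gen s"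
  unfolding chart_def by blast

text \<open>An apartment is rigid: each of its chambers has exactly one other
  \<open>s\<close>-neighbour in it, so two charts that agree at one chamber agree along every
  word.\<close>

lemma chart_unique:
  assumes \<phi>: "chart A \<phi>" and \<psi>: "chart A \<psi>" and v: "v \<in> par S" "v' \<in> par S" and eq: "\<phi> v = \<psi> v'" and w: "w \<in> par S"
  shows "\<phi> (v + w) = \<psi> (v' + w)"
proof -
  obtain u where u: "u \<in> lists S" "ev u = w" using w by (auto simp: par_def)
  have "\<phi> (v + ev u) = \<psi> (v' + ev u)" using u(1)
  proof (induction u rule: rev_induct)
    case Nil
    then show ?case using eq by simp
  next
    case (snoc s u)
    then have s: "s \<in> S" and uS: "u \<in> lists S" by auto
    define a where "a = v + ev u"
    define b where "b = v' + ev u"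
    have ab: "a \<in> par S" "b \<in> par S" "a + gen s \<in> par S"
      using v ev_par[OF uS] par_gen[OF s] unfolding a_def b_def by (auto intro!: par_add)
    have IH: "\<phi> a = \<psi> b" unfolding a_def b_def by (rule snoc.IH[OF uS])
    obtain c where c: "c \<in> par S" "\<psi> c = \<phi> (a + gen s)"
      by (rule chart_onto[OF \<psi> chart_in[OF \<phi> ab(3)]])
    have "adj \<Delta> s (\<phi> a) (\<phi> (a + gen s))" using chart_adj[OF \<phi> s ab(1,3)] by simp
    then have "adj \<Delta> s (\<psi> b) (\<psi> c)" unfolding IH c(2) .
    then have "c = b \<or> c = b + gen s" using chart_adj[OF \<psi> s ab(2) c(1)] by simp
    moreover have "c \<noteq> b"
    proof
      assume "c = b"
      then have "\<phi> (a + gen s) = \<phi> a" using c(2) IH by simp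
      then show False using chart_inj[OF \<phi> ab(3,1)] gen_neq_0[OF s] add_left_cancel[of a "gen s" 0] by simp
    qed
    ultimately show ?case using c(2) by (simp add: a_def b_def add.assoc)
  qed
  then show ?thesis using u(2) by simp
qed

lemma chart_translate:
  assumes \<phi>: "chart A \<phi>" and v: "v \<in> par S"
  shows "chart A (\<lambda>w. \<phi> (v + w))"
proof -
  have "bij_betw (\<lambda>w. v + w) (par S) (par S)"
    by (rule bij_betw_byWitness[of _ "\<lambda>w. - v + w"])
      (use v par_add par_uminus[of S] in \<open>auto simp: add.assoc[symmetric]\<close>)
  then have "bij_betw (\<phi> \<circ> (\<lambda>w. v + w)) (par S) A"
    using \<phi> unfolding chart_def by (blast intro: bij_betw_trans)
  moreover have "adj \<Delta> s (\<phi> (v + x)) (\<phi> (v + y)) \<longleftrightarrow> y = x \<or> y = x + gen s"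
    if "s \<in> S" "x \<in> par S" "y \<in> par S" for s x y
    using chart_adj[OF \<phi> that(1) par_add[OF v that(2)] par_add[OF v that(3)]] by (simp add: add.assoc)
  ultimately show ?thesis by (simp add: chart_def comp_def)
qed

lemma chart_at:
  assumes "A \<in> \<A>" "x \<in> A"
  obtains \<phi> where "chart A \<phi>" "\<phi> 0 = x"
proof -
  obtain \<psi> where \<psi>: "chart A \<psi>" by (rule chart_exists[OF assms(1)])
  obtain v where v: "v \<in> par S" "\<psi> v = x" by (rule chart_onto[OF \<psi> assms(2)])
  show ?thesis using that[OF chart_translate[OF \<psi> v(1)]] v(2) by simp
qed

lemma chart_iso:
  assumes \<phi>: "chart A \<phi>" and h: "chamber_iso S (subsystem \<Delta> A) (subsystem \<Delta> B) h"
  shows "chart B (\<lambda>w. h (\<phi> w))"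
proof -
  have bij: "bij_betw h A B" using h by (simp add: chamber_iso_def subsystem_def)
  have 1: "bij_betw (h \<circ> \<phi>) (par S) B"
    using \<phi> bij unfolding chart_def by (blast intro: bij_betw_trans)
  have "adj \<Delta> s (h (\<phi> v)) (h (\<phi> w)) \<longleftrightarrow> w = v \<or> w = v + gen s"
    if s: "s \<in> S" and vw: "v \<in> par S" "w \<in> par S" for s v w
  proof -
    have A: "\<phi> v \<in> A" "\<phi> w \<in> A" using chart_in[OF \<phi>] vw by auto
    then have B: "h (\<phi> v) \<in> B" "h (\<phi> w) \<in> B" using bij bij_betwE by blast+
    have "adj (subsystem \<Delta> A) s (\<phi> v) (\<phi> w) \<longleftrightarrow> adj (subsystem \<Delta> B) s (h (\<phi> v)) (h (\<phi> w))"
      using h s A unfolding chamber_iso_def by (simp add: subsystem_def)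
    then show ?thesis unfolding adj_subsystem using A B chart_adj[OF \<phi> s vw] by simp
  qed
  then show ?thesis using 1 by (simp add: chart_def comp_def)
qed

lemma apartment_iso:
  assumes "A \<in> \<A>" "B \<in> \<A>"
  obtains h where "chamber_iso S (subsystem \<Delta> A) (subsystem \<Delta> B) h" "fixes_intersection S \<Delta> A B h"
  using apts assms unfolding apartment_system_def by blast

lemma common_apartment:
  assumes "x \<in> C" "y \<in> C"
  obtains A where "A \<in> \<A>" "x \<in> A" "y \<in> A"
  using apts assms unfolding apartment_system_def by blast

lemma apartment_subset: "A \<in> \<A> \<Longrightarrow> A \<subseteq> C"
  using apts unfolding apartment_system_def by blast

section \<open>The Weyl distance and its axioms\<close>

definition wdist :: "'c \<Rightarrow> 'c \<Rightarrow> 's word set symm" where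
  "wdist x y = (THE w. w \<in> par S \<and> (\<exists>A\<in>\<A>. \<exists>\<phi>. chart A \<phi> \<and> \<phi> 0 = x \<and> \<phi> w = y))"

text \<open>For another chart joining the same chambers, the isomorphism of apartments fixes both of
  them. It carries the first chart to one that agrees with the second at 0, and rigidity identifies
  the two.\<close>

lemma wdist_chart_0:
  assumes A: "A \<in> \<A>" and \<phi>: "chart A \<phi>" and w: "w \<in> par S"
  shows "wdist (\<phi> 0) (\<phi> w) = w"
  unfolding wdist_def
proof (rule the_equality)
  show "w \<in> par S \<and> (\<exists>A\<in>\<A>. \<exists>\<phi>'. chart A \<phi>' \<and> \<phi>' 0 = \<phi> 0 \<and> \<phi>' w = \<phi> w)"
    using assms by blast
  fix w' assume w': "w' \<in> par S \<and> (\<exists>A\<in>\<A>. \<exists>\<phi>'. chart A \<phi>' \<and> \<phi>' 0 = \<phi> 0 \<and> \<phi>' w' = \<phi> w)"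
  then obtain B \<psi> where B: "B \<in> \<A>" "chart B \<psi>" "\<psi> 0 = \<phi> 0" "\<psi> w' = \<phi> w" by blast
  obtain h where h: "chamber_iso S (subsystem \<Delta> A) (subsystem \<Delta> B) h" "fixes_intersection S \<Delta> A B h"
    by (rule apartment_iso[OF A B(1)])
  have fixed: "h z = z" if "z \<in> A" "z \<in> B" for z
    using h(2) that unfolding fixes_intersection_def by blast
  have "\<phi> 0 \<in> A" "\<phi> w \<in> A" using chart_in[OF \<phi>] par_0 w by auto
  moreover have "\<phi> 0 \<in> B" "\<phi> w \<in> B" using chart_in[OF B(2) par_0] chart_in[OF B(2), of w'] w' B by auto
  ultimately have "h (\<phi> 0) = \<psi> 0" "h (\<phi> w) = \<psi> w'" using fixed B by auto
  moreover have "h (\<phi> (0 + w)) = \<psi> (0 + w)"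
    by (rule chart_unique[OF chart_iso[OF \<phi> h(1)] B(2) par_0 par_0 _ w]) (rule calculation(1))
  ultimately have "\<psi> w' = \<psi> w" by simp
  then show "w' = w" using chart_inj[OF B(2), of w' w] w w' by simp
qed

lemma wdist_chart:
  assumes "A \<in> \<A>" "chart A \<phi>" "v \<in> par S" "w \<in> par S"
  shows "wdist (\<phi> v) (\<phi> w) = - v + w"
proof -
  have "- v + w \<in> par S" using assms by (simp only: par_add par_uminus[OF subset_refl])
  from wdist_chart_0[OF assms(1) chart_translate[OF assms(2,3)] this] show ?thesis
    by (simp add: add.assoc[symmetric])
qed

lemma common_chart:
  assumes "x \<in> C" "y \<in> C"
  obtains A \<phi> where "A \<in> \<A>" "chart A \<phi>" "\<phi> 0 = x" "wdist x y \<in> par S" "\<phi> (wdist x y) = y"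
proof -
  obtain A where A: "A \<in> \<A>" "x \<in> A" "y \<in> A" by (rule common_apartment[OF assms])
  obtain \<phi> where \<phi>: "chart A \<phi>" "\<phi> 0 = x" by (rule chart_at[OF A(1,2)])
  obtain w where w: "w \<in> par S" "\<phi> w = y" by (rule chart_onto[OF \<phi>(1) A(3)])
  have "wdist x y = w" using wdist_chart_0[OF A(1) \<phi>(1) w(1)] \<phi>(2) w(2) by simp
  then show ?thesis using that A \<phi> w by blast
qed

lemma adj_equiv:
  assumes "s \<in> S"
  shows "x \<in> C \<Longrightarrow> adj \<Delta> s x x" "adj \<Delta> s x y \<Longrightarrow> adj \<Delta> s y z \<Longrightarrow> adj \<Delta> s x z"
proof -
  have p: "partition_on C (adj_classes \<Delta> s)" using system assms by (simp add: is_chamber_system_def)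
  show "adj \<Delta> s x x" if "x \<in> C"
    using partition_onD1[OF p] that by (auto simp: adj_def)
  show "adj \<Delta> s x z" if "adj \<Delta> s x y" "adj \<Delta> s y z"
  proof -
    obtain P Q where PQ: "P \<in> adj_classes \<Delta> s" "x \<in> P" "y \<in> P" "Q \<in> adj_classes \<Delta> s" "y \<in> Q" "z \<in> Q"
      using \<open>adj \<Delta> s x y\<close> \<open>adj \<Delta> s y z\<close> by (auto simp: adj_def)
    then have "P = Q" using partition_onD2[OF p] by (auto simp: disjoint_def)
    then show ?thesis using PQ by (auto simp: adj_def)
  qed
qed

lemma adj_iff:
  assumes "s \<in> S" "x \<in> C" "y \<in> C"
  shows "adj \<Delta> s x y \<longleftrightarrow> wdist x y = 0 \<or> wdist x y = gen s"
proof -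
  obtain A \<phi> where A: "A \<in> \<A>" "chart A \<phi>" "\<phi> 0 = x" "wdist x y \<in> par S" "\<phi> (wdist x y) = y"
    by (rule common_chart[OF assms(2,3)])
  show ?thesis using chart_adj[OF A(2) assms(1) par_0 A(4)] A(3,5) by simp
qed

lemma gallery_Cons:
  "is_gallery \<Delta> I x y (x # cs) \<longleftrightarrow> x \<in> C \<and>
    (cs = [] \<and> x = y \<or> (\<exists>z. is_gallery \<Delta> I z y cs \<and> (\<exists>s\<in>I. adj \<Delta> s x z)))"
  by (cases cs) (auto simp: is_gallery_def)

lemma gallery_singleton:
  assumes "s \<in> S" "is_gallery \<Delta> {s} x y cs"
  shows "adj \<Delta> s x y"
  using assms(2)
proof (induction cs arbitrary: x)
  case Nil
  then show ?case by (simp add: is_gallery_def)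
next
  case (Cons c cs)
  have "c = x" using Cons.prems by (simp add: is_gallery_def)
  with Cons.prems have *: "x \<in> C" "cs = [] \<and> x = y \<or> (\<exists>z. is_gallery \<Delta> {s} z y cs \<and> adj \<Delta> s x z)"
    by (simp_all add: gallery_Cons)
  from *(2) show ?case
  proof
    assume "cs = [] \<and> x = y"
    then show ?thesis using adj_equiv(1)[OF assms(1) *(1)] by simp
  next
    assume "\<exists>z. is_gallery \<Delta> {s} z y cs \<and> adj \<Delta> s x z"
    then obtain z where "is_gallery \<Delta> {s} z y cs" "adj \<Delta> s x z" by blast
    then show ?thesis using adj_equiv(2)[OF assms(1)] Cons.IH by blast
  qed
qed

text \<open>The other axioms are checked in a single apartment. Here \<open>A\<close> contains
  \<open>x\<close> and \<open>y\<close>, and \<open>B\<close> contains \<open>x'\<close> and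
  \<open>y\<close>. The isomorphism from \<open>A\<close> to \<open>B\<close> fixes \<open>y\<close>
  and maps the panel of \<open>x\<close> in \<open>A\<close> onto its trace in \<open>B\<close>; so
  \<open>x'\<close> is the image of some \<open>a\<close> in that panel, and
  \<open>wdist x' y\<close> can be computed from \<open>a\<close> within \<open>A\<close>.\<close>

lemma wdist_step:
  assumes x: "x \<in> C" and x': "x' \<in> C" and y: "y \<in> C" and s: "s \<in> S" and d: "wdist x x' = gen s"
  shows "wdist x' y = wdist x y \<or> wdist x' y = gen s + wdist x y"
proof -
  obtain A \<phi> where A: "A \<in> \<A>" "chart A \<phi>" "\<phi> 0 = x" "wdist x y \<in> par S" "\<phi> (wdist x y) = y"
    by (rule common_chart[OF x y])
  obtain B where B: "B \<in> \<A>" "x' \<in> B" "y \<in> B" by (rule common_apartment[OF x' y])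
  have inA: "x \<in> A" "y \<in> A" using chart_in[OF A(2) par_0] chart_in[OF A(2,4)] A(3,5) by auto
  obtain h where h: "chamber_iso S (subsystem \<Delta> A) (subsystem \<Delta> B) h" "fixes_intersection S \<Delta> A B h"
    by (rule apartment_iso[OF A(1) B(1)])
  define P where "P = {z. \<exists>cs. is_gallery \<Delta> {s} x z cs}"
  have "is_residue \<Delta> {s} P" unfolding is_residue_def P_def by (rule bexI[OF refl x])
  then have P: "P \<in> residues_of S \<Delta>" unfolding residues_of_def using s by (intro CollectI exI[of _ "{s}"]) simp
  have "is_gallery \<Delta> {s} x x [x]" using x by (simp add: is_gallery_def)
  then have xP: "x \<in> P" unfolding P_def by blast
  have "adj \<Delta> s x x'" using adj_iff[OF s x x'] d by simp
  then have "is_gallery \<Delta> {s} x x' [x, x']" using x x' by (simp add: is_gallery_def)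
  then have x'P: "x' \<in> P" unfolding P_def by blast
  have "P \<inter> A \<noteq> {} \<and> P \<inter> B \<noteq> {} \<longrightarrow> h ` (P \<inter> A) = P \<inter> B"
    using h(2) P by (simp add: fixes_intersection_def)
  then have "h ` (P \<inter> A) = P \<inter> B" using xP inA(1) x'P B(2) by auto
  then have "x' \<in> h ` (P \<inter> A)" using x'P B(2) by simp
  then obtain a where a: "a \<in> P" "a \<in> A" "h a = x'" by auto
  have "h y = y" using h(2) inA(2) B(3) by (simp add: fixes_intersection_def)
  obtain u where u: "u \<in> par S" "\<phi> u = a" by (rule chart_onto[OF A(2) a(2)])
  have "adj \<Delta> s x a" using a(1) gallery_singleton[OF s] unfolding P_def by blast
  then have "u = 0 \<or> u = gen s" using chart_adj[OF A(2) s par_0 u(1)] A(3) u(2) by simp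
  moreover have "wdist x' y = - u + wdist x y"
    using wdist_chart[OF B(1) chart_iso[OF A(2) h(1)] u(1) A(4)] u(2) a(3) A(5) \<open>h y = y\<close> by simp
  ultimately show ?thesis using gen_uminus[OF s] by auto
qed

sublocale weyl_building S gen C wdist
proof unfold_locales
  fix x y assume xy: "x \<in> C" "y \<in> C"
  obtain A \<phi> where A: "A \<in> \<A>" "chart A \<phi>" "\<phi> 0 = x" "wdist x y \<in> par S" "\<phi> (wdist x y) = y"
    by (rule common_chart[OF xy])
  show "wdist x y \<in> par S" by (rule A(4))
  show "wdist x y = 0 \<longleftrightarrow> x = y" using chart_inj[OF A(2) par_0 A(4)] A(3,5) by auto
  show "wdist y x = - wdist x y" using wdist_chart[OF A(1,2,4) par_0] A(3,5) by simp
  show "\<exists>z\<in>C. wdist x z = v \<and> wdist z y = w"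
    if "v \<in> par S" "w \<in> par S" "wdist x y = v + w" for v w
  proof (intro bexI conjI)
    show "wdist x (\<phi> v) = v" using wdist_chart_0[OF A(1,2) that(1)] A(3) by simp
    show "wdist (\<phi> v) y = w"
      using wdist_chart[OF A(1,2) that(1) A(4)] A(5) that(3) by (simp add: add.assoc[symmetric])
    show "\<phi> v \<in> C" using chart_in[OF A(2) that(1)] apartment_subset[OF A(1)] by blast
  qed
next
  fix x x' y s assume "x \<in> C" "x' \<in> C" "y \<in> C" "s \<in> S" "wdist x x' = gen s"
  then show "wdist x' y = wdist x y \<or> wdist x' y = gen s + wdist x y" by (rule wdist_step)
next
  fix x w assume x: "x \<in> C" and w: "w \<in> par S"
  obtain A \<phi> where A: "A \<in> \<A>" "chart A \<phi>" "\<phi> 0 = x" by (rule common_chart[OF x x])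
  show "\<exists>y\<in>C. wdist x y = w"
  proof (intro bexI)
    show "wdist x (\<phi> w) = w" using wdist_chart_0[OF A(1,2) w] A(3) by simp
    show "\<phi> w \<in> C" using chart_in[OF A(2) w] apartment_subset[OF A(1)] by blast
  qed
qed

section \<open>Galleries, residues and projections in terms of the Weyl distance\<close>

lemma gallery_wdist:
  assumes I: "I \<subseteq> S" and cs: "is_gallery \<Delta> I x y cs"
  shows "wdist x y \<in> par I \<and> len (wdist x y) < length cs \<and> x \<in> C \<and> y \<in> C"
  using cs
proof (induction cs arbitrary: x)
  case Nil
  then show ?case by (simp add: is_gallery_def)
next
  case (Cons c cs)
  have "c = x" using Cons.prems by (simp add: is_gallery_def)
  with Cons.prems have x: "x \<in> C" and *: "cs = [] \<and> x = y \<or> (\<exists>z. is_gallery \<Delta> I z y cs \<and> (\<exists>s\<in>I. adj \<Delta> s x z))"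
    by (simp_all add: gallery_Cons)
  from * show ?case
  proof
    assume "cs = [] \<and> x = y"
    then show ?thesis using delta_eq_0[OF x x] x par_0 by simp
  next
    assume "\<exists>z. is_gallery \<Delta> I z y cs \<and> (\<exists>s\<in>I. adj \<Delta> s x z)"
    then obtain z s where z: "is_gallery \<Delta> I z y cs" "s \<in> I" "adj \<Delta> s x z" by blast
    note IH = Cons.IH[OF z(1)]
    have zC: "z \<in> C" and yC: "y \<in> C" and s: "s \<in> S" using IH z(2) I by auto
    have "wdist x y = wdist z y \<or> wdist x y = gen s + wdist z y"
    proof (cases "x = z")
      case False
      then have "wdist x z = gen s" using z(3) adj_iff[OF s x zC] delta_eq_0[OF x zC] by simp
      from delta_step[OF zC x yC s delta_gen_commute[OF x zC s this]] show ?thesis .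
    qed simp
    moreover have "gen s + wdist z y \<in> par I" using IH by (simp add: par_add par_gen z(2))
    \<comment> \<open>Each further chamber adds at most one letter; the bound by
      \<open>length cs\<close> is strict because a gallery lists one chamber more than it has
      steps.\<close>
    moreover have "len (gen s + wdist z y) \<le> Suc (len (wdist z y))"
      using len_add_gen(2)[OF delta_par[OF zC yC] s] by linarith
    ultimately show ?thesis using IH x by fastforce
  qed
qed

lemma word_gallery:
  assumes I: "I \<subseteq> S" and u: "u \<in> lists I" and "x \<in> C" "y \<in> C" "wdist x y = ev u"
  shows "\<exists>cs. is_gallery \<Delta> I x y (x # cs) \<and> length cs = length u"
  using u assms(3-5)
proof (induction u arbitrary: x rule: lists.induct)
  case Nil
  then have "x = y" using delta_eq_0[of x y] by simp
  then show ?case using Nil by (simp add: gallery_Cons)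
next
  case (Cons s u)
  have s: "s \<in> S" and uS: "u \<in> lists S" using Cons.hyps I by auto
  have "wdist x y = gen s + ev u" using Cons.prems by simp
  from delta_split[OF Cons.prems(1,2) par_gen[OF s] ev_par[OF uS] this]
  obtain z where z: "z \<in> C" "wdist x z = gen s" "wdist z y = ev u" by auto
  obtain cs where cs: "is_gallery \<Delta> I z y (z # cs)" "length cs = length u"
    using Cons.IH[OF z(1) Cons.prems(2) z(3)] by auto
  have "adj \<Delta> s x z" using adj_iff[OF s Cons.prems(1) z(1)] z(2) by simp
  then have "is_gallery \<Delta> I x y (x # z # cs)"
    using cs(1) Cons.prems(1) Cons.hyps unfolding gallery_Cons[of I x y "z # cs"] by blast
  then show ?case using cs(2) by (intro exI[of _ "z # cs"]) simp
qed

lemma gallery_res: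
  assumes I: "I \<subseteq> S" and x: "x \<in> C"
  shows "{y. \<exists>cs. is_gallery \<Delta> I x y cs} = res I x"
proof (intro equalityI subsetI)
  fix y assume "y \<in> {y. \<exists>cs. is_gallery \<Delta> I x y cs}"
  then show "y \<in> res I x" using gallery_wdist[OF I] by (auto simp: res_def)
next
  fix y assume "y \<in> res I x"
  then have y: "y \<in> C" "wdist x y \<in> par I" by (auto simp: res_def)
  then obtain u where "u \<in> lists I" "ev u = wdist x y" by (auto simp: par_def)
  then show "y \<in> {y. \<exists>cs. is_gallery \<Delta> I x y cs}" using word_gallery[OF I _ x y(1), of u] by auto
qed

lemma is_residue_iff: "I \<subseteq> S \<Longrightarrow> is_residue \<Delta> I R \<longleftrightarrow> (\<exists>x\<in>C. R = res I x)"
  unfolding is_residue_def by (simp add: gallery_res)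

lemma residues_of_iff: "R \<in> residues_of S \<Delta> \<longleftrightarrow> (\<exists>I x. I \<subseteq> S \<and> x \<in> C \<and> R = res I x)"
proof -
  have "R \<in> residues_of S \<Delta> \<longleftrightarrow> (\<exists>I. I \<subseteq> S \<and> is_residue \<Delta> I R)"
    by (simp add: residues_of_def)
  also have "\<dots> \<longleftrightarrow> (\<exists>I. I \<subseteq> S \<and> (\<exists>x. x \<in> C \<and> R = res I x))"
    by (intro ex_cong1 conj_cong refl) (simp add: is_residue_iff Bex_def)
  finally show ?thesis by simp
qed

lemma chamber_dist_eq:
  assumes "x \<in> C" "y \<in> C"
  shows "chamber_dist S \<Delta> x y = len (wdist x y)"
  unfolding chamber_dist_def
proof (rule Least_equality)
  obtain u where u: "u \<in> lists S" "ev u = wdist x y" "length u = len (wdist x y)"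
    by (rule reduced_word[OF delta_par[OF assms]])
  obtain cs where "is_gallery \<Delta> S x y (x # cs)" "length cs = length u"
    using word_gallery[OF subset_refl u(1) assms] u(2) by auto
  then show "\<exists>cs. is_gallery \<Delta> S x y cs \<and> length cs = Suc (len (wdist x y))"
    using u(3) by (intro exI[of _ "x # cs"]) simp
next
  fix n assume "\<exists>cs. is_gallery \<Delta> S x y cs \<and> length cs = Suc n"
  then obtain cs where "is_gallery \<Delta> S x y cs" "length cs = Suc n" by blast
  then show "len (wdist x y) \<le> n" using gallery_wdist[OF subset_refl, of x y cs] by simp
qed

lemma proj_eq:
  assumes "R \<subseteq> C" "x \<in> C"
  shows "proj S \<Delta> R x = pr R x"
proof -
  have "(c \<in> R \<and> (\<forall>d\<in>R. chamber_dist S \<Delta> x c \<le> chamber_dist S \<Delta> x d)) \<longleftrightarrow>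
      (c \<in> R \<and> (\<forall>d\<in>R. len (wdist x c) \<le> len (wdist x d)))" for c
    using chamber_dist_eq[OF assms(2)] assms(1) by (intro conj_cong ball_cong refl) (auto simp: subset_iff)
  then show ?thesis by (simp add: proj_def pr_def)
qed

lemma parallel_iff:
  assumes "R \<subseteq> C" "Q \<subseteq> C"
  shows "parallel S \<Delta> R Q \<longleftrightarrow> pll R Q"
proof -
  have "proj S \<Delta> R ` Q = pr R ` Q" "proj S \<Delta> Q ` R = pr Q ` R"
    by (rule image_cong[OF refl proj_eq]; use assms in blast)+
  then show ?thesis by (simp add: parallel_def pll_def)
qed

lemma parallelism_iff:
  "(R, Q) \<in> parallelism S \<Delta> \<longleftrightarrow> R \<in> residues_of S \<Delta> \<and> Q \<in> residues_of S \<Delta> \<and> pll R Q"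
proof -
  have "R \<subseteq> C" if "R \<in> residues_of S \<Delta>" for R
    using that res_subset unfolding residues_of_iff by auto
  then show ?thesis using parallel_iff[of R Q] by (auto simp: parallelism_def)
qed

section \<open>The equivalence\<close>

lemma equiv_iff_trans: "equiv (residues_of S \<Delta>) (parallelism S \<Delta>) \<longleftrightarrow> trans (parallelism S \<Delta>)"
proof
  assume "trans (parallelism S \<Delta>)"
  moreover have "parallelism S \<Delta> \<subseteq> residues_of S \<Delta> \<times> residues_of S \<Delta>"
    by (auto simp: parallelism_def)
  moreover have "sym (parallelism S \<Delta>)"
    using pll_sym by (intro symI) (auto simp: parallelism_iff)
  moreover have "refl_on (residues_of S \<Delta>) (parallelism S \<Delta>)"
    using pll_refl by (intro refl_onI) (auto simp: parallelism_iff residues_of_iff)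
  ultimately show "equiv (residues_of S \<Delta>) (parallelism S \<Delta>)" by (intro equivI)
qed (auto simp: equiv_def)

lemma infinite_par:
  assumes s: "s \<in> S" and r: "r \<in> S" and inf: "m s r = \<infinity>"
  shows "infinite (par {s, r})"
proof
  assume fin: "finite (par {s, r})"
  define f where "f n = nmul n (gen s + gen r)" for n
  have f: "f (n + k) = f n + f k" for n k unfolding f_def by (rule nmul_add)
  have "f n \<in> par {s, r}" for n
    by (induction n) (auto simp: f_def intro!: par_0 par_add par_gen)
  then have "finite (range f)" using fin by (auto intro: finite_subset)
  then have "\<not> inj f" using finite_imageD by blast
  then obtain i j where "i < j" "f i = f j" unfolding inj_def by (metis linorder_neqE_nat)
  then have "f (j - i) = 0" using f[of i "j - i"] add_left_cancel[of "f i" "f (j - i)" 0] by simp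
  then have "j - i = 0" unfolding f_def by (rule cgen_infinite_order[OF matrix s r inf])
  then show False using \<open>i < j\<close> by simp
qed

lemma thin_or_commutingI:
  assumes H: "\<forall>I R. I \<subseteq> S \<and> card I = 2 \<and> is_residue \<Delta> I R \<and> spherical S m I \<longrightarrow>
    thin \<Delta> I R \<or> right_angled m I"
  shows thin_or_commuting
  unfolding thin_or_commuting_def
proof (intro ballI impI)
  fix s r x assume sr: "s \<in> S" "r \<in> S" and x: "x \<in> C" and ne: "s \<noteq> r" and fin: "finite (par {s, r})"
  have I: "{s, r} \<subseteq> S" "card {s, r} = 2" using sr ne by auto
  have "is_residue \<Delta> {s, r} (res {s, r} x)" using is_residue_iff[OF I(1)] x by blast
  moreover have "spherical S m {s, r}" using spherical_iff[OF I(1)] fin by simp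
  ultimately have "thin \<Delta> {s, r} (res {s, r} x) \<or> right_angled m {s, r}" using H I by blast
  then show "gen s + gen r = gen r + gen s \<or> (\<forall>a\<in>{s, r}. \<forall>y\<in>res {s, r} x. card (res {a} y) = 2)"
  proof
    assume "right_angled m {s, r}"
    then have "m s r = 2 \<or> m s r = \<infinity>" using ne by (simp add: right_angled_def)
    then show ?thesis using cgen_commute_iff[OF matrix sr ne] infinite_par[OF sr] fin by blast
  next
    assume thin: "thin \<Delta> {s, r} (res {s, r} x)"
    have "card (res {a} y) = 2" if a: "a \<in> {s, r}" and y: "y \<in> res {s, r} x" for a y
    proof -
      have "{a} \<subseteq> S" "{a} \<subseteq> {s, r}" using a sr by auto
      then have "is_residue \<Delta> {a} (res {a} y)" using is_residue_iff[of "{a}"] res_C[OF y] by blast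
      moreover have "res {a} y \<subseteq> res {s, r} x"
        using res_mono[OF \<open>{a} \<subseteq> {s, r}\<close>, of y] res_eq[OF I(1) x y] by simp
      ultimately show ?thesis using thin a unfolding thin_def by blast
    qed
    then show ?thesis by blast
  qed
qed

lemma parallelism_equiv_iff:
  "equiv (residues_of S \<Delta>) (parallelism S \<Delta>) \<longleftrightarrow>
    (\<forall>I R. I \<subseteq> S \<and> card I = 2 \<and> is_residue \<Delta> I R \<and> spherical S m I \<longrightarrow>
      thin \<Delta> I R \<or> right_angled m I)" (is "_ \<longleftrightarrow> ?H")
  unfolding equiv_iff_trans
proof
  assume ?H
  then have H: thin_or_commuting by (rule thin_or_commutingI)
  show "trans (parallelism S \<Delta>)"
  proof (rule transI)
    fix R Q T assume *: "(R, Q) \<in> parallelism S \<Delta>" "(Q, T) \<in> parallelism S \<Delta>"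
    then obtain I r J q K p where "I \<subseteq> S" "J \<subseteq> S" "K \<subseteq> S" "r \<in> C" "q \<in> C" "p \<in> C"
      "R = res I r" "Q = res J q" "T = res K p"
      unfolding parallelism_iff residues_of_iff by blast
    then have "pll R T" using * parallel_trans[OF H] unfolding parallelism_iff by blast
    then show "(R, T) \<in> parallelism S \<Delta>" using * unfolding parallelism_iff by blast
  qed
next
  assume trans: "trans (parallelism S \<Delta>)"
  show ?H
  proof (intro allI impI, elim conjE, rule ccontr)
    fix I R assume I: "I \<subseteq> S" "card I = 2" "is_residue \<Delta> I R" "spherical S m I"
      and neg: "\<not> (thin \<Delta> I R \<or> right_angled m I)"
    \<comment> \<open>\<open>a\<close> is the type of a panel with more than two chambers.
      Transitivity will fail for panels of the other type \<open>b\<close>.\<close>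
    then obtain a P where P: "a \<in> I" "is_residue \<Delta> {a} P" "card P \<noteq> 2" unfolding thin_def by blast
    then have aS: "a \<in> S" "{a} \<subseteq> S" using I by auto
    obtain b where b: "I = {a, b}" "a \<noteq> b" using I(2) P(1) by (auto simp: card_2_iff)
    have bS: "b \<in> S" using b I by auto
    obtain x where x: "x \<in> C" "P = res {a} x" using P(2) is_residue_iff[OF aS(2)] by blast
    have fin: "finite (par {a, b})" using I(4) spherical_iff[OF I(1)] b by simp
    have "m b a = m a b" using matrix aS bS by (simp add: coxeter_matrix_def)
    then have "m a b \<noteq> 2" using neg b unfolding right_angled_def by auto
    then have nc: "gen a + gen b \<noteq> gen b + gen a" using cgen_commute_iff[OF matrix aS(1) bS b(2)] by blast
    have "card (res {a} x) \<noteq> 2" using P(3) x(2) by simp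
    then obtain x2 x3 t y where *: "x2 \<in> C" "x3 \<in> C" "t \<in> S" "y \<in> C"
      "pll (res {b} x2) (res {t} y)" "pll (res {t} y) (res {b} x3)" "\<not> pll (res {b} x2) (res {b} x3)"
      by (rule not_parallel_trans[OF aS(1) bS fin nc x(1)])
    have "res {b} x2 \<in> residues_of S \<Delta>" "res {b} x3 \<in> residues_of S \<Delta>" "res {t} y \<in> residues_of S \<Delta>"
      unfolding residues_of_iff using * bS by blast+
    then have "(res {b} x2, res {t} y) \<in> parallelism S \<Delta>" "(res {t} y, res {b} x3) \<in> parallelism S \<Delta>"
      using *(5,6) by (simp_all add: parallelism_iff)
    then have "(res {b} x2, res {b} x3) \<in> parallelism S \<Delta>" using trans by (meson transD)
    then show False using *(7) by (simp add: parallelism_iff)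
  qed
qed

end

theorem theorem1p1:
  fixes S :: "'s set" and m :: "'s \<Rightarrow> 's \<Rightarrow> enat" and \<Delta> :: "('c, 's) chamber_system"
  assumes "coxeter_matrix S m"
    and "building S m \<Delta>"
  shows "equiv (residues_of S \<Delta>) (parallelism S \<Delta>) \<longleftrightarrow>
    (\<forall>I R. I \<subseteq> S \<and> card I = 2 \<and> is_residue \<Delta> I R \<and> spherical S m I \<longrightarrow>
      thin \<Delta> I R \<or> right_angled m I)"
proof -
  obtain \<A> where "is_chamber_system S \<Delta>" "apartment_system S m \<Delta> \<A>"
    using assms(2) unfolding building_def by blast
  then interpret apartments S m \<Delta> \<A>
    using assms(1) by unfold_locales
  show ?thesis by (rule parallelism_equiv_iff)
qed

end
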